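(* Consider the Mixing method with a step size $\theta>0$, that is, cyclically for $i=1,\ldots,n$, $v_i := \dfrac{v_i-\theta\sum_{j=1}^n c_{ij}v_j}{\|v_i-\theta\sum_{j=1}^n c_{ij}v_j\|}$. Take $k>\sqrt{2n}$ and $\theta\in\left(0,\frac{1}{\max_i\|c_i\|_1}\right)$, where $\|\cdot\|_1$ denotes the $1$-norm. Then for almost every $C$, the method converges to a global optimum almost surely under random initialization.
   Context: Let $C\in\mathbb{R}^{n\times n}$ be a symmetric cost matrix with columns $c_i$ and (w.l.o.g.) $c_{ii}=0$. The problem is $\min_{V\in\mathbb{R}^{k\times n}}\langle C,V^TV\rangle$ subject to $\|v_i\|=1$ for all $i$ ($v_i$ the $i$-th column of $V$, $\|\cdot\|$ the Euclidean norm), the low-rank form of the SDP $\min_{X\succeq0}\langle C,X\rangle$ s.t. $X_{ii}=1$; a global optimum means $V^TV$ is optimal for this SDP. Random initialization: any distribution on the product of unit spheres that assigns zero probability to zero-volume sets (e.g., normalized spherical Gaussian). *)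

theory Defs
  imports "HOL-Analysis.Analysis"
begin

text \<open>Matrices indexed by nat, entries with indices < n relevant.
  A configuration V assigns to each index i < n a column v_i in R^k (type real^'k).\<close>

definition sym_zero_diag :: "(nat \<times> nat \<Rightarrow> real) \<Rightarrow> nat \<Rightarrow> nat \<Rightarrow> real" where
  "sym_zero_diag u i j = (if i < j then u (i, j) else if j < i then u (j, i) else 0)"

text \<open>Parameter space of symmetric zero-diagonal n x n matrices with Lebesgue measure.\<close>
definition cost_space :: "nat \<Rightarrow> (nat \<times> nat \<Rightarrow> real) measure" where
  "cost_space n = PiM {(i, j). i < j \<and> j < n} (\<lambda>_. lborel)"

definition init_space :: "nat \<Rightarrow> (nat \<Rightarrow> real ^ 'k) measure" where
  "init_space n = PiM {..<n} (\<lambda>_. lborel)"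

definition col_norm1 :: "nat \<Rightarrow> (nat \<Rightarrow> nat \<Rightarrow> real) \<Rightarrow> nat \<Rightarrow> real" where
  "col_norm1 n C i = (\<Sum>j<n. \<bar>C j i\<bar>)"

definition max_col_norm1 :: "nat \<Rightarrow> (nat \<Rightarrow> nat \<Rightarrow> real) \<Rightarrow> real" where
  "max_col_norm1 n C = Max (col_norm1 n C ` {..<n})"

definition mix_step :: "nat \<Rightarrow> (nat \<Rightarrow> nat \<Rightarrow> real) \<Rightarrow> real \<Rightarrow> (nat \<Rightarrow> real ^ 'k) \<Rightarrow> nat \<Rightarrow> (nat \<Rightarrow> real ^ 'k)" where
  "mix_step n C \<theta> V i =
     (let w = V i - \<theta> *\<^sub>R (\<Sum>j<n. C i j *\<^sub>R V j) in V(i := (1 / norm w) *\<^sub>R w))"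

definition mix_sweep :: "nat \<Rightarrow> (nat \<Rightarrow> nat \<Rightarrow> real) \<Rightarrow> real \<Rightarrow> (nat \<Rightarrow> real ^ 'k) \<Rightarrow> (nat \<Rightarrow> real ^ 'k)" where
  "mix_sweep n C \<theta> V = fold (\<lambda>i W. mix_step n C \<theta> W i) [0..<n] V"

definition mix_iter :: "nat \<Rightarrow> (nat \<Rightarrow> nat \<Rightarrow> real) \<Rightarrow> real \<Rightarrow> (nat \<Rightarrow> real ^ 'k) \<Rightarrow> nat \<Rightarrow> (nat \<Rightarrow> real ^ 'k)" where
  "mix_iter n C \<theta> V0 t = (mix_sweep n C \<theta> ^^ t) V0"

definition psd :: "nat \<Rightarrow> (nat \<Rightarrow> nat \<Rightarrow> real) \<Rightarrow> bool" where
  "psd n X \<longleftrightarrow> (\<forall>i<n. \<forall>j<n. X i j = X j i) \<and>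
      (\<forall>x :: nat \<Rightarrow> real. 0 \<le> (\<Sum>i<n. \<Sum>j<n. x i * X i j * x j))"

definition gram :: "(nat \<Rightarrow> real ^ 'k) \<Rightarrow> nat \<Rightarrow> nat \<Rightarrow> real" where
  "gram V i j = V i \<bullet> V j"

definition frob :: "nat \<Rightarrow> (nat \<Rightarrow> nat \<Rightarrow> real) \<Rightarrow> (nat \<Rightarrow> nat \<Rightarrow> real) \<Rightarrow> real" where
  "frob n C X = (\<Sum>i<n. \<Sum>j<n. C i j * X i j)"

definition global_opt :: "nat \<Rightarrow> (nat \<Rightarrow> nat \<Rightarrow> real) \<Rightarrow> (nat \<Rightarrow> real ^ 'k) \<Rightarrow> bool" where
  "global_opt n C V \<longleftrightarrow> (\<forall>i<n. norm (V i) = 1) \<and>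
     (\<forall>X. psd n X \<and> (\<forall>i<n. X i i = 1) \<longrightarrow> frob n C (gram V) \<le> frob n C X)"

definition converges_to_global_opt :: "nat \<Rightarrow> (nat \<Rightarrow> nat \<Rightarrow> real) \<Rightarrow> real \<Rightarrow> (nat \<Rightarrow> real ^ 'k) \<Rightarrow> bool" where
  "converges_to_global_opt n C \<theta> V0 \<longleftrightarrow>
     (\<exists>Vs. (\<forall>i<n. (\<lambda>t. mix_iter n C \<theta> V0 t i) \<longlonglongrightarrow> Vs i) \<and> global_opt n C Vs)"

end

(*
Write S = C - diag(lambda) for the multiplier matrix of a critical configuration V, so that S V^T = 0.

Every sweep decreases the objective by at least |step|^2 / theta and moves at least proportionally to the
Riemannian gradient.  If every critical V is Morse--Bott (the kernel of the Hessian is the tangent space of its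
O(k)-orbit), rotating a nearby point to be aligned with V gives |f - f(V)| <= K |grad f|^2, hence every orbit
converges to a critical point.

Morse--Bott holds for almost every C: on an index set J where S_JJ is invertible of full rank, C and the
squared column norms are a polynomial function of (S_JJ, kernel basis, Gram matrix of the other columns),
between spaces of equal dimension, and a failure of Morse--Bott makes this a critical value (Sard), or the
Gram matrix a boundary point of the positive semidefinite cone.

Morse--Bott and k(k+1)/2 > n force V to be rank deficient; a unit vector u orthogonal to all columns turns a
negative direction z of S into the negative direction u z^T of the Hessian, so either S is positive
semidefinite and V is globally optimal, or V is a strict saddle.  Near a saddle the cone
{q(d) <= -eta |d|^2} of the Hessian form q is invariant and expanded by the sweep, because the linearised
sweep decreases q by |step|^2 / theta.  Hence a line in the direction u z^T meets the set of starting points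
trapped near the saddle at most once, and disjoint translates show that this set is null.  Lifting a sweep
to unnormalised columns gives injective maps with locally Lipschitz inverse, so preimages of null sets are
null, and Lindeloef covers all saddles.
*)
theory Submission
  imports Defs
begin

section \<open>Preliminaries from analysis and measure theory\<close>

text \<open>Three obstacles shape the proof. Rotations carry critical points to critical points, so
  these are not isolated: degeneracy can be excluded only modulo rotations, and convergence of an
  orbit needs a length estimate. Sard's theorem yields a null set of pairs (cost matrix, squared
  column norms), while the problem lives on the slice of unit norms, itself null; since v_i -> s_i
  v_i together with c_ij -> c_ij / (s_i s_j) preserves criticality, a degenerate C fills a whole
  fibre over the norms, and Fubini applies. Finally, the linearised sweep is a product of
  noncommuting partial steps with no accessible spectrum; the Hessian form replaces eigenvectors,
  and the differences of two trapped orbits are followed directly instead of building a stable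
  manifold. Degeneracy depends on C alone, so a single null set of cost matrices serves every
  admissible step size.\<close>

lemma psd_frob_nonneg:
  assumes "psd n S" "psd n X"
  shows "0 \<le> frob n S X"
  using assms
proof (induction n arbitrary: X)
  case 0
  then show ?case by (simp add: frob_def)
next
  case (Suc n)
  have symS: "S i j = S j i" and symX: "X i j = X j i" if "i \<le> n" "j \<le> n" for i j
    using Suc.prems that by (auto simp: psd_def less_Suc_eq_le)
  have posS: "0 \<le> (\<Sum>i<Suc n. \<Sum>j<Suc n. x i * S i j * x j)"
    and posX: "0 \<le> (\<Sum>i<Suc n. \<Sum>j<Suc n. x i * X i j * x j)" for x :: "nat \<Rightarrow> real"
    using Suc.prems by (auto simp: psd_def)
  have split: "(\<Sum>i<Suc n. \<Sum>j<Suc n. x i * Y i j * x j) =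
      (\<Sum>i<n. \<Sum>j<n. x i * Y i j * x j) + 2 * x n * (\<Sum>i<n. x i * Y i n) + x n * Y n n * x n"
    if "\<And>i. i < n \<Longrightarrow> Y n i = Y i n" for x :: "nat \<Rightarrow> real" and Y :: "nat \<Rightarrow> nat \<Rightarrow> real"
  proof -
    have "(\<Sum>j<n. x n * Y n j * x j) = (\<Sum>i<n. x i * Y i n * x n)"
      using that by (intro sum.cong) auto
    moreover have "(\<Sum>i<n. x i * Y i n * x n) = x n * (\<Sum>i<n. x i * Y i n)"
      by (simp add: sum_distrib_left mult_ac)
    ultimately show ?thesis
      by (simp add: sum.distrib algebra_simps)
  qed
  have "psd n S"
    unfolding psd_def
  proof (intro conjI allI impI)
    show "S i j = S j i" if "i < n" "j < n" for i j
      using symS[of i j] that by simp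
  next
    fix x :: "nat \<Rightarrow> real"
    have *: "(\<Sum>i<n. \<Sum>j<n. (x(n:=0)) i * S i j * (x(n:=0)) j) = (\<Sum>i<n. \<Sum>j<n. x i * S i j * x j)"
      by (intro sum.cong) auto
    show "0 \<le> (\<Sum>i<n. \<Sum>j<n. x i * S i j * x j)"
      using posS[of "x(n:=0)"] * by (subst (asm) split) (auto simp: symS)
  qed
  have diag: "0 \<le> X n n"
  proof -
    have "(\<Sum>i<n. \<Sum>j<n. (if i = n then 1 else 0) * X i j * (if j = n then 1 else 0)) = (0::real)"
      by (intro sum.neutral) auto
    then show ?thesis
      using posX[of "\<lambda>i. if i = n then 1 else 0"] by (subst (asm) split) (auto simp: symX)
  qed
  \<comment> \<open>Symmetric elimination of the last index of \<open>X\<close>: a zero pivot forces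
    a zero last column, a positive pivot \<open>a\<close> splits off the rank-one matrix (column
    \<open>n\<close>)(column \<open>n\<close>)^T / \<open>a\<close>, whose pairing with
    \<open>S\<close> is a value of the form of \<open>S\<close>. No spectral theorem enters.\<close>
  show ?case
  proof (cases "X n n = 0")
    case True
    have z: "X i n = 0" if "i < n" for i
    proof (rule ccontr)
      assume normalized: "X i n \<noteq> 0"
      \<comment> \<open>This \<open>t\<close> gives the form of \<open>X\<close> the value -1 at the
        vector with entry 1 at \<open>i\<close> and \<open>t\<close> at \<open>n\<close>.\<close>
      define t where "t = - (X i i + 1) / (2 * X i n)"
      define x where "x = (\<lambda>j. if j = i then 1 else if j = n then t else (0::real))"
      have xs: "x i = 1" "x n = t" "\<And>j. j < n \<Longrightarrow> j \<noteq> i \<Longrightarrow> x j = 0" using that by (auto simp: x_def)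
      have 1: "(\<Sum>j<n. x j * X j n) = X i n"
        using that by (subst sum.remove[of _ i]) (auto simp: xs)
      have 2: "(\<Sum>l<n. \<Sum>j<n. x l * X l j * x j) = X i i"
      proof -
        have "(\<Sum>l<n. \<Sum>j<n. x l * X l j * x j) = (\<Sum>j<n. x i * X i j * x j)"
          using that by (subst sum.remove[of _ i]) (auto simp: xs intro!: sum.neutral)
        also have "\<dots> = X i i"
          using that by (subst sum.remove[of _ i]) (auto simp: xs)
        finally show ?thesis .
      qed
      have "0 \<le> X i i + 2 * t * X i n"
        using posX[of x] by (subst (asm) split) (auto simp: symX 1 2 xs True)
      moreover have "2 * t * X i n = - (X i i + 1)" using normalized by (simp add: t_def)
      ultimately show False by linarith
    qed
    have "psd n X"
      unfolding psd_def
    proof (intro conjI allI impI)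
      show "X i j = X j i" if "i < n" "j < n" for i j
        using symX[of i j] that by simp
    next
      fix x :: "nat \<Rightarrow> real"
      show "0 \<le> (\<Sum>i<n. \<Sum>j<n. x i * X i j * x j)"
        using posX[of x] by (subst (asm) split) (auto simp: symX True z)
    qed
    then have "0 \<le> frob n S X" using Suc.IH \<open>psd n S\<close> by simp
    moreover have "frob (Suc n) S X = frob n S X"
      using z symX True by (simp add: frob_def)
    ultimately show ?thesis by simp
  next
    case False
    define a where "a = X n n"
    have a: "a > 0" using False diag a_def by simp
    define X' where "X' = (\<lambda>i j. X i j - X i n * X j n / a)"
    have "psd n X'"
      unfolding psd_def
    proof (intro conjI allI impI)
      show "X' i j = X' j i" if "i < n" "j < n" for i j
        using symX[of i j] that by (simp add: X'_def)
    next
      fix x :: "nat \<Rightarrow> real"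
      define b where "b = (\<Sum>i<n. x i * X i n)"
      \<comment> \<open>The last coordinate minimises the form of \<open>X\<close> over all
        extensions of \<open>x\<close>; the minimum is the form of the Schur complement
        \<open>X'\<close>.\<close>
      define y where "y = x(n := - b / a)"
      have ys: "y n = - b/a" "\<And>i. i < n \<Longrightarrow> y i = x i" by (auto simp: y_def)
      have 1: "(\<Sum>i<n. y i * X i n) = b" unfolding b_def by (intro sum.cong) (auto simp: ys)
      have 2: "(\<Sum>i<n. \<Sum>j<n. y i * X i j * y j) = (\<Sum>i<n. \<Sum>j<n. x i * X i j * x j)"
        by (intro sum.cong) (auto simp: ys)
      have bb: "b * b = (\<Sum>i<n. \<Sum>j<n. x i * (X i n * X j n) * x j)"
        unfolding b_def sum_product by (intro sum.cong) (auto simp: mult_ac)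
      have "(\<Sum>i<n. \<Sum>j<n. x i * X' i j * x j) = (\<Sum>i<n. \<Sum>j<n. x i * X i j * x j) - b * b / a"
        unfolding bb X'_def by (simp add: sum_divide_distrib right_diff_distrib left_diff_distrib sum_subtractf)
      also have "\<dots> = (\<Sum>i<n. \<Sum>j<n. x i * X i j * x j) + 2 * y n * b + y n * a * y n"
        using a by (simp add: ys field_simps)
      also have "\<dots> = (\<Sum>i<Suc n. \<Sum>j<Suc n. y i * X i j * y j)"
        by (subst split) (auto simp: symX 1 2 a_def)
      also have "\<dots> \<ge> 0" by (rule posX)
      finally show "0 \<le> (\<Sum>i<n. \<Sum>j<n. x i * X' i j * x j)" .
    qed
    then have 1: "0 \<le> frob n S X'" using Suc.IH \<open>psd n S\<close> by simp
    have "frob (Suc n) S X = frob n S X' + (\<Sum>i<Suc n. \<Sum>j<Suc n. X i n * S i j * X j n) / a"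
    proof -
      have "frob (Suc n) S X - (\<Sum>i<Suc n. \<Sum>j<Suc n. X i n * S i j * X j n) / a =
         (\<Sum>i<Suc n. \<Sum>j<Suc n. S i j * X' i j)"
        unfolding frob_def X'_def by (simp add: sum_divide_distrib sum_subtractf algebra_simps sum.distrib diff_divide_distrib add_divide_distrib)
      moreover have "X' i n = 0" "X' n i = 0" if "i \<le> n" for i
        using a that symX[of i n] by (auto simp: X'_def a_def)
      ultimately show ?thesis by (simp add: frob_def)
    qed
    then show ?thesis using 1 a posS[of "\<lambda>i. X i n"] by simp
  qed
qed

text \<open>The kernel of \<open>T\<close> contributes nothing to the form, and on its orthogonal
  complement \<open>T\<close> is injective, hence bounded below. In \<open>sweep_gap\<close> this
  bounds the Hessian form by a squared gradient without any assumption on the rank.\<close>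

lemma selfadjoint_form_bound:
  fixes T :: "'a::euclidean_space \<Rightarrow> 'a"
  assumes lin: "linear T" and sa: "\<And>x y. T x \<bullet> y = x \<bullet> T y"
  obtains c where "c > 0" "\<And>x. \<bar>x \<bullet> T x\<bar> \<le> c * (norm (T x))\<^sup>2"
proof -
  define K where "K = {x. T x = 0}"
  define S where "S = {x. \<forall>y\<in>K. orthogonal x y}"
  have K: "subspace K" unfolding K_def using lin by (rule linear_subspace_kernel)
  have S: "subspace S"
    unfolding S_def subspace_def by (auto simp: orthogonal_def inner_add_left)
  have "\<exists>e>0. \<forall>x\<in>S. norm (T x) \<ge> e * norm x"
  proof (rule injective_imp_isometric)
    show "\<forall>x\<in>S. T x = 0 \<longrightarrow> x = 0"
      by (auto simp: S_def K_def orthogonal_def)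
  qed (use S lin in \<open>auto simp: closed_subspace linear_conv_bounded_linear[symmetric]\<close>)
  then obtain e where e: "e > 0" "\<And>x. x \<in> S \<Longrightarrow> e * norm x \<le> norm (T x)" by auto
  have "\<bar>x \<bullet> T x\<bar> \<le> (1/e) * (norm (T x))\<^sup>2" for x
  proof -
    obtain y z where yz: "y \<in> span K" "\<And>w. w \<in> span K \<Longrightarrow> orthogonal z w" "x = y + z"
      using orthogonal_subspace_decomp_exists[of K x] by blast
    have "T y = 0" using yz(1) K by (simp add: span_eq_iff[THEN iffD2] K_def)
    then have Tx: "T x = T z" using lin yz(3) by (simp add: linear_add)
    have zS: "z \<in> S" unfolding S_def using yz(2) span_base by auto
    have "x \<bullet> T x = z \<bullet> T z"
      using sa[of y z] \<open>T y = 0\<close> Tx yz(3) by (simp add: inner_add_left)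
    then have "\<bar>x \<bullet> T x\<bar> \<le> norm z * norm (T z)" by (simp add: Cauchy_Schwarz_ineq2)
    also have "\<dots> \<le> (norm (T z) / e) * norm (T z)"
      using e(2)[OF zS] e(1) by (intro mult_right_mono) (auto simp: field_simps)
    finally show ?thesis using Tx by (simp add: power2_eq_square)
  qed
  then show ?thesis using that[of "1/e"] e(1) by simp
qed

text \<open>Two nearby points are compared with each other and not only with \<open>x\<close>. This
  is what two orbits near a fixed point require: their difference is propagated by \<open>A\<close>
  up to an error relative to that difference itself.\<close>

definition strict_deriv :: "('a::real_normed_vector \<Rightarrow> 'b::real_normed_vector) \<Rightarrow> ('a \<Rightarrow> 'b) \<Rightarrow> 'a \<Rightarrow> bool" where
  "strict_deriv f A x \<longleftrightarrow> bounded_linear A \<and>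
     (\<forall>e>0. \<exists>d>0. \<forall>y\<in>ball x d. \<forall>z\<in>ball x d. norm (f z - f y - A (z - y)) \<le> e * norm (z - y))"

lemma strict_derivD:
  assumes "strict_deriv f A x" "e > 0"
  obtains d where "d > 0" "\<And>y z. y \<in> ball x d \<Longrightarrow> z \<in> ball x d \<Longrightarrow> norm (f z - f y - A (z - y)) \<le> e * norm (z - y)"
  using assms unfolding strict_deriv_def by meson

lemma strict_deriv_bounded_linear: "bounded_linear A \<Longrightarrow> strict_deriv A A x"
  unfolding strict_deriv_def
  by (auto simp: bounded_linear.linear linear_diff intro!: exI[of _ 1])

lemma strict_deriv_add:
  assumes f: "strict_deriv f A x" and g: "strict_deriv g B x"
  shows "strict_deriv (\<lambda>y. f y + g y) (\<lambda>h. A h + B h) x"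
  unfolding strict_deriv_def
proof (intro conjI allI impI)
  show "bounded_linear (\<lambda>h. A h + B h)"
    using f g by (auto simp: strict_deriv_def intro: bounded_linear_add)
next
  fix e :: real assume "e > 0"
  then have "e/2 > 0" by simp
  from strict_derivD[OF f this] obtain d1 where d1: "d1 > 0"
    "\<And>y z. y \<in> ball x d1 \<Longrightarrow> z \<in> ball x d1 \<Longrightarrow> norm (f z - f y - A (z - y)) \<le> e/2 * norm (z - y)" by metis
  from strict_derivD[OF g \<open>e/2 > 0\<close>] obtain d2 where d2: "d2 > 0"
    "\<And>y z. y \<in> ball x d2 \<Longrightarrow> z \<in> ball x d2 \<Longrightarrow> norm (g z - g y - B (z - y)) \<le> e/2 * norm (z - y)" by metis
  show "\<exists>d>0. \<forall>y\<in>ball x d. \<forall>z\<in>ball x d.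
          norm (f z + g z - (f y + g y) - (A (z - y) + B (z - y))) \<le> e * norm (z - y)"
  proof (intro exI[of _ "min d1 d2"] conjI ballI)
    fix y z assume "y \<in> ball x (min d1 d2)" "z \<in> ball x (min d1 d2)"
    then have "norm (f z - f y - A (z - y)) \<le> e/2 * norm (z - y)" "norm (g z - g y - B (z - y)) \<le> e/2 * norm (z - y)"
      using d1 d2 by auto
    moreover have "f z + g z - (f y + g y) - (A (z - y) + B (z - y)) = (f z - f y - A (z - y)) + (g z - g y - B (z - y))"
      by simp
    ultimately show "norm (f z + g z - (f y + g y) - (A (z - y) + B (z - y))) \<le> e * norm (z - y)"
      using norm_triangle_ineq[of "f z - f y - A (z - y)" "g z - g y - B (z - y)"] by (simp only:)
  qed (use d1 d2 in auto)
qed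

lemma strict_deriv_compose:
  assumes f: "strict_deriv f A x" and g: "strict_deriv g B (f x)"
  shows "strict_deriv (\<lambda>y. g (f y)) (\<lambda>h. B (A h)) x"
  unfolding strict_deriv_def
proof (intro conjI allI impI)
  have bA: "bounded_linear A" and bB: "bounded_linear B" using f g by (auto simp: strict_deriv_def)
  show "bounded_linear (\<lambda>h. B (A h))"
    using bA bB by (rule bounded_linear_compose[rotated])
  fix e :: real assume e: "e > 0"
  obtain KA where KA: "KA > 0" "\<And>h. norm (A h) \<le> norm h * KA" using bounded_linear.pos_bounded[OF bA] by auto
  obtain KB where KB: "KB > 0" "\<And>h. norm (B h) \<le> norm h * KB" using bounded_linear.pos_bounded[OF bB] by auto
  \<comment> \<open>\<open>e1 \<le> 1\<close> gives \<open>f\<close> the Lipschitz constant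
    \<open>KA + 1\<close> near \<open>x\<close>; \<open>e1 * KB\<close> and
    \<open>e2 * (KA + 1)\<close> each cost at most \<open>e/2\<close>.\<close>
  define e1 where "e1 = min 1 (e / (2 * KB))"
  define e2 where "e2 = e / (2 * (KA + 1))"
  have e12: "e1 > 0" "e2 > 0" "e1 \<le> 1" using e KA KB by (auto simp: e1_def e2_def)
  obtain d1 where d1: "d1 > 0"
    "\<And>y z. y \<in> ball x d1 \<Longrightarrow> z \<in> ball x d1 \<Longrightarrow> norm (f z - f y - A (z - y)) \<le> e1 * norm (z - y)"
    using strict_derivD[OF f e12(1)] by metis
  obtain d2 where d2: "d2 > 0"
    "\<And>y z. y \<in> ball (f x) d2 \<Longrightarrow> z \<in> ball (f x) d2 \<Longrightarrow> norm (g z - g y - B (z - y)) \<le> e2 * norm (z - y)"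
    using strict_derivD[OF g e12(2)] by metis
  have lip: "norm (f z - f y) \<le> (KA + 1) * norm (z - y)" if "y \<in> ball x d1" "z \<in> ball x d1" for y z
  proof -
    have "norm (f z - f y) \<le> norm (f z - f y - A (z - y)) + norm (A (z - y))"
      using norm_triangle_ineq[of "f z - f y - A (z - y)" "A (z - y)"] by simp
    also have "\<dots> \<le> 1 * norm (z - y) + norm (z - y) * KA"
      using d1(2)[OF that] KA(2)[of "z - y"] e12(3) mult_right_mono[of e1 1 "norm (z - y)"] by auto
    finally show ?thesis by (simp add: algebra_simps)
  qed
  define d where "d = min d1 (d2 / (KA + 1))"
  have d: "d > 0" "d \<le> d1" "d * (KA + 1) \<le> d2" using d1 d2 KA by (auto simp: d_def pos_le_divide_eq[symmetric])
  have inb: "f y \<in> ball (f x) d2" if "y \<in> ball x d" for y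
  proof -
    have "norm (f y - f x) \<le> (KA + 1) * norm (y - x)" using that d d1 by (intro lip) auto
    also have "\<dots> < (KA + 1) * d" using that KA by (intro mult_strict_left_mono) (auto simp: dist_norm norm_minus_commute)
    finally show ?thesis using d by (simp add: dist_norm norm_minus_commute mult.commute)
  qed
  show "\<exists>d>0. \<forall>y\<in>ball x d. \<forall>z\<in>ball x d. norm (g (f z) - g (f y) - B (A (z - y))) \<le> e * norm (z - y)"
  proof (intro exI[of _ d] conjI ballI)
    fix y z assume yz: "y \<in> ball x d" "z \<in> ball x d"
    then have yz1: "y \<in> ball x d1" "z \<in> ball x d1" using d by auto
    have "g (f z) - g (f y) - B (A (z - y)) = (g (f z) - g (f y) - B (f z - f y)) + B (f z - f y - A (z - y))"
      using bB by (simp add: bounded_linear.linear linear_diff)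
    then have "norm (g (f z) - g (f y) - B (A (z - y))) \<le> norm (g (f z) - g (f y) - B (f z - f y)) + norm (B (f z - f y - A (z - y)))"
      by (simp only: norm_triangle_ineq)
    also have "\<dots> \<le> e2 * norm (f z - f y) + norm (f z - f y - A (z - y)) * KB"
      using d2(2)[OF inb[OF yz(1)] inb[OF yz(2)]] KB(2) by (intro add_mono) auto
    also have "\<dots> \<le> e2 * ((KA + 1) * norm (z - y)) + (e1 * norm (z - y)) * KB"
      using lip[OF yz1] d1(2)[OF yz1] e12 KB by (intro add_mono mult_left_mono mult_right_mono) auto
    also have "\<dots> \<le> e/2 * norm (z - y) + e/2 * norm (z - y)"
    proof (intro add_mono)
      show "e2 * ((KA + 1) * norm (z - y)) \<le> e/2 * norm (z - y)"
        using KA by (simp add: e2_def field_simps)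
      have "e1 * KB \<le> e/2" using KB by (auto simp: e1_def min_def field_simps)
      then show "(e1 * norm (z - y)) * KB \<le> e/2 * norm (z - y)"
        using mult_right_mono[of "e1 * KB" "e/2" "norm (z - y)"] by (simp add: mult_ac)
    qed
    finally show "norm (g (f z) - g (f y) - B (A (z - y))) \<le> e * norm (z - y)" by simp
  qed (use d in auto)
qed

lemma has_derivative_sgn:
  fixes w :: "'a::real_inner"
  assumes w: "w \<noteq> 0"
  shows "(sgn has_derivative (\<lambda>h. (h - (h \<bullet> sgn w) *\<^sub>R sgn w) /\<^sub>R norm w)) (at w)"
proof -
  have n: "(norm has_derivative (\<lambda>h. h \<bullet> sgn w)) (at w)" using has_derivative_norm[OF w] by (simp add: inner_commute)
  have "((\<lambda>x. inverse (norm x)) has_derivative (\<lambda>h. - (inverse (norm w) * (h \<bullet> sgn w) * inverse (norm w)))) (at w)"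
    using Deriv.has_derivative_inverse[OF _ n] w by simp
  from has_derivative_scaleR[OF this has_derivative_ident]
  have "((\<lambda>x. inverse (norm x) *\<^sub>R x) has_derivative (\<lambda>h. (h - (h \<bullet> sgn w) *\<^sub>R sgn w) /\<^sub>R norm w)) (at w)"
    by (rule has_derivative_eq_rhs) (auto simp: sgn_div_norm algebra_simps)
  moreover have "sgn = (\<lambda>x::'a. inverse (norm x) *\<^sub>R x)" by (rule ext) (simp add: sgn_div_norm divide_inverse_commute)
  ultimately show ?thesis by (simp only:)
qed

lemma strict_deriv_sgn:
  fixes w :: "'a::euclidean_space"
  assumes w: "w \<noteq> 0"
  shows "strict_deriv sgn (\<lambda>h. (h - (h \<bullet> sgn w) *\<^sub>R sgn w) /\<^sub>R norm w) w"
  unfolding strict_deriv_def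
proof (intro conjI allI impI)
  let ?f' = "\<lambda>x h. (h - (h \<bullet> sgn x) *\<^sub>R sgn x) /\<^sub>R norm x"
  show "bounded_linear (?f' w)"
    using has_derivative_bounded_linear[OF has_derivative_sgn[OF w]] .
  \<comment> \<open>Bounds the operator norm of the difference of the derivatives at
    \<open>x\<close> and \<open>w\<close>. It is continuous and vanishes at \<open>w\<close>, so the
    mean value inequality upgrades the ordinary derivatives to a strict one.\<close>
  define \<phi> where "\<phi> x = \<bar>inverse (norm x) - inverse (norm w)\<bar> + norm (sgn x - sgn w) * norm (sgn x /\<^sub>R norm x)
     + norm (sgn w) * norm (sgn x /\<^sub>R norm x - sgn w /\<^sub>R norm w)" for x :: 'a
  have "isCont \<phi> w" unfolding \<phi>_def using w by (intro continuous_intros isCont_sgn) auto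
  moreover have "\<phi> w = 0" by (simp add: \<phi>_def)
  ultimately have lim: "\<phi> \<midarrow>w\<rightarrow> 0" by (simp add: isCont_def)
  fix e :: real assume e: "e > 0"
  from LIM_D[OF lim e] obtain s where s: "s > 0" "\<And>x. x \<noteq> w \<Longrightarrow> norm (x - w) < s \<Longrightarrow> norm (\<phi> x - 0) < e" by blast
  have bd: "onorm (?f' x - ?f' w) \<le> e" if "x \<in> ball w s" for x
  proof (rule onorm_le)
    fix h
    have "\<phi> x \<le> e"
      using s(2)[of x] that \<open>\<phi> w = 0\<close> e by (cases "x = w") (auto simp: dist_norm norm_minus_commute abs_less_iff)
    have eq: "?f' x h - ?f' w h = (inverse (norm x) - inverse (norm w)) *\<^sub>R h - (h \<bullet> (sgn x - sgn w)) *\<^sub>R (sgn x /\<^sub>R norm x)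
        - (h \<bullet> sgn w) *\<^sub>R (sgn x /\<^sub>R norm x - sgn w /\<^sub>R norm w)"
      by (simp add: algebra_simps inner_diff_right scaleR_diff_right scaleR_diff_left)
    have "norm (?f' x h - ?f' w h) \<le> \<bar>inverse (norm x) - inverse (norm w)\<bar> * norm h + (norm h * norm (sgn x - sgn w)) * norm (sgn x /\<^sub>R norm x)
       + (norm h * norm (sgn w)) * norm (sgn x /\<^sub>R norm x - sgn w /\<^sub>R norm w)"
      unfolding eq
      by (intro norm_triangle_le_diff add_mono)
        (auto simp only: norm_scaleR intro!: mult_right_mono Cauchy_Schwarz_ineq2 norm_ge_zero order_refl mult_nonneg_nonneg abs_ge_zero)
    also have "\<dots> = \<phi> x * norm h" by (simp add: \<phi>_def algebra_simps)
    also have "\<dots> \<le> e * norm h" using \<open>\<phi> x \<le> e\<close> by (intro mult_right_mono) auto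
    finally show "norm ((?f' x - ?f' w) h) \<le> e * norm h" by simp
  qed
  show "\<exists>d>0. \<forall>y\<in>ball w d. \<forall>z\<in>ball w d. norm (sgn z - sgn y - ?f' w (z - y)) \<le> e * norm (z - y)"
  proof (intro exI[of _ "min s (norm w)"] conjI ballI)
    fix y z assume yz: "y \<in> ball w (min s (norm w))" "z \<in> ball w (min s (norm w))"
    have "norm (sgn z - sgn y - ?f' w (z - y)) \<le> norm (z - y) * e"
    proof (rule differentiable_bound_linearization[where S="ball w (min s (norm w))" and f'="?f'"])
      fix t :: real assume t: "t \<in> {0..1}"
      have "y + t *\<^sub>R (z - y) = (1 - t) *\<^sub>R y + t *\<^sub>R z" by (simp add: algebra_simps)
      then show "y + t *\<^sub>R (z - y) \<in> ball w (min s (norm w))"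
        using convexD_alt[OF convex_ball yz, of t] t by (simp del: mem_ball)
    next
      fix x assume "x \<in> ball w (min s (norm w))"
      then have "x \<noteq> 0" by auto
      then show "(sgn has_derivative ?f' x) (at x within ball w (min s (norm w)))"
        by (rule has_derivative_at_withinI[OF has_derivative_sgn])
    qed (use bd s w in auto)
    then show "norm (sgn z - sgn y - ?f' w (z - y)) \<le> e * norm (z - y)" by (simp add: mult.commute)
  qed (use s w in auto)
qed

text \<open>The translates of \<open>S\<close> by (i/N) e for i < N are pairwise disjoint, have
  equal measure and lie in one fixed ball, so N times the measure of \<open>S\<close> stays bounded
  in N.\<close>

lemma negligible_thin_translates:
  fixes S :: "'a::euclidean_space set"
  assumes S: "S \<in> sets lebesgue" and bd: "bounded S" and e: "e \<noteq> 0"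
    and thin: "\<And>x s. x \<in> S \<Longrightarrow> x + s *\<^sub>R e \<in> S \<Longrightarrow> s = 0"
  shows "negligible S"
proof -
  have Sm: "S \<in> lmeasurable" using S bd by (simp add: bounded_set_imp_lmeasurable)
  obtain B where B: "\<And>x. x \<in> S \<Longrightarrow> norm x \<le> B" using bd bounded_iff by blast
  define D where "D = cball (0::'a) (B + norm e)"
  have le: "real N * measure lebesgue S \<le> measure lebesgue D" for N :: nat
  proof (cases "N = 0")
    case True then show ?thesis by simp
  next
    case False
    define T where "T i = (+) ((real i / real N) *\<^sub>R e) ` S" for i
    have Tm: "T i \<in> lmeasurable" for i unfolding T_def using Sm by (rule measurable_translation)
    have "measure lebesgue (\<Union>i\<in>{..<N}. T i) = (\<Sum>i<N. measure lebesgue (T i))"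
    proof (rule measure_UNION')
      show "pairwise (\<lambda>i j. disjnt (T i) (T j)) {..<N}"
      proof (rule pairwiseI)
        fix i j :: nat assume ij: "i \<noteq> j"
        show "disjnt (T i) (T j)"
        proof (rule ccontr)
          assume "\<not> disjnt (T i) (T j)"
          then obtain x y where xy: "x \<in> S" "y \<in> S" "(real i / real N) *\<^sub>R e + x = (real j / real N) *\<^sub>R e + y"
            by (auto simp: disjnt_iff T_def)
          then have "y = x + (real i / real N - real j / real N) *\<^sub>R e"
            by (simp add: scaleR_diff_left algebra_simps)
          then have "real i / real N - real j / real N = 0" using thin xy by blast
          then show False using ij False by simp
        qed
      qed
    qed (use Tm in auto)
    also have "\<dots> = real N * measure lebesgue S"
      by (simp add: T_def measure_translation)
    finally have eq: "real N * measure lebesgue S = measure lebesgue (\<Union>i\<in>{..<N}. T i)" by simp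
    also have "\<dots> \<le> measure lebesgue D"
    proof (rule measure_mono_fmeasurable)
      show "(\<Union>i\<in>{..<N}. T i) \<subseteq> D"
      proof (clarsimp simp: T_def D_def)
        fix i x assume "i < N" "x \<in> S"
        have "norm ((real i / real N) *\<^sub>R e) \<le> norm e"
          using \<open>i < N\<close> mult_right_mono[of "real i / real N" 1 "norm e"] by simp
        then show "norm ((real i / real N) *\<^sub>R e + x) \<le> B + norm e"
          using B[OF \<open>x \<in> S\<close>] norm_triangle_ineq[of "(real i / real N) *\<^sub>R e" x] by linarith
      qed
      show "(\<Union>i\<in>{..<N}. T i) \<in> sets lebesgue" using Tm by (auto intro!: sets.finite_UN)
      show "D \<in> lmeasurable" by (simp add: D_def)
    qed
    finally show ?thesis .
  qed
  have "measure lebesgue S = 0"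
  proof (rule ccontr)
    assume "measure lebesgue S \<noteq> 0"
    then have "measure lebesgue S > 0" using measure_nonneg[of lebesgue S] by linarith
    then obtain N :: nat where "measure lebesgue D < real N * measure lebesgue S"
      using reals_Archimedean3 by blast
    then show False using le[of N] by simp
  qed
  then show ?thesis using Sm negligible_iff_measure by blast
qed

section \<open>Lebesgue measure on vectors and product measures\<close>

lemma measurable_vec_lambda_PiM:
  "(\<lambda>f. \<chi> i. f i) \<in> measurable (PiM UNIV (\<lambda>_::'m::finite. lborel :: 'b::euclidean_space measure)) borel"
proof (subst borel_measurable_euclidean_space, intro ballI)
    fix b :: "'b^'m" assume "b \<in> Basis"
    then obtain i u where b: "b = axis i u" "u \<in> Basis" by (auto simp: Basis_vec_def)
    then show "(\<lambda>f. (\<chi> i. f i) \<bullet> b) \<in> borel_measurable (PiM UNIV (\<lambda>_::'m. lborel :: 'b measure))"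
      by (simp add: inner_axis)
  qed
lemma lborel_vec_eq_distr_PiM:
  "(lborel :: ('b::euclidean_space ^ 'm::finite) measure) = distr (PiM UNIV (\<lambda>_. lborel)) borel (\<lambda>f. \<chi> i. f i)"
proof (rule lborel_eqI)
  note meas = measurable_vec_lambda_PiM[where 'm='m and 'b='b]
  interpret product_sigma_finite "\<lambda>_::'m. lborel :: 'b measure" by standard
  fix l u :: "'b^'m" assume lu: "\<And>b. b \<in> Basis \<Longrightarrow> l \<bullet> b \<le> u \<bullet> b"
  have le: "l $ i \<bullet> b \<le> u $ i \<bullet> b" if "b \<in> Basis" for i b
    using lu[of "axis i b"] that by (auto simp: inner_axis Basis_vec_def)
  have eq: "(\<lambda>f. \<chi> i. f i) -` box l u \<inter> space (PiM UNIV (\<lambda>_::'m. lborel :: 'b measure)) = Pi\<^sub>E UNIV (\<lambda>i. box (l $ i) (u $ i))"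
    by (auto simp: box_def Basis_vec_def inner_axis space_PiM)
  have "emeasure (distr (PiM UNIV (\<lambda>_. lborel)) borel (\<lambda>f. \<chi> i. f i)) (box l u) = emeasure (PiM UNIV (\<lambda>_::'m. lborel :: 'b measure)) (Pi\<^sub>E UNIV (\<lambda>i. box (l $ i) (u $ i)))"
    using meas by (subst emeasure_distr) (auto simp: eq)
  also have "\<dots> = (\<Prod>i\<in>UNIV. emeasure lborel (box (l $ i) (u $ i)))"
    by (rule emeasure_PiM) auto
  also have "\<dots> = (\<Prod>i\<in>UNIV. ennreal (\<Prod>b\<in>Basis. (u $ i - l $ i) \<bullet> b))"
    using le by (intro prod.cong refl) (simp add: emeasure_lborel_box)
  also have "\<dots> = ennreal (\<Prod>i\<in>UNIV. \<Prod>b\<in>Basis. (u $ i - l $ i) \<bullet> b)"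
    using le by (subst prod_ennreal) (auto intro!: prod_nonneg simp: inner_diff_left)
  also have "(\<Prod>i\<in>UNIV. \<Prod>b\<in>Basis. (u $ i - l $ i) \<bullet> b) = (\<Prod>b\<in>Basis. (u - l) \<bullet> b)"
  proof -
    have "(\<Prod>b\<in>Basis. (u - l) \<bullet> b) = (\<Prod>b\<in>(\<lambda>(i, v). axis i v) ` (UNIV \<times> (Basis::'b set)). (u - l) \<bullet> b)"
      by (intro prod.cong) (auto simp: Basis_vec_def)
    also have "\<dots> = (\<Prod>(i,v)\<in>UNIV \<times> (Basis::'b set). (u - l) \<bullet> axis i v)"
      by (subst prod.reindex) (auto simp: inj_on_def axis_eq_axis split_def)
    finally show ?thesis by (simp add: inner_axis prod.cartesian_product)
  qed
  finally show "emeasure (distr (PiM UNIV (\<lambda>_. lborel)) borel (\<lambda>f. \<chi> i. f i)) (box l u) = ennreal (\<Prod>b\<in>Basis. (u - l) \<bullet> b)" .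
qed simp

text \<open>Fubini with spare coordinates: for almost every \<open>f\<close>, almost every filling
  of the coordinates outside the image of \<open>e\<close> avoids \<open>Z\<close>, so at least one
  filling does. The existential form matters, because the shadow of \<open>Z\<close> in the
  coordinates \<open>I\<close> need not be null. It serves both cost matrices and initial
  points.\<close>

lemma AE_PiM_of_negligible:
  fixes Z :: "('b::euclidean_space ^ 'm::finite) set" and e :: "'a \<Rightarrow> 'm"
  assumes I: "finite I" and e: "inj_on e I" and Z: "negligible Z"
  shows "AE f in PiM I (\<lambda>_. lborel). \<exists>x. (\<forall>i\<in>I. x $ e i = f i) \<and> x \<notin> Z"
proof -
  interpret A: product_sigma_finite "\<lambda>_::'m. lborel :: 'b measure" by standard
  interpret B: product_sigma_finite "\<lambda>_::'a. lborel :: 'b measure" by standard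
  define K where "K = - e ` I"
  have K: "UNIV = e ` I \<union> K" "e ` I \<inter> K = {}" by (auto simp: K_def)
  interpret PI: sigma_finite_measure "PiM (e ` I) (\<lambda>_::'m. lborel :: 'b measure)" by (rule A.sigma_finite) (use I in auto)
  interpret PK: sigma_finite_measure "PiM K (\<lambda>_::'m. lborel :: 'b measure)" by (rule A.sigma_finite) auto
  have "AE x in lborel. x \<notin> Z"
    using AE_not_in[of Z lebesgue] Z by (simp add: negligible_iff_null_sets AE_completion_iff)
  then have "AE f in PiM UNIV (\<lambda>_::'m. lborel). (\<chi> i. f i) \<notin> Z"
    unfolding lborel_vec_eq_distr_PiM by (rule AE_distrD[OF measurable_vec_lambda_PiM])
  then have "AE f in PiM (e ` I \<union> K) (\<lambda>_::'m. lborel). (\<chi> i. f i) \<notin> Z"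
    by (simp only: K)
  then have "AE p in distr (PiM (e ` I) (\<lambda>_::'m. lborel) \<Otimes>\<^sub>M PiM K (\<lambda>_::'m. lborel)) (PiM (e ` I \<union> K) (\<lambda>_::'m. lborel)) (merge (e ` I) K).
      (\<chi> i. p i) \<notin> Z"
    unfolding A.distr_merge[OF K(2) finite_imageI[OF I] finite] .
  then have "AE p in PiM (e ` I) (\<lambda>_::'m. lborel) \<Otimes>\<^sub>M PiM K (\<lambda>_::'m. lborel). (\<chi> i. merge (e ` I) K p i) \<notin> Z"
    by (rule AE_distrD[OF measurable_merge])
  then have "AE f in PiM (e ` I) (\<lambda>_::'m. lborel). AE g in PiM K (\<lambda>_::'m. lborel). (\<chi> i. merge (e ` I) K (f, g) i) \<notin> Z"
    by (rule pair_sigma_finite.AE_pair[rotated]) (rule pair_sigma_finite.intro PI.sigma_finite_measure_axioms PK.sigma_finite_measure_axioms)+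
  then have 1: "AE f in PiM (e ` I) (\<lambda>_::'m. lborel). \<exists>x. (\<forall>i\<in>I. x $ e i = f (e i)) \<and> x \<notin> Z"
  proof eventually_elim
    case (elim f)
    \<comment> \<open>The spare factor is never a null space: its total measure is infinite, or 1 if
      there are no spare coordinates.\<close>
    have "\<not> (AE g in PiM K (\<lambda>_::'m. lborel :: 'b measure). False)"
    proof
      assume "AE g in PiM K (\<lambda>_::'m. lborel :: 'b measure). False"
      then have "emeasure (PiM K (\<lambda>_::'m. lborel :: 'b measure)) (Pi\<^sub>E K (\<lambda>_. UNIV)) = 0"
        by (simp add: AE_iff_null space_PiM null_sets_def)
      then show False by (subst (asm) A.emeasure_PiM) auto
    qed
    then obtain g where "(\<chi> i. merge (e ` I) K (f, g) i) \<notin> Z"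
      using elim by (metis (mono_tags, lifting) eventually_mono)
    then show ?case by (intro exI[of _ "\<chi> i. merge (e ` I) K (f, g) i"]) (auto simp: merge_def)
  qed
  \<comment> \<open>Renaming of indices along \<open>e\<close>, which carries one product measure to
    the other.\<close>
  define h where "h f = (\<lambda>m\<in>e ` I. f (the_inv_into I e m))" for f :: "'a \<Rightarrow> 'b"
  have hm: "h \<in> measurable (PiM I (\<lambda>_. lborel)) (PiM (e ` I) (\<lambda>_. lborel))"
    unfolding h_def using e by (intro measurable_restrict) (auto simp: the_inv_into_into the_inv_into_f_f)
  have deq: "distr (PiM I (\<lambda>_. lborel)) (PiM (e ` I) (\<lambda>_. lborel)) h = PiM (e ` I) (\<lambda>_. lborel)"
  proof (rule A.PiM_eqI)
    fix A :: "'m \<Rightarrow> 'b set" assume A: "\<And>i. i \<in> e ` I \<Longrightarrow> A i \<in> sets lborel"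
    have vi: "h -` Pi\<^sub>E (e ` I) A \<inter> space (PiM I (\<lambda>_. lborel)) = Pi\<^sub>E I (\<lambda>i. A (e i))"
      using e by (auto simp: h_def space_PiM PiE_iff the_inv_into_f_f)
    show "emeasure (distr (PiM I (\<lambda>_. lborel)) (PiM (e ` I) (\<lambda>_. lborel)) h) (Pi\<^sub>E (e ` I) A) = (\<Prod>i\<in>e ` I. emeasure lborel (A i))"
      using A I e hm by (subst emeasure_distr) (auto simp: vi B.emeasure_PiM prod.reindex intro!: sets_PiM_I_finite)
  qed (use I in auto)
  have "AE f in distr (PiM I (\<lambda>_. lborel)) (PiM (e ` I) (\<lambda>_. lborel)) h. \<exists>x. (\<forall>i\<in>I. x $ e i = f (e i)) \<and> x \<notin> Z"
    unfolding deq by (rule 1)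
  then have "AE f in PiM I (\<lambda>_. lborel). \<exists>x. (\<forall>i\<in>I. x $ e i = h f (e i)) \<and> x \<notin> Z"
    using hm by (rule AE_distrD[rotated])
  then show ?thesis
    by (rule AE_mp) (auto simp: h_def e the_inv_into_f_f[OF e])
qed
text \<open>Let \<open>E t\<close> be the square root of the remaining energy above a cluster point
  \<open>v\<close>. Near \<open>v\<close>, \<open>loj\<close> and \<open>grad\<close> give
  \<open>E t \<le> M * s t\<close> for the step length \<open>s t\<close>, so the descent a * s_t^2
  <= E_t^2 - E_(t+1)^2 becomes \<open>s t \<le> C * (E t - E (Suc t))\<close>. These bounds
  telescope, and an orbit that once comes close enough to \<open>v\<close> cannot leave.\<close>

lemma loj_convergence:
  fixes x :: "nat \<Rightarrow> 'a::euclidean_space" and \<phi> :: "'a \<Rightarrow> real" and p :: "'a \<Rightarrow> 'b::real_normed_vector"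
  assumes K: "compact K" and xK: "\<And>t. x t \<in> K"
    and \<phi>: "continuous_on K \<phi>" and p: "continuous_on K p"
    and a: "a > 0" and desc: "\<And>t. a * (norm (x (Suc t) - x t))\<^sup>2 \<le> \<phi> (x t) - \<phi> (x (Suc t))"
    and grad: "\<And>t. norm (p (x t)) \<le> B * norm (x (Suc t) - x t)"
    and loj: "\<And>v. v \<in> K \<Longrightarrow> p v = 0 \<Longrightarrow> \<exists>C \<delta>. \<delta> > 0 \<and> (\<forall>y\<in>K \<inter> ball v \<delta>. \<bar>\<phi> y - \<phi> v\<bar> \<le> C * (norm (p y))\<^sup>2)"
  obtains v where "v \<in> K" "p v = 0" "x \<longlonglongrightarrow> v"
proof -
  have dec: "\<phi> (x (Suc t)) \<le> \<phi> (x t)" for t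
    using desc[of t] a by (smt (verit) mult_nonneg_nonneg zero_le_power2)
  then have anti: "decseq (\<lambda>t. \<phi> (x t))" by (rule decseq_SucI)
  obtain v r where v: "v \<in> K" "strict_mono (r :: nat \<Rightarrow> nat)" "(x \<circ> r) \<longlonglongrightarrow> v"
    using K xK unfolding compact_def by blast
  have \<phi>r: "(\<lambda>t. \<phi> (x (r t))) \<longlonglongrightarrow> \<phi> v"
    using continuous_on_tendsto_compose[OF \<phi> v(3) v(1)] xK by (simp add: o_def)
  have ge: "\<phi> v \<le> \<phi> (x t)" for t
  proof (rule LIMSEQ_le_const2[OF \<phi>r], intro exI allI impI)
    fix n assume "t \<le> n"
    then have "t \<le> r n" using seq_suble[OF v(2), of n] by simp
    then show "\<phi> (x (r n)) \<le> \<phi> (x t)" using anti by (simp add: decseq_def)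
  qed
  have \<phi>lim: "(\<lambda>t. \<phi> (x t)) \<longlonglongrightarrow> \<phi> v"
  proof -
    obtain l where l: "(\<lambda>t. \<phi> (x t)) \<longlonglongrightarrow> l"
      using decseq_convergent[OF anti, of "\<phi> v"] ge by blast
    then have "(\<lambda>t. \<phi> (x (r t))) \<longlonglongrightarrow> l"
      using LIMSEQ_subseq_LIMSEQ[OF l v(2)] by (simp add: o_def)
    then show ?thesis using l LIMSEQ_unique[OF _ \<phi>r] by blast
  qed
  have s0: "(\<lambda>t. norm (x (Suc t) - x t)) \<longlonglongrightarrow> 0"
  proof -
    have "(\<lambda>t. (\<phi> (x t) - \<phi> (x (Suc t))) / a) \<longlonglongrightarrow> (\<phi> v - \<phi> v) / a"
      by (intro tendsto_intros \<phi>lim LIMSEQ_Suc) (use a in auto)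
    then have "(\<lambda>t. (\<phi> (x t) - \<phi> (x (Suc t))) / a) \<longlonglongrightarrow> 0" by simp
    then have "(\<lambda>t. (norm (x (Suc t) - x t))\<^sup>2) \<longlonglongrightarrow> 0"
      by (rule Lim_null_comparison[rotated]) (use desc a in \<open>auto simp: field_simps\<close>)
    then show ?thesis using tendsto_real_sqrt by fastforce
  qed
  have "(\<lambda>t. B * norm (x (Suc t) - x t)) \<longlonglongrightarrow> 0" using tendsto_mult_right_zero[OF s0] .
  then have p0: "(\<lambda>t. p (x t)) \<longlonglongrightarrow> 0"
    by (rule Lim_null_comparison[rotated]) (use grad in auto)
  have pv: "p v = 0"
  proof -
    have "(\<lambda>t. p (x (r t))) \<longlonglongrightarrow> p v"
      using continuous_on_tendsto_compose[OF p v(3) v(1)] xK by (simp add: o_def)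
    moreover have "(\<lambda>t. p (x (r t))) \<longlonglongrightarrow> 0" using LIMSEQ_subseq_LIMSEQ[OF p0 v(2)] by (simp add: o_def)
    ultimately show ?thesis by (rule LIMSEQ_unique)
  qed
  obtain C0 \<delta> where \<delta>: "\<delta> > 0" and lo: "\<And>y. y \<in> K \<inter> ball v \<delta> \<Longrightarrow> \<bar>\<phi> y - \<phi> v\<bar> \<le> C0 * (norm (p y))\<^sup>2"
    using loj[OF v(1) pv] by blast
  define E where "E t = sqrt (\<phi> (x t) - \<phi> v)" for t
  define s where "s t = norm (x (Suc t) - x t)" for t
  have E0: "E \<longlonglongrightarrow> 0"
    unfolding E_def using tendsto_real_sqrt[OF tendsto_diff[OF \<phi>lim tendsto_const[of "\<phi> v"]]] by simp
  have Epos: "E t \<ge> 0" for t unfolding E_def using ge by simp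
  have Esq: "(E t)\<^sup>2 = \<phi> (x t) - \<phi> v" for t unfolding E_def using ge by simp
  have Edec: "E (Suc t) \<le> E t" for t unfolding E_def using dec by simp
  define M where "M = \<bar>B\<bar> * sqrt \<bar>C0\<bar> + 1"
  have M: "M > 0" unfolding M_def by (smt (verit) abs_ge_zero mult_nonneg_nonneg real_sqrt_ge_zero)
  define C where "C = 2 * M / a"
  have C: "C > 0" using M a by (simp add: C_def)
  have step: "s t \<le> C * (E t - E (Suc t))" if "x t \<in> ball v \<delta>" for t
  proof (cases "s t = 0")
    case True then show ?thesis using C Edec[of t] by simp
  next
    case False
    then have sp: "s t > 0" by (simp add: s_def)
    have "(E t)\<^sup>2 \<le> \<bar>C0\<bar> * (norm (p (x t)))\<^sup>2"
      unfolding Esq using lo[of "x t"] that xK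
      by (smt (verit, ccfv_SIG) IntI mult_right_mono zero_le_power2)
    also have "\<dots> \<le> \<bar>C0\<bar> * (\<bar>B\<bar> * s t)\<^sup>2"
    proof (intro mult_left_mono power_mono)
      show "norm (p (x t)) \<le> \<bar>B\<bar> * s t"
        using grad[of t] mult_right_mono[OF abs_ge_self[of B], of "s t"] by (simp add: s_def)
    qed auto
    finally have "E t \<le> sqrt (\<bar>C0\<bar> * (\<bar>B\<bar> * s t)\<^sup>2)" using real_le_rsqrt by blast
    also have "\<dots> = \<bar>B\<bar> * sqrt \<bar>C0\<bar> * s t" using sp by (simp add: real_sqrt_mult abs_mult)
    also have "\<dots> \<le> M * s t" using sp by (simp add: M_def mult_right_mono algebra_simps)
    finally have EM: "E t \<le> M * s t" .
    have "a * (s t)\<^sup>2 \<le> (E t)\<^sup>2 - (E (Suc t))\<^sup>2" unfolding Esq s_def using desc[of t] by simp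
    also have "\<dots> = (E t - E (Suc t)) * (E t + E (Suc t))" by (simp add: power2_eq_square algebra_simps)
    also have "\<dots> \<le> (E t - E (Suc t)) * (2 * M * s t)"
      using Edec[of t] EM by (intro mult_left_mono) auto
    finally have "s t * (a * s t) \<le> s t * (2 * M * (E t - E (Suc t)))"
      by (simp add: power2_eq_square mult_ac)
    then have "a * s t \<le> 2 * M * (E t - E (Suc t))" using sp by simp
    then show ?thesis using a by (simp add: C_def field_simps)
  qed
  have "x \<longlonglongrightarrow> v"
  proof (rule LIMSEQ_I)
    fix e :: real assume e: "e > 0"
    \<comment> \<open>\<open>x T\<close> lies within \<open>e'\<close> of \<open>v\<close> and the
      path after \<open>T\<close> is shorter than \<open>e'\<close>; twice \<open>e'\<close> fits
      both into \<open>e\<close> and into the ball of radius \<delta> where \<open>step\<close>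
      applies.\<close>
    define e' where "e' = min e \<delta> / 2"
    have e': "e' > 0" "2 * e' \<le> e" "2 * e' \<le> \<delta>" using e \<delta> by (auto simp: e'_def min_def)
    have "\<forall>\<^sub>F t in sequentially. E t < e' / C"
      using order_tendstoD(2)[OF E0] e' C by simp
    then obtain N where N: "\<And>t. t \<ge> N \<Longrightarrow> E t < e' / C" by (auto simp: eventually_sequentially)
    obtain N' where N': "\<And>t. t \<ge> N' \<Longrightarrow> dist ((x \<circ> r) t) v < e'"
      using metric_LIMSEQ_D[OF v(3) e'(1)] by blast
    define T where "T = r (max N N')"
    have T: "T \<ge> N" "dist (x T) v < e'"
      using seq_suble[OF v(2), of "max N N'"] N'[of "max N N'"] by (auto simp: T_def)
    have CE: "C * E T < e'" using N[OF T(1)] C by (simp add: field_simps)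
    have ind: "norm (x (T + k) - x T) \<le> C * (E T - E (T + k))" for k
    proof (induction k)
      case 0 then show ?case by simp
    next
      case (Suc k)
      have "norm (x (T + k) - x T) \<le> C * E T - C * E (T + k)" using Suc by (simp add: algebra_simps)
      also have "\<dots> < e'" using CE C Epos[of "T + k"] by (smt (verit) mult_nonneg_nonneg)
      finally have "norm (x (T + k) - x T) < e'" .
      then have "x (T + k) \<in> ball v \<delta>"
        using T(2) e' dist_triangle[of "x (T+k)" v "x T"] by (simp add: dist_norm norm_minus_commute)
      then have "s (T + k) \<le> C * (E (T + k) - E (Suc (T + k)))" by (rule step)
      then show ?case
        using Suc norm_triangle_ineq[of "x (T + Suc k) - x (T + k)" "x (T + k) - x T"]
        by (simp add: s_def algebra_simps)
    qed
    show "\<exists>no. \<forall>n\<ge>no. norm (x n - v) < e"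
    proof (intro exI[of _ T] allI impI)
      fix n assume "T \<le> n"
      then obtain k where k: "n = T + k" using le_Suc_ex by blast
      have "norm (x n - x T) \<le> C * E T - C * E n" using ind[of k] k by (simp add: algebra_simps)
      also have "\<dots> < e'" using CE C Epos[of n] by (smt (verit) mult_nonneg_nonneg)
      finally have "dist (x n) (x T) < e'" by (simp add: dist_norm)
      then have "dist (x n) v < e" using T(2) e' dist_triangle[of "x n" v "x T"] by simp
      then show "norm (x n - v) < e" by (simp add: dist_norm)
    qed
  qed
  then show ?thesis using that v(1) pv by blast
qed

section \<open>The sweep and its descent property\<close>

text \<open>For unit columns this is the orthogonal projection onto the tangent space of the product
  of spheres, so \<open>proj x (G x)\<close> will be half the Riemannian gradient of
  \<open>f\<close>. A zero column of \<open>v\<close> leaves the column of \<open>d\<close>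
  unchanged.\<close>

definition proj :: "'e::euclidean_space^'i \<Rightarrow> 'e^'i \<Rightarrow> 'e^'i::finite" where
  "proj v d = (\<chi> i. d $ i - (d $ i \<bullet> v $ i) *\<^sub>R v $ i)"

text \<open>\<open>R\<close> is an arbitrary matrix: orthogonal ones give the symmetry orbit, skew
  ones its tangent vectors, and a symmetric one produces the Hessian kernel vector of
  \<open>crit_rank_deficient\<close>.\<close>

definition rot :: "real^'k^'k \<Rightarrow> real^'k^'i \<Rightarrow> real^'k^'i::finite" where
  "rot R x = (\<chi> i. R *v x $ i)"

text \<open>The number of columns must be able to vary while Euclidean configuration spaces need an index type,
  so only the indices in \<open>A\<close> are active; the remaining columns of a configuration are zero.\<close>

locale mixing =
  fixes A :: "'i::finite set" and c :: "'i \<Rightarrow> 'i \<Rightarrow> real" and \<theta> :: real and xs :: "'i list"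
  assumes c_sym: "c i j = c j i" and c_diag: "c i i = 0" and c_out: "i \<notin> A \<Longrightarrow> c i j = 0"
    and set_xs: "set xs = A" and distinct_xs: "distinct xs"
    and \<theta>_pos: "\<theta> > 0" and \<theta>_less: "\<theta> * (\<Sum>j\<in>UNIV. \<bar>c i j\<bar>) < 1"
begin

definition G :: "real^'k^'i \<Rightarrow> real^'k^'i" where
  "G x = (\<chi> i. \<Sum>j\<in>UNIV. c i j *\<^sub>R x $ j)"

definition f :: "real^'k^'i \<Rightarrow> real" where "f x = x \<bullet> G x"

definition configs :: "(real^'k^'i) set" where
  "configs = {x. (\<forall>i\<in>A. norm (x $ i) = 1) \<and> (\<forall>i. i \<notin> A \<longrightarrow> x $ i = 0)}"

definition step_map :: "'i \<Rightarrow> real^'k^'i \<Rightarrow> real^'k^'i" where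
  "step_map i x = (\<chi> j. if j = i then sgn (x $ i - \<theta> *\<^sub>R G x $ i) else x $ j)"

definition sweep :: "real^'k^'i \<Rightarrow> real^'k^'i" where "sweep x = fold step_map xs x"

definition crit :: "real^'k^'i \<Rightarrow> bool" where "crit v \<longleftrightarrow> v \<in> configs \<and> proj v (G v) = 0"

definition lam :: "real^'k^'i \<Rightarrow> 'i \<Rightarrow> real" where "lam v i = G v $ i \<bullet> v $ i"

text \<open>Half the Hessian of the Lagrangian of \<open>f\<close> under the unit-norm constraints,
  with multipliers \<open>lam v\<close>. At a critical \<open>v\<close> its form on
  \<open>tangent v\<close> is half the Riemannian Hessian form.\<close>

definition L :: "real^'k^'i \<Rightarrow> real^'k^'i \<Rightarrow> real^'k^'i" where
  "L v d = (\<chi> i. G d $ i - lam v i *\<^sub>R d $ i)"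

definition tangent :: "real^'k^'i \<Rightarrow> (real^'k^'i) set" where
  "tangent v = {d. (\<forall>i. d $ i \<bullet> v $ i = 0) \<and> (\<forall>i. i \<notin> A \<longrightarrow> d $ i = 0)}"

text \<open>Only this inclusion carries content: at a critical point \<open>rot \<Omega> v\<close>
  with skew \<open>\<Omega>\<close> is tangent and in the kernel anyway, because \<open>L v\<close>
  commutes with \<open>rot\<close> and annihilates \<open>v\<close>.\<close>

definition morse_bott :: "real^'k^'i \<Rightarrow> bool" where
  "morse_bott v \<longleftrightarrow> (\<forall>d\<in>tangent v. proj v (L v d) = 0 \<longrightarrow> (\<exists>\<Omega>. transpose \<Omega> = - \<Omega> \<and> d = rot \<Omega> v))"

lemma G_nth: "G x $ i = (\<Sum>j\<in>UNIV. c i j *\<^sub>R x $ j)" by (simp add: G_def)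

lemma linear_G: "linear G"
  by (rule linearI) (auto simp: G_def vec_eq_iff scaleR_add_right sum.distrib scaleR_sum_right mult.commute)

lemma G_add: "G (x + y) = G x + G y" by (rule linear_add[OF linear_G])
lemma G_diff: "G (x - y) = G x - G y" by (rule linear_diff[OF linear_G])
lemma G_scale: "G (r *\<^sub>R x) = r *\<^sub>R G x" by (rule linear_scale[OF linear_G])
lemma G_selfadj: "G x \<bullet> y = x \<bullet> G y"
proof -
  have "G x \<bullet> y = (\<Sum>i\<in>UNIV. \<Sum>j\<in>UNIV. c i j * (x $ j \<bullet> y $ i))"
    unfolding inner_vec_def[of "G x"] by (simp add: G_nth inner_sum_left)
  also have "\<dots> = (\<Sum>j\<in>UNIV. \<Sum>i\<in>UNIV. c j i * (x $ j \<bullet> y $ i))"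
    by (subst sum.swap) (metis (no_types, lifting) c_sym sum.cong)
  also have "\<dots> = x \<bullet> G y"
    unfolding inner_vec_def[of x] by (simp add: G_nth inner_sum_right)
  finally show ?thesis .
qed

lemma continuous_on_G:
  fixes g :: "'a::euclidean_space \<Rightarrow> _"
  assumes "continuous_on S g"
  shows "continuous_on S (\<lambda>x. G (g x))"
  by (rule linear_continuous_on_compose[OF assms linear_G])

lemma continuous_on_proj: "continuous_on S (\<lambda>x. proj (g x) (h x))" if "continuous_on S g" "continuous_on S h"
  unfolding proj_def using that by (intro continuous_intros)

lemma G_out: "i \<notin> A \<Longrightarrow> G x $ i = 0" by (simp add: G_nth c_out)

lemma configs_norm: "x \<in> configs \<Longrightarrow> i \<in> A \<Longrightarrow> norm (x $ i) = 1" and configs_out: "x \<in> configs \<Longrightarrow> i \<notin> A \<Longrightarrow> x $ i = 0"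
  by (auto simp: configs_def)

lemma configs_norm_le: "x \<in> configs \<Longrightarrow> norm (x $ i) \<le> 1" by (cases "i \<in> A") (auto simp: configs_def)

lemma compact_configs: "compact configs"
proof -
  have "closed configs"
    unfolding configs_def Ball_def
    by (intro closed_Collect_conj closed_Collect_all closed_Collect_imp open_Collect_const closed_Collect_eq continuous_intros)
  moreover have "norm x \<le> real CARD('i)" if "x \<in> configs" for x
  proof -
    have "norm x \<le> (\<Sum>i\<in>UNIV. norm (x $ i))" by (simp add: norm_vec_def L2_set_le_sum)
    also have "\<dots> \<le> (\<Sum>i\<in>(UNIV::'i set). 1)" by (intro sum_mono configs_norm_le that)
    finally show ?thesis by simp
  qed
  then have "bounded configs" by (auto simp: bounded_iff)
  ultimately show ?thesis by (simp add: compact_eq_bounded_closed)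
qed

lemma norm_G_nth_less:
  assumes "\<And>j. norm (x $ j) \<le> 1"
  shows "norm (\<theta> *\<^sub>R G x $ i) < 1"
proof -
  have "norm (G x $ i) \<le> (\<Sum>j\<in>UNIV. \<bar>c i j\<bar>)"
    unfolding G_nth by (rule order_trans[OF norm_sum]) (auto intro!: sum_mono mult_left_le simp: assms)
  then have "\<theta> * norm (G x $ i) \<le> \<theta> * (\<Sum>j\<in>UNIV. \<bar>c i j\<bar>)" using \<theta>_pos by simp
  then have "\<theta> * norm (G x $ i) < 1" using \<theta>_less[of i] by linarith
  then show ?thesis using \<theta>_pos by simp
qed

lemma step_map_nth: "step_map i x $ j = (if j = i then sgn (x $ i - \<theta> *\<^sub>R G x $ i) else x $ j)"
  by (simp add: step_map_def)

lemma step_map_arg_nonzero: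
  assumes "x \<in> configs" "i \<in> A"
  shows "x $ i - \<theta> *\<^sub>R G x $ i \<noteq> 0"
  using norm_G_nth_less[of x i] configs_norm[OF assms] configs_norm_le[OF assms(1)] by auto

lemma step_map_configs: "x \<in> configs \<Longrightarrow> i \<in> A \<Longrightarrow> step_map i x \<in> configs"
  using step_map_arg_nonzero[of x i] by (auto simp: configs_def step_map_nth norm_sgn)

lemma fold_configs: "x \<in> configs \<Longrightarrow> set ys \<subseteq> A \<Longrightarrow> fold step_map ys x \<in> configs"
  by (induction ys arbitrary: x) (auto simp: step_map_configs)

lemma sweep_configs: "x \<in> configs \<Longrightarrow> sweep x \<in> configs" by (simp add: sweep_def fold_configs set_xs)

lemma funpow_sweep_configs: "x \<in> configs \<Longrightarrow> (sweep ^^ t) x \<in> configs" by (induction t) (auto simp: sweep_configs)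

lemma step_map_eq_add_axis: "step_map i x = x + axis i (step_map i x $ i - x $ i)"
  by (auto simp: vec_eq_iff axis_def step_map_nth)

lemma norm_axis_vec: "norm (axis i v :: 'e::euclidean_space^'i) = norm v"
proof -
  have "(norm (axis i v :: 'e^'i))\<^sup>2 = (norm v)\<^sup>2"
    by (simp add: power2_norm_eq_inner inner_axis inner_axis_axis)
  then show ?thesis by simp
qed

lemma step_facts:
  assumes x: "x \<in> configs" and i: "i \<in> A"
  defines "u \<equiv> step_map i x $ i" and "w \<equiv> x $ i - \<theta> *\<^sub>R G x $ i"
  shows "\<theta> *\<^sub>R G x $ i = x $ i - norm w *\<^sub>R u" "norm u = 1" "norm w \<le> 2"
proof -
  have w: "w \<noteq> 0" unfolding w_def by (rule step_map_arg_nonzero[OF x i])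
  have u: "u = sgn w" by (simp add: u_def w_def step_map_nth)
  then show "norm u = 1" using w by (simp add: norm_sgn)
  have "norm w *\<^sub>R u = w" using w by (simp add: u sgn_div_norm)
  then show "\<theta> *\<^sub>R G x $ i = x $ i - norm w *\<^sub>R u" by (simp add: w_def)
  show "norm w \<le> 2"
    using norm_triangle_ineq4[of "x $ i" "\<theta> *\<^sub>R G x $ i"] configs_norm[OF x i] norm_G_nth_less[of x i] configs_norm_le[OF x]
    by (simp add: w_def)
qed

text \<open>The zero diagonal of \<open>c\<close> makes \<open>f\<close> affine in column
  \<open>i\<close>. Rewriting \<theta> G x as x - |w| u evaluates the change exactly as -(1 + |w|) /
  \<theta> times the squared step; the surplus from |w| is dropped.\<close>

lemma step_descent:
  assumes x: "x \<in> configs" and i: "i \<in> A"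
  shows "(1/\<theta>) * (norm (step_map i x - x))\<^sup>2 \<le> f x - f (step_map i x)"
proof -
  define u where "u = step_map i x $ i"
  define w where "w = x $ i - \<theta> *\<^sub>R G x $ i"
  note sf = step_facts[OF x i, folded u_def w_def]
  define h where "h = axis i (u - x $ i)"
  have s: "step_map i x = x + h" using step_map_eq_add_axis[of i x] by (simp add: h_def u_def)
  have "G h $ i = 0" by (auto simp: G_nth h_def axis_def c_diag intro!: sum.neutral)
  then have hh: "h \<bullet> G h = 0" by (simp add: h_def inner_axis' )
  have "f (step_map i x) - f x = 2 * (h \<bullet> G x)"
  proof -
    have "x \<bullet> G h = h \<bullet> G x" using G_selfadj[of x h] by (metis inner_commute)
    then show ?thesis unfolding f_def s G_add inner_add_left inner_add_right hh by simp
  qed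
  also have "h \<bullet> G x = (u - x $ i) \<bullet> G x $ i" by (simp add: h_def inner_axis')
  finally have "\<theta> * (f (step_map i x) - f x) = 2 * ((u - x $ i) \<bullet> (\<theta> *\<^sub>R G x $ i))" by simp
  also have "\<dots> = 2 * ((u - x $ i) \<bullet> (x $ i - norm w *\<^sub>R u))" by (simp add: sf)
  also have "\<dots> = - (1 + norm w) * (norm (u - x $ i))\<^sup>2"
  proof -
    have uu: "u \<bullet> u = 1" using sf(2) by (simp add: norm_eq_1)
    have xx: "x $ i \<bullet> x $ i = 1" using configs_norm[OF x i] by (simp add: norm_eq_1)
    show ?thesis
      unfolding power2_norm_eq_inner inner_diff_left inner_diff_right inner_scaleR_right uu xx inner_commute[of "x $ i" u]
      by (simp add: algebra_simps)
  qed
  also have "\<dots> \<le> - (norm (u - x $ i))\<^sup>2" by (simp add: algebra_simps)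
  finally have "(norm (u - x $ i))\<^sup>2 \<le> \<theta> * (f x - f (step_map i x))" by (simp add: algebra_simps)
  moreover have "norm (step_map i x - x) = norm (u - x $ i)" by (simp add: s h_def norm_axis_vec)
  ultimately show ?thesis using \<theta>_pos by (simp add: field_simps)
qed

text \<open>Projecting \<theta> G x = x - |w| u off the column x_i leaves only -|w| times the
  projection of u - x_i, and |w| is at most 2.\<close>

lemma step_proj_bound:
  assumes x: "x \<in> configs" and i: "i \<in> A"
  shows "norm (proj x (G x) $ i) \<le> (2/\<theta>) * norm (step_map i x - x)"
proof -
  define u where "u = step_map i x $ i"
  define w where "w = x $ i - \<theta> *\<^sub>R G x $ i"
  note sf = step_facts[OF x i, folded u_def w_def]
  have xx: "x $ i \<bullet> x $ i = 1" using configs_norm[OF x i] by (simp add: norm_eq_1)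
  define P where "P y = y - (y \<bullet> x $ i) *\<^sub>R x $ i" for y
  have Pn: "norm (P y) \<le> norm y" for y
  proof -
    have "(norm (P y))\<^sup>2 = (norm y)\<^sup>2 - (y \<bullet> x $ i)\<^sup>2"
      unfolding power2_norm_eq_inner P_def inner_diff_left inner_diff_right inner_scaleR_left inner_scaleR_right xx
        inner_commute[of "x $ i" y]
      by (simp add: power2_eq_square)
    then have "(norm (P y))\<^sup>2 \<le> (norm y)\<^sup>2" by simp
    then show ?thesis by (rule power2_le_imp_le) simp
  qed
  have "\<theta> *\<^sub>R proj x (G x) $ i = P (\<theta> *\<^sub>R G x $ i)"
    by (simp add: proj_def P_def algebra_simps)
  also have "\<dots> = P (x $ i - norm w *\<^sub>R u)" by (simp add: sf)
  also have "\<dots> = - norm w *\<^sub>R P (u - x $ i)"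
    by (simp add: P_def inner_diff_left xx algebra_simps)
  finally have "norm (\<theta> *\<^sub>R proj x (G x) $ i) = norm (- norm w *\<^sub>R P (u - x $ i))" by (rule arg_cong)
  then have "\<theta> * norm (proj x (G x) $ i) = norm w * norm (P (u - x $ i))"
    using \<theta>_pos by simp
  also have "\<dots> \<le> 2 * norm (u - x $ i)" using sf(3) Pn by (intro mult_mono) auto
  also have "norm (u - x $ i) = norm (step_map i x - x)"
  proof -
    have "step_map i x - x = axis i (u - x $ i)" by (auto simp: vec_eq_iff axis_def u_def step_map_nth)
    then show ?thesis by (simp add: norm_axis_vec)
  qed
  finally show ?thesis using \<theta>_pos by (simp add: field_simps)
qed

text \<open>Different columns move in orthogonal directions and each is visited once, so squared
  steps add exactly and the descent constant of a single step survives. When column \<open>i\<close>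
  is visited it still has its value from \<open>x\<close>; the gradients at \<open>x\<close> and at
  the current point differ there only through \<open>G (y - x)\<close>, which costs the term
  \<open>2 * K\<close>.\<close>

lemma fold_facts:
  fixes x :: "real^'k^'i"
  assumes x: "x \<in> configs" and K: "\<And>d::real^'k^'i. norm (G d) \<le> K * norm d" and K0: "K \<ge> 0"
  shows "distinct ys \<Longrightarrow> set ys \<subseteq> A \<Longrightarrow>
    (\<forall>j. j \<notin> set ys \<longrightarrow> fold step_map ys x $ j = x $ j) \<and>
    (1/\<theta>) * (norm (fold step_map ys x - x))\<^sup>2 \<le> f x - f (fold step_map ys x) \<and>
    (\<forall>i\<in>set ys. norm (proj x (G x) $ i) \<le> (2/\<theta> + 2 * K) * norm (fold step_map ys x - x))"
proof (induction ys rule: rev_induct)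
  case Nil
  then show ?case by simp
next
  case (snoc i ys)
  define y where "y = fold step_map ys x"
  have IH: "\<And>j. j \<notin> set ys \<Longrightarrow> y $ j = x $ j" "(1/\<theta>) * (norm (y - x))\<^sup>2 \<le> f x - f y"
    "\<And>j. j \<in> set ys \<Longrightarrow> norm (proj x (G x) $ j) \<le> (2/\<theta> + 2 * K) * norm (y - x)"
  proof -
    have "distinct ys" "set ys \<subseteq> A" using snoc.prems by auto
    note ih = snoc.IH[OF this, folded y_def]
    show "\<And>j. j \<notin> set ys \<Longrightarrow> y $ j = x $ j" "(1/\<theta>) * (norm (y - x))\<^sup>2 \<le> f x - f y"
      "\<And>j. j \<in> set ys \<Longrightarrow> norm (proj x (G x) $ j) \<le> (2/\<theta> + 2 * K) * norm (y - x)"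
      using ih by blast+
  qed
  have i: "i \<notin> set ys" "i \<in> A" using snoc.prems by auto
  have y: "y \<in> configs" unfolding y_def using x snoc.prems by (intro fold_configs) auto
  have eq: "fold step_map (ys @ [i]) x = step_map i y" by (simp add: y_def)
  define h where "h = axis i (step_map i y $ i - y $ i)"
  have s: "step_map i y = y + h" using step_map_eq_add_axis[of i y] by (simp add: h_def)
  have orth: "(y - x) \<bullet> h = 0" using IH(1)[OF i(1)] by (simp add: h_def inner_axis)
  have pyth: "(norm (step_map i y - x))\<^sup>2 = (norm (y - x))\<^sup>2 + (norm (step_map i y - y))\<^sup>2"
  proof -
    have "step_map i y - x = (y - x) + h" "step_map i y - y = h" by (simp_all add: s)
    then show ?thesis using norm_add_Pythagorean[of "y - x" h] orth by (simp only: orthogonal_def)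
  qed
  have le1: "norm (y - x) \<le> norm (step_map i y - x)" and le2: "norm (step_map i y - y) \<le> norm (step_map i y - x)"
    by (rule power2_le_imp_le, simp add: pyth, simp)+
  have Kle: "K * norm (y - x) \<le> K * norm (step_map i y - x)"
    using le1 K0 by (rule mult_left_mono)
  have a: "(1/\<theta>) * (norm (step_map i y - x))\<^sup>2 \<le> f x - f (step_map i y)"
    using IH(2) step_descent[OF y i(2)] by (simp add: pyth algebra_simps add_divide_distrib)
  have b: "norm (proj x (G x) $ j) \<le> (2/\<theta> + 2 * K) * norm (step_map i y - x)" if "j \<in> insert i (set ys)" for j
  proof (cases "j = i")
    case True
    have yx: "y $ i = x $ i" by (rule IH(1)[OF i(1)])
    have "proj x (G x) $ i = proj y (G y) $ i - proj y (G (y - x)) $ i"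
      by (simp add: proj_def yx G_diff algebra_simps inner_diff_left)
    then have "norm (proj x (G x) $ i) \<le> norm (proj y (G y) $ i) + norm (proj y (G (y - x)) $ i)"
      by (metis norm_triangle_ineq4)
    also have "norm (proj y (G (y - x)) $ i) \<le> 2 * norm (G (y - x) $ i)"
    proof -
      have "norm (proj y (G (y - x)) $ i) \<le> norm (G (y - x) $ i) + norm (G (y - x) $ i) * norm (y $ i) * norm (y $ i)"
        unfolding proj_def by (simp, rule order_trans[OF norm_triangle_ineq4]) (simp add: Cauchy_Schwarz_ineq2 mult_right_mono)
      then show ?thesis using configs_norm[OF y i(2)] by simp
    qed
    also have "norm (G (y - x) $ i) \<le> K * norm (y - x)"
      using K[of "y - x"] Finite_Cartesian_Product.norm_nth_le[of "G (y - x)" i] by linarith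
    also have "norm (proj y (G y) $ i) \<le> (2/\<theta>) * norm (step_map i y - y)" by (rule step_proj_bound[OF y i(2)])
    also have "(2/\<theta>) * norm (step_map i y - y) \<le> (2/\<theta>) * norm (step_map i y - x)" using le2 \<theta>_pos by (simp add: divide_right_mono)
    finally show ?thesis using True Kle by (simp add: algebra_simps)
  next
    case False
    then have "norm (proj x (G x) $ j) \<le> (2/\<theta> + 2 * K) * norm (y - x)" using that by (intro IH(3)) auto
    also have "\<dots> \<le> (2/\<theta> + 2 * K) * norm (step_map i y - x)"
      using Kle mult_left_mono[OF le1, of "2/\<theta>"] \<theta>_pos by (simp add: algebra_simps)
    finally show ?thesis .
  qed
  have "step_map i y $ j = x $ j" if "j \<notin> set (ys @ [i])" for j using that IH(1) by (simp add: step_map_nth)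
  then show ?case unfolding eq using a b by (metis insert_iff list.set(2) rotate1.simps(2) set_rotate1)
qed

lemma sweep_descent:
  fixes x :: "real^'k^'i"
  assumes x: "x \<in> configs"
  shows "(1/\<theta>) * (norm (sweep x - x))\<^sup>2 \<le> f x - f (sweep x)"
proof -
  have b: "bounded_linear (G :: real^'k^'i \<Rightarrow> _)" using linear_G linear_conv_bounded_linear by blast
  have "norm (G d) \<le> onorm (G :: real^'k^'i \<Rightarrow> _) * norm d" for d :: "real^'k^'i" by (rule onorm[OF b])
  from fold_facts[OF x this onorm_pos_le[OF b] distinct_xs]
  show ?thesis by (auto simp: sweep_def set_xs)
qed

lemma sweep_proj_bound:
  obtains B where "\<And>x::real^'k^'i. x \<in> configs \<Longrightarrow> norm (proj x (G x)) \<le> B * norm (sweep x - x)"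
proof -
  obtain K where K: "\<And>d::real^'k^'i. norm (G d) \<le> K * norm d"
    using linear_bounded[OF linear_G] by blast
  have "norm (proj x (G x)) \<le> (real CARD('i) * (2/\<theta> + 2 * \<bar>K\<bar>)) * norm (sweep x - x)" if x: "x \<in> configs" for x :: "real^'k^'i"
  proof -
    have K': "norm (G d) \<le> \<bar>K\<bar> * norm d" for d :: "real^'k^'i"
      using K[of d] mult_right_mono[OF abs_ge_self[of K], of "norm d"] by simp
    have "norm (proj x (G x)) \<le> (\<Sum>i\<in>UNIV. norm (proj x (G x) $ i))" by (simp add: norm_vec_def L2_set_le_sum)
    also have "\<dots> \<le> (\<Sum>i\<in>(UNIV::'i set). (2/\<theta> + 2 * \<bar>K\<bar>) * norm (sweep x - x))"
    proof (rule sum_mono)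
      fix i
      show "norm (proj x (G x) $ i) \<le> (2/\<theta> + 2 * \<bar>K\<bar>) * norm (sweep x - x)"
      proof (cases "i \<in> A")
        case True
        then show ?thesis using fold_facts[OF x K' abs_ge_zero distinct_xs] by (simp add: sweep_def set_xs)
      next
        case False
        then show ?thesis using \<theta>_pos by (simp add: proj_def G_out)
      qed
    qed
    finally show ?thesis by simp
  qed
  then show ?thesis using that by blast
qed

end

section \<open>A Lojasiewicz inequality at Morse--Bott critical points\<close>

lemma inner_rot:
  assumes "\<And>x. norm (R *v x) = norm (x::real^'k)"
  shows "rot R x \<bullet> rot R y = x \<bullet> (y :: real^'k^'i::finite)"
proof -
  have "orthogonal_transformation ((*v) R)"
    using assms by (simp add: orthogonal_transformation)
  then have "(R *v a) \<bullet> (R *v b) = a \<bullet> b" for a b by (simp add: orthogonal_transformation_def)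
  then show ?thesis unfolding inner_vec_def[of "rot R x"] inner_vec_def[of x] by (simp add: rot_def)
qed

lemma linear_matrix_arg: "linear (\<lambda>R::real^'k^'l. R *v x)"
  by (rule linearI) (simp_all add: matrix_vector_mult_add_rdistrib scaleR_matrix_vector_assoc)

lemma compact_isometries: "compact {R::real^'k^'k. \<forall>x. norm (R *v x) = norm x}"
proof -
  have "closed {R::real^'k^'k. norm (R *v x) = norm x}" for x
    by (intro closed_Collect_eq continuous_intros linear_continuous_on linear_matrix_arg[unfolded linear_conv_bounded_linear])
  then have "closed {R::real^'k^'k. \<forall>x. norm (R *v x) = norm x}"
    by (intro closed_Collect_all)
  moreover have "norm R \<le> real CARD('k) * real CARD('k)" if R: "\<forall>x. norm (R *v x) = norm x" for R :: "real^'k^'k"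
  proof -
    have ent: "\<bar>R $ a $ b\<bar> \<le> 1" for a b
    proof -
      have "R $ a $ b = (R *v axis b 1) $ a" by (simp add: matrix_vector_mult_basis column_def)
      also have "\<bar>\<dots>\<bar> \<le> norm (R *v axis b 1)" by (rule component_le_norm_cart)
      also have "\<dots> = 1" using R by (simp add: norm_axis_1)
      finally show ?thesis .
    qed
    have "norm R \<le> (\<Sum>a\<in>UNIV. norm (R $ a))" by (simp add: norm_vec_def[of R] L2_set_le_sum)
    also have "\<dots> \<le> (\<Sum>a\<in>(UNIV::'k set). \<Sum>b\<in>(UNIV::'k set). 1)"
      by (intro sum_mono order_trans[OF norm_le_l1_cart] ent)
    finally show ?thesis by simp
  qed
  then have "bounded {R::real^'k^'k. \<forall>x. norm (R *v x) = norm x}" by (auto simp: bounded_iff)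
  ultimately show ?thesis by (simp add: compact_eq_bounded_closed)
qed

text \<open>Rotation by the angle \<open>t\<close> in a coordinate plane, written as the identity
  plus a correction in two coordinates. These one-parameter families already test every skew
  direction.\<close>

definition plane_rot :: "'k \<Rightarrow> 'k \<Rightarrow> real \<Rightarrow> real^'k^'k" where
  "plane_rot a b t = matrix (\<lambda>x. x + ((cos t - 1) * x $ a - sin t * x $ b) *\<^sub>R axis a 1 + ((cos t - 1) * x $ b + sin t * x $ a) *\<^sub>R axis b 1)"

lemma plane_rot_apply:
  fixes x :: "real^'k"
  shows
  "plane_rot a b t *v x = x + ((cos t - 1) * x $ a - sin t * x $ b) *\<^sub>R axis a 1 + ((cos t - 1) * x $ b + sin t * x $ a) *\<^sub>R axis b 1"
proof -
  have "linear (\<lambda>x::real^'k. x + ((cos t - 1) * x $ a - sin t * x $ b) *\<^sub>R axis a 1 + ((cos t - 1) * x $ b + sin t * x $ a) *\<^sub>R axis b 1)"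
    by (rule linearI) (simp_all add: vec_eq_iff algebra_simps)
  then show ?thesis unfolding plane_rot_def by (simp add: matrix_vector_mul)
qed

lemma norm_plane_rot:
  fixes x :: "real^'k"
  assumes "a \<noteq> b"
  shows "norm (plane_rot a b t *v x) = norm x"
proof -
  define p where "p = x $ a"
  define q where "q = x $ b"
  define \<alpha> where "\<alpha> = (cos t - 1) * p - sin t * q"
  define \<beta> where "\<beta> = (cos t - 1) * q + sin t * p"
  define ea where "ea = (axis a 1 :: real^'k)"
  define eb where "eb = (axis b 1 :: real^'k)"
  have ab: "ea \<bullet> ea = 1" "eb \<bullet> eb = 1" "ea \<bullet> eb = 0" "eb \<bullet> ea = 0" "x \<bullet> ea = p" "x \<bullet> eb = q" "ea \<bullet> x = p" "eb \<bullet> x = q"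
    using assms by (auto simp: ea_def eb_def inner_axis_axis inner_axis inner_axis' p_def q_def) (auto simp: axis_def)
  have "(norm (plane_rot a b t *v x))\<^sup>2 = (x + \<alpha> *\<^sub>R ea + \<beta> *\<^sub>R eb) \<bullet> (x + \<alpha> *\<^sub>R ea + \<beta> *\<^sub>R eb)"
    by (simp add: plane_rot_apply power2_norm_eq_inner \<alpha>_def \<beta>_def p_def q_def ea_def eb_def)
  also have "\<dots> = x \<bullet> x + 2 * \<alpha> * p + 2 * \<beta> * q + \<alpha>\<^sup>2 + \<beta>\<^sup>2"
    unfolding inner_add_left inner_add_right inner_scaleR_left inner_scaleR_right ab by (simp add: power2_eq_square algebra_simps)
  finally have n: "(norm (plane_rot a b t *v x))\<^sup>2 = x \<bullet> x + 2 * \<alpha> * p + 2 * \<beta> * q + \<alpha>\<^sup>2 + \<beta>\<^sup>2" .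
  have "2 * \<alpha> * p + 2 * \<beta> * q + \<alpha>\<^sup>2 + \<beta>\<^sup>2 = 0" if "\<alpha> = (c - 1) * p - s * q" "\<beta> = (c - 1) * q + s * p" "c\<^sup>2 + s\<^sup>2 = 1" for c s :: real
  proof -
    have "2 * \<alpha> * p + 2 * \<beta> * q + \<alpha>\<^sup>2 + \<beta>\<^sup>2 = (c\<^sup>2 + s\<^sup>2 - 1) * (p\<^sup>2 + q\<^sup>2)"
      unfolding that(1,2) by (simp add: power2_eq_square algebra_simps)
    then show ?thesis using that(3) by simp
  qed
  from this[OF \<alpha>_def \<beta>_def] n have "(norm (plane_rot a b t *v x))\<^sup>2 = (norm x)\<^sup>2"
    by (simp add: power2_norm_eq_inner)
  then show ?thesis by (rule power2_eq_imp_eq) auto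
qed

lemma cos_sin_max_imp:
  fixes P Q :: real
  assumes "\<And>t. (cos t - 1) * P + sin t * Q \<le> 0"
  shows "Q = 0"
proof -
  have "((\<lambda>t. (cos t - 1) * P + sin t * Q) has_real_derivative Q) (at 0)"
    by (auto intro!: derivative_eq_intros)
  then show ?thesis
    by (rule DERIV_local_max[where d=1]) (use assms in auto)
qed

text \<open>First-order condition at a maximum over O(k), taken along plane rotations only: it makes
  the cross matrix \<open>M\<close> symmetric, and a symmetric matrix pairs to zero with a skew
  one.\<close>

lemma skew_inner_zero:
  fixes y v :: "real^'k^'i::finite"
  assumes max: "\<And>R::real^'k^'k. (\<forall>x. norm (R *v x) = norm x) \<Longrightarrow> y \<bullet> rot R v \<le> y \<bullet> v"
    and skew: "transpose \<Omega> = - \<Omega>"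
  shows "y \<bullet> rot \<Omega> v = 0"
proof -
  define M where "M a b = (\<Sum>i\<in>UNIV. y $ i $ a * v $ i $ b)" for a b
  have sym: "M a b = M b a" for a b
  proof (cases "a = b")
    case False
    have "(cos t - 1) * (M a a + M b b) + sin t * (M b a - M a b) \<le> 0" for t
    proof -
      have "y \<bullet> rot (plane_rot a b t) v = y \<bullet> v + ((cos t - 1) * (M a a + M b b) + sin t * (M b a - M a b))"
        unfolding inner_vec_def[of y] rot_def M_def
        by (simp add: plane_rot_apply inner_add_right inner_axis sum.distrib sum_distrib_left sum_subtractf algebra_simps)
      then show ?thesis using max[of "plane_rot a b t"] norm_plane_rot[OF False] by simp
    qed
    from cos_sin_max_imp[OF this] show ?thesis by simp
  qed simp
  have sk: "\<Omega> $ b $ a = - \<Omega> $ a $ b" for a b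
    using arg_cong[OF skew, of "\<lambda>X. X $ a $ b"] by (simp add: transpose_def)
  have "y \<bullet> rot \<Omega> v = (\<Sum>i\<in>UNIV. \<Sum>a\<in>UNIV. \<Sum>b\<in>UNIV. \<Omega> $ a $ b * (y $ i $ a * v $ i $ b))"
    by (simp add: inner_vec_def rot_def matrix_vector_mult_def sum_distrib_left mult_ac)
  also have "\<dots> = (\<Sum>a\<in>UNIV. \<Sum>b\<in>UNIV. \<Omega> $ a $ b * M a b)"
    unfolding M_def sum_distrib_left
    by (subst sum.swap, intro sum.cong refl, subst sum.swap, rule refl)
  finally have 1: "y \<bullet> rot \<Omega> v = (\<Sum>a\<in>UNIV. \<Sum>b\<in>UNIV. \<Omega> $ a $ b * M a b)" .
  also have "\<dots> = (\<Sum>b\<in>UNIV. \<Sum>a\<in>UNIV. \<Omega> $ a $ b * M a b)" by (rule sum.swap)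
  also have "\<dots> = (\<Sum>b\<in>UNIV. \<Sum>a\<in>UNIV. - (\<Omega> $ b $ a * M b a))"
    by (intro sum.cong refl) (metis sk sym mult_minus_left)
  also have "\<dots> = - (y \<bullet> rot \<Omega> v)" unfolding 1 by (simp add: sum_negf)
  finally show ?thesis by simp
qed

section \<open>Exact expansions at critical points and alignment by rotations\<close>

context mixing begin

lemma G_rot: "G (rot R x) = rot R (G x)"
proof -
  have "G (rot R x) $ i = rot R (G x) $ i" for i
    unfolding G_nth rot_def vec_lambda_beta
    by (simp add: linear_sum[OF matrix_vector_mul_linear] matrix_vector_mult_scaleR o_def)
  then show ?thesis by (simp add: vec_eq_iff)
qed

lemma crit_G: "crit v \<Longrightarrow> G v $ i = lam v i *\<^sub>R v $ i"
  by (auto simp: crit_def proj_def vec_eq_iff lam_def)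

lemma linear_L: "linear (L v)"
  by (rule linearI) (auto simp: L_def vec_eq_iff G_add G_scale algebra_simps)

lemma L_selfadj: "L v x \<bullet> y = x \<bullet> L v y"
proof -
  have "L v x \<bullet> y = G x \<bullet> y - (\<Sum>i\<in>UNIV. lam v i * (x $ i \<bullet> y $ i))" for x y
    unfolding inner_vec_def[of "L v x"] inner_vec_def[of "G x"] by (simp add: L_def inner_diff_left sum_subtractf)
  from this[of x y] this[of y x] show ?thesis
    using G_selfadj[of x y] by (simp add: inner_commute)
qed

lemma crit_L: "crit v \<Longrightarrow> L v v = 0"
  by (simp add: L_def vec_eq_iff crit_G)

text \<open>An identity without remainder: on \<open>configs\<close> the multiplier terms of
  \<open>y\<close> and \<open>v\<close> agree because the column norms do, and
  \<open>L v v = 0\<close> removes the linear part.\<close>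

lemma f_diff_crit:
  assumes v: "crit v" and y: "y \<in> configs"
  shows "f y - f v = (y - v) \<bullet> L v (y - v)"
proof -
  have vc: "v \<in> configs" using v by (simp add: crit_def)
  have nn: "y $ i \<bullet> y $ i = v $ i \<bullet> v $ i" for i
    using y vc by (cases "i \<in> A") (auto simp: configs_def norm_eq_1)
  have *: "x \<bullet> L v x = f x - (\<Sum>i\<in>UNIV. lam v i * (x $ i \<bullet> x $ i))" for x
    unfolding f_def inner_vec_def[of x "L v x"] inner_vec_def[of x "G x"] by (simp add: L_def inner_diff_right sum_subtractf)
  have "f y - f v = y \<bullet> L v y - v \<bullet> L v v" unfolding * by (simp add: nn)
  also have "\<dots> = (y - v) \<bullet> L v (y - v)"
    using L_selfadj[of v v y] by (simp add: crit_L[OF v] linear_diff[OF linear_L] inner_diff_left inner_diff_right)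
  finally show ?thesis .
qed

text \<open>\<open>G y\<close> and \<open>L v y\<close> differ columnwise by multiples of
  \<open>y $ i\<close>, which \<open>proj y\<close> annihilates on unit columns.\<close>

lemma proj_G_eq:
  assumes v: "crit v" and y: "y \<in> configs"
  shows "proj y (G y) = proj y (L v (y - v))"
proof -
  have "L v (y - v) = L v y" by (simp add: linear_diff[OF linear_L] crit_L[OF v])
  moreover have "proj y (G y) $ i = proj y (L v y) $ i" for i
    using y by (cases "i \<in> A") (auto simp: proj_def L_def configs_def norm_eq_1 inner_diff_left algebra_simps)
  then have "proj y (G y) = proj y (L v y)" by (subst vec_eq_iff) simp
  ultimately show ?thesis by simp
qed

lemma rot_configs:
  fixes x :: "real^'k^'i"
  assumes R: "\<And>x::real^'k. norm (R *v x) = norm x"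
  shows "x \<in> configs \<Longrightarrow> rot R x \<in> configs" "f (rot R x) = f x" "norm (proj (rot R x) (G (rot R x))) = norm (proj x (G x))"
proof -
  show "x \<in> configs \<Longrightarrow> rot R x \<in> configs" by (auto simp: configs_def rot_def R)
  show "f (rot R x) = f x" by (simp add: f_def G_rot inner_rot[OF R])
  have "orthogonal_transformation ((*v) R)" using R by (simp add: orthogonal_transformation)
  then have io: "(R *v a) \<bullet> (R *v b) = a \<bullet> b" for a b by (simp add: orthogonal_transformation_def)
  have "proj (rot R x) (rot R (G x)) $ i = rot R (proj x (G x)) $ i" for i
    by (simp add: proj_def rot_def io matrix_vector_mult_diff_distrib matrix_vector_mult_scaleR)
  then have "proj (rot R x) (G (rot R x)) = rot R (proj x (G x))"
    unfolding G_rot by (subst vec_eq_iff) simp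
  moreover have "norm (rot R y) = norm y" for y :: "real^'k^'i" by (simp add: norm_eq_sqrt_inner inner_rot[OF R])
  ultimately show "norm (proj (rot R x) (G (rot R x))) = norm (proj x (G x))" by simp
qed

text \<open>Orthogonal Procrustes problem: maximise the inner product of \<open>y\<close> with
  \<open>rot Q v\<close> over the compact group O(k) and apply the transpose of a maximiser to
  \<open>y\<close>. Comparison with the identity gives the distance bound, the first-order condition
  the orthogonality to the orbit directions at \<open>v\<close>.\<close>

lemma aligned_rotation:
  fixes y v :: "real^'k^'i"
  obtains R where "\<And>x::real^'k. norm (R *v x) = norm x" "norm (rot R y - v) \<le> norm (y - v)"
    "\<And>\<Omega>. transpose \<Omega> = - \<Omega> \<Longrightarrow> rot R y \<bullet> rot \<Omega> v = 0"
proof -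
  let ?O = "{R::real^'k^'k. \<forall>x. norm (R *v x) = norm x}"
  have cont: "continuous_on ?O (\<lambda>R. y \<bullet> rot R v)"
    unfolding rot_def
    by (intro continuous_intros linear_continuous_on linear_matrix_arg[unfolded linear_conv_bounded_linear])
  have I: "mat 1 \<in> ?O" by simp
  then have "?O \<noteq> {}" by (metis empty_iff)
  from continuous_attains_sup[OF compact_isometries this cont]
  obtain R where R: "R \<in> ?O" "\<And>Q. Q \<in> ?O \<Longrightarrow> y \<bullet> rot Q v \<le> y \<bullet> rot R v" by (elim bexE) (metis (no_types, lifting))
  define T where "T = transpose R"
  have "orthogonal_transformation ((*v) R)" using R(1) by (simp add: orthogonal_transformation)
  then have om: "orthogonal_matrix R" by (simp add: orthogonal_transformation_matrix)
  then have "orthogonal_matrix T" by (simp add: T_def orthogonal_matrix_transpose)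
  then have "orthogonal_transformation ((*v) T)" by (simp add: orthogonal_transformation_matrix)
  then have T: "norm (T *v x) = norm x" for x by (simp add: orthogonal_transformation)
  have TR: "T *v (R *v x) = x" for x
    using om by (simp add: T_def matrix_vector_mul_assoc orthogonal_matrix)
  have rTR: "rot T (rot R x) = x" for x :: "real^'k^'i" by (simp add: rot_def TR vec_eq_iff)
  have adj: "rot T y \<bullet> x = y \<bullet> rot R x" for x :: "real^'k^'i"
    using inner_rot[of T y "rot R x"] T rTR by simp
  show ?thesis
  proof (rule that[of T])
    show "norm (T *v x) = norm x" for x by (rule T)
    have "y \<bullet> v \<le> rot T y \<bullet> v" using R(2)[OF I] by (simp add: adj) (simp add: rot_def)
    moreover have "rot T y \<bullet> rot T y = y \<bullet> y" by (rule inner_rot[OF T])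
    ultimately have "(norm (rot T y - v))\<^sup>2 \<le> (norm (y - v))\<^sup>2"
      by (simp add: power2_norm_eq_inner inner_diff_left inner_diff_right inner_commute[of v y] inner_commute[of v "rot T y"])
    then show "norm (rot T y - v) \<le> norm (y - v)" by (rule power2_le_imp_le) simp
    fix \<Omega> :: "real^'k^'k" assume sk: "transpose \<Omega> = - \<Omega>"
    show "rot T y \<bullet> rot \<Omega> v = 0"
    proof (rule skew_inner_zero[OF _ sk])
      fix Q :: "real^'k^'k" assume Q: "\<forall>x. norm (Q *v x) = norm x"
      have "rot R (rot Q v) = rot (R ** Q) v" by (simp add: rot_def matrix_vector_mul_assoc vec_eq_iff)
      moreover have "R ** Q \<in> ?O" using R(1) Q by (simp add: matrix_vector_mul_assoc[symmetric])
      ultimately show "rot T y \<bullet> rot Q v \<le> rot T y \<bullet> v" unfolding adj using R(2) by simp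
    qed
  qed
qed

text \<open>Compactness: violators with growing constants, aligned with \<open>v\<close>, have
  displacements whose normalised limit \<open>w\<close> is tangent and in the Hessian kernel.
  Morse--Bott writes \<open>w\<close> as \<open>rot \<Omega> v\<close>, to which all aligned
  displacements are orthogonal, so the unit vector \<open>w\<close> would be orthogonal to
  itself.\<close>

lemma loj_ineq:
  fixes v :: "real^'k^'i"
  assumes v: "crit v" and morse_bott: "morse_bott v"
  shows "\<exists>C \<delta>. \<delta> > 0 \<and> (\<forall>y\<in>configs \<inter> ball v \<delta>. \<bar>f y - f v\<bar> \<le> C * (norm (proj y (G y)))\<^sup>2)"
proof (rule ccontr)
  assume no: "\<not> ?thesis"
  have vc: "v \<in> configs" using v by (simp add: crit_def)
  have ex: "\<exists>y. y \<in> configs \<and> norm (y - v) < 1 / real (Suc m) \<and> real (Suc m) * (norm (proj y (G y)))\<^sup>2 < \<bar>f y - f v\<bar>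
      \<and> (\<forall>\<Omega>. transpose \<Omega> = - \<Omega> \<longrightarrow> y \<bullet> rot \<Omega> v = 0)" for m
  proof -
    have "\<exists>y\<in>configs \<inter> ball v (1 / real (Suc m)). \<not> \<bar>f y - f v\<bar> \<le> real (Suc m) * (norm (proj y (G y)))\<^sup>2"
      using no by (meson divide_pos_pos of_nat_0_less_iff zero_less_Suc zero_less_one)
    then obtain y where y: "y \<in> configs" "norm (y - v) < 1 / real (Suc m)" "real (Suc m) * (norm (proj y (G y)))\<^sup>2 < \<bar>f y - f v\<bar>"
      by (auto simp: dist_norm norm_minus_commute not_le)
    obtain R where R: "\<And>x::real^'k. norm (R *v x) = norm x" "norm (rot R y - v) \<le> norm (y - v)"
      "\<And>\<Omega>. transpose \<Omega> = - \<Omega> \<Longrightarrow> rot R y \<bullet> rot \<Omega> v = 0"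
      using aligned_rotation[of y v] by blast
    show ?thesis
      using rot_configs[OF R(1), of y] y R(2,3) by (intro exI[of _ "rot R y"]) auto
  qed
  define y where "y m = (SOME y. y \<in> configs \<and> norm (y - v) < 1 / real (Suc m) \<and> real (Suc m) * (norm (proj y (G y)))\<^sup>2 < \<bar>f y - f v\<bar>
      \<and> (\<forall>\<Omega>. transpose \<Omega> = - \<Omega> \<longrightarrow> y \<bullet> rot \<Omega> v = 0))" for m
  have y: "y m \<in> configs" "norm (y m - v) < 1 / real (Suc m)" "real (Suc m) * (norm (proj (y m) (G (y m))))\<^sup>2 < \<bar>f (y m) - f v\<bar>"
    "\<And>\<Omega>. transpose \<Omega> = - \<Omega> \<Longrightarrow> y m \<bullet> rot \<Omega> v = 0" for m
    using someI_ex[OF ex[of m]] unfolding y_def[symmetric] by blast+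
  define d where "d m = y m - v" for m
  define e where "e m = d m /\<^sub>R norm (d m)" for m
  have dnz: "d m \<noteq> 0" for m
    using y(3)[of m] by (auto simp: d_def mult_less_0_iff not_less[symmetric])
  have d0: "(\<lambda>m. norm (d m)) \<longlonglongrightarrow> 0"
    by (rule Lim_null_comparison[OF _ LIMSEQ_inverse_real_of_nat])
      (use y(2) in \<open>auto simp: d_def inverse_eq_divide less_imp_le\<close>)
  have ylim: "y \<longlonglongrightarrow> v"
    using d0 by (simp add: d_def tendsto_norm_zero_iff LIM_zero_iff)
  have e1: "norm (e m) = 1" for m using dnz[of m] by (simp add: e_def)
  obtain w r where wr: "strict_mono (r::nat\<Rightarrow>nat)" "(e \<circ> r) \<longlonglongrightarrow> w"
    using compact_sphere[of "0::real^'k^'i" 1] e1 unfolding compact_def by (metis mem_sphere_0)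
  have w1: "norm w = 1"
    using LIMSEQ_unique[OF tendsto_norm[OF wr(2)]] e1 by (simp add: o_def)
  have yr: "(\<lambda>m. y (r m)) \<longlonglongrightarrow> v" using LIMSEQ_subseq_LIMSEQ[OF ylim wr(1)] by (simp add: o_def)
  have er: "(\<lambda>m. e (r m)) \<longlonglongrightarrow> w" using wr(2) by (simp add: o_def)
  have dr: "(\<lambda>m. norm (d (r m))) \<longlonglongrightarrow> 0" using LIMSEQ_subseq_LIMSEQ[OF d0 wr(1)] by (simp add: o_def)
  have Lc: "continuous_on UNIV (L v)" by (rule linear_continuous_on[OF linear_L[unfolded linear_conv_bounded_linear]])
  have Ler: "(\<lambda>m. L v (e (r m))) \<longlonglongrightarrow> L v w"
    using continuous_on_tendsto_compose[OF Lc er] by simp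
  have tangw: "w \<in> tangent v"
  proof -
    have "w $ i \<bullet> v $ i = 0" for i
    proof -
      \<comment> \<open>On a sphere the component of a displacement along \<open>v $ i\<close> is of
        second order in the displacement, so it disappears in the limit direction.\<close>
      have eq: "e m $ i \<bullet> v $ i = - (norm (d m) * (e m $ i \<bullet> e m $ i)) / 2" for m
      proof -
        have "y m $ i \<bullet> y m $ i = v $ i \<bullet> v $ i"
          using y(1)[of m] vc by (cases "i \<in> A") (auto simp: configs_def norm_eq_1)
        moreover have "y m $ i = v $ i + d m $ i" by (simp add: d_def)
        ultimately have "2 * (d m $ i \<bullet> v $ i) = - (d m $ i \<bullet> d m $ i)"
          by (simp add: inner_add_left inner_add_right inner_commute[of "v $ i" "d m $ i"])
        moreover have "d m $ i = norm (d m) *\<^sub>R e m $ i" using dnz by (simp add: e_def)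
        ultimately have "norm (d m) * (2 * (e m $ i \<bullet> v $ i)) = norm (d m) * (- (norm (d m) * (e m $ i \<bullet> e m $ i)))" by simp
        then have "2 * (e m $ i \<bullet> v $ i) = - (norm (d m) * (e m $ i \<bullet> e m $ i))"
          using mult_left_cancel[of "norm (d m)"] dnz[of m] by (metis norm_eq_zero)
        then show ?thesis by simp
      qed
      have "(\<lambda>m. e (r m) $ i \<bullet> v $ i) \<longlonglongrightarrow> w $ i \<bullet> v $ i" by (intro tendsto_intros er)
      moreover have "(\<lambda>m. e (r m) $ i \<bullet> v $ i) \<longlonglongrightarrow> - (0 * (w $ i \<bullet> w $ i)) / 2"
        unfolding eq by (intro tendsto_intros er dr) auto
      ultimately show ?thesis using LIMSEQ_unique by fastforce
    qed
    moreover have "w $ i = 0" if "i \<notin> A" for i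
    proof -
      have "e m $ i = 0" for m using y(1)[of m] vc that by (simp add: e_def d_def configs_def)
      moreover have "(\<lambda>m. e (r m) $ i) \<longlonglongrightarrow> w $ i" by (intro tendsto_intros er)
      ultimately show ?thesis using LIMSEQ_unique[of "\<lambda>m. 0"] by auto
    qed
    ultimately show ?thesis by (simp add: tangent_def)
  qed
  define K where "K = onorm (L v)"
  have K: "\<bar>x \<bullet> L v x\<bar> \<le> K" if "norm x = 1" for x
  proof -
    have "\<bar>x \<bullet> L v x\<bar> \<le> norm x * norm (L v x)" by (rule Cauchy_Schwarz_ineq2)
    also have "\<dots> \<le> K" unfolding K_def using onorm[OF linear_L[unfolded linear_conv_bounded_linear], of v x] that by simp
    finally show ?thesis .
  qed
  \<comment> \<open>The value difference and the squared gradient both carry the factor |d m|^2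
    exactly, and it cancels in the violated inequality.\<close>
  have small: "(norm (proj (y m) (L v (e m))))\<^sup>2 \<le> K / real (Suc m)" for m
  proof -
    have de: "d m = norm (d m) *\<^sub>R e m" using dnz by (simp add: e_def)
    have "proj (y m) (G (y m)) = proj (y m) (L v (d m))" using proj_G_eq[OF v y(1)] by (simp add: d_def)
    also have "\<dots> = norm (d m) *\<^sub>R proj (y m) (L v (e m))"
      by (subst de) (simp add: linear_scale[OF linear_L] proj_def vec_eq_iff algebra_simps)
    finally have p: "(norm (proj (y m) (G (y m))))\<^sup>2 = (norm (d m))\<^sup>2 * (norm (proj (y m) (L v (e m))))\<^sup>2"
      by (simp add: power_mult_distrib)
    have "f (y m) - f v = d m \<bullet> L v (d m)" using f_diff_crit[OF v y(1)] by (simp add: d_def)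
    also have "\<dots> = (norm (d m))\<^sup>2 * (e m \<bullet> L v (e m))"
      by (subst (1 2) de) (simp add: linear_scale[OF linear_L] power2_eq_square)
    finally have "\<bar>f (y m) - f v\<bar> = (norm (d m))\<^sup>2 * \<bar>e m \<bullet> L v (e m)\<bar>" by (simp add: abs_mult)
    also have "\<dots> \<le> (norm (d m))\<^sup>2 * K" by (intro mult_left_mono K e1) auto
    finally have "(norm (d m))\<^sup>2 * (real (Suc m) * (norm (proj (y m) (L v (e m))))\<^sup>2) \<le> (norm (d m))\<^sup>2 * K"
      using y(3)[of m] unfolding p by (simp add: mult_ac)
    then have "real (Suc m) * (norm (proj (y m) (L v (e m))))\<^sup>2 \<le> K" using dnz[of m] by simp
    then show ?thesis by (simp add: pos_le_divide_eq mult.commute del: of_nat_Suc)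
  qed
  have "(\<lambda>m. K / real (Suc m)) \<longlonglongrightarrow> 0"
    using tendsto_mult_right_zero[OF LIMSEQ_inverse_real_of_nat, of K] by (simp add: divide_inverse)
  then have "(\<lambda>m. (norm (proj (y m) (L v (e m))))\<^sup>2) \<longlonglongrightarrow> 0"
    by (rule Lim_null_comparison[rotated]) (use small in auto)
  then have "(\<lambda>m. norm (proj (y m) (L v (e m)))) \<longlonglongrightarrow> 0" using tendsto_real_sqrt by fastforce
  then have "(\<lambda>m. proj (y m) (L v (e m))) \<longlonglongrightarrow> 0" by (simp add: tendsto_norm_zero_iff)
  then have "(\<lambda>m. proj (y (r m)) (L v (e (r m)))) \<longlonglongrightarrow> 0"
    using LIMSEQ_subseq_LIMSEQ[OF _ wr(1)] by (fastforce simp: o_def)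
  moreover have "(\<lambda>m. proj (y (r m)) (L v (e (r m)))) \<longlonglongrightarrow> proj v (L v w)"
    unfolding proj_def by (intro tendsto_intros yr Ler)
  ultimately have "proj v (L v w) = 0" using LIMSEQ_unique by blast
  then obtain \<Omega> where \<Omega>: "transpose \<Omega> = - \<Omega>" "w = rot \<Omega> v" using morse_bott tangw unfolding morse_bott_def by blast
  \<comment> \<open>The alignment condition passes to the limit \<open>v\<close>, so it also holds
    for the displacements y m - v.\<close>
  have vO: "v \<bullet> rot \<Omega> v = 0"
  proof -
    have "(\<lambda>m. y m \<bullet> rot \<Omega> v) \<longlonglongrightarrow> v \<bullet> rot \<Omega> v" by (intro tendsto_intros ylim)
    then show ?thesis using y(4)[OF \<Omega>(1)] LIMSEQ_unique[of "\<lambda>m. 0"] by auto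
  qed
  have "e m \<bullet> rot \<Omega> v = 0" for m using y(4)[OF \<Omega>(1), of m] vO by (simp add: e_def d_def inner_diff_left)
  moreover have "(\<lambda>m. e (r m) \<bullet> rot \<Omega> v) \<longlonglongrightarrow> w \<bullet> rot \<Omega> v" by (intro tendsto_intros er)
  ultimately have "(\<lambda>m::nat. 0) \<longlonglongrightarrow> w \<bullet> w" unfolding \<Omega>(2)[symmetric] by simp
  from LIMSEQ_unique[OF this tendsto_const] have "w \<bullet> w = 0" by simp
  then show False using w1 by simp
qed

lemma mixing_convergence:
  fixes x :: "real^'k^'i"
  assumes x: "x \<in> configs" and morse_bott: "\<And>v::real^'k^'i. crit v \<Longrightarrow> morse_bott v"
  obtains v where "crit v" "(\<lambda>t. (sweep ^^ t) x) \<longlonglongrightarrow> v"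
proof -
  obtain B where B: "\<And>x::real^'k^'i. x \<in> configs \<Longrightarrow> norm (proj x (G x)) \<le> B * norm (sweep x - x)"
    using sweep_proj_bound by blast
  note c = funpow_sweep_configs[OF x]
  have Suc_eq: "(sweep ^^ Suc t) x = sweep ((sweep ^^ t) x)" for t
    by (simp add: funpow_swap1 funpow_Suc_right)
  obtain v where "v \<in> configs" "proj v (G v) = 0" "(\<lambda>t. (sweep ^^ t) x) \<longlonglongrightarrow> v"
  proof (rule loj_convergence[OF compact_configs c, where \<phi>=f and p="\<lambda>x. proj x (G x)" and a="1/\<theta>" and B=B])
    show "1 / \<theta> * (norm ((sweep ^^ Suc t) x - (sweep ^^ t) x))\<^sup>2 \<le> f ((sweep ^^ t) x) - f ((sweep ^^ Suc t) x)" for t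
      using sweep_descent[OF c[of t]] unfolding Suc_eq .
    show "norm (proj ((sweep ^^ t) x) (G ((sweep ^^ t) x))) \<le> B * norm ((sweep ^^ Suc t) x - (sweep ^^ t) x)" for t
      using B[OF c[of t]] unfolding Suc_eq .
    show "continuous_on configs (f :: real^'k^'i \<Rightarrow> real)" unfolding f_def by (intro continuous_intros continuous_on_G)
    show "continuous_on configs (\<lambda>x::real^'k^'i. proj x (G x))" by (intro continuous_on_proj continuous_on_G continuous_intros)
    show "\<exists>C \<delta>. \<delta> > 0 \<and> (\<forall>y\<in>configs \<inter> ball v \<delta>. \<bar>f y - f v\<bar> \<le> C * (norm (proj y (G y)))\<^sup>2)"
      if "v \<in> configs" "proj v (G v) = 0" for v :: "real^'k^'i"
      using that morse_bott by (intro loj_ineq) (auto simp: crit_def)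
  qed (use \<theta>_pos in auto)
  then show ?thesis using that by (auto simp: crit_def)
qed

end

section \<open>Expanding cones at saddle points\<close>

lemma quadratic_diff_bound:
  fixes M :: "'a::euclidean_space \<Rightarrow> 'a"
  assumes M: "bounded_linear M" and K: "\<And>x. norm (M x) \<le> K * norm x"
  shows "\<bar>x \<bullet> M x - y \<bullet> M y\<bar> \<le> K * norm (x - y) * (norm x + norm y)"
proof -
  have "x \<bullet> M x - y \<bullet> M y = (x - y) \<bullet> M x + y \<bullet> M (x - y)"
    using M by (simp add: bounded_linear.linear linear_diff inner_diff_left inner_diff_right)
  also have "\<bar>\<dots>\<bar> \<le> norm (x - y) * norm (M x) + norm y * norm (M (x - y))"
    by (intro order_trans[OF abs_triangle_ineq] add_mono Cauchy_Schwarz_ineq2)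
  also have "\<dots> \<le> norm (x - y) * (K * norm x) + norm y * (K * norm (x - y))"
    by (intro add_mono mult_left_mono K) auto
  finally show ?thesis by (simp add: algebra_simps)
qed

text \<open>On \<open>S\<close>, \<open>desc\<close> and \<open>gap\<close> together multiply -q by
  at least 1 + a * \<kappa> where q is negative. This survives when \<open>d\<close> is only nearly
  in \<open>S\<close> and \<open>d'\<close> only nearly \<open>T d\<close>. No eigenvalue of
  \<open>T\<close> is used; in the application \<open>T\<close> is the linearised sweep, which need
  not be symmetric.\<close>

lemma expanding_cone:
  fixes M T P :: "'a::euclidean_space \<Rightarrow> 'a"
  defines "q \<equiv> \<lambda>x. x \<bullet> M x"
  assumes M: "bounded_linear M" and T: "bounded_linear T" and P: "\<And>x. norm (P x) \<le> norm x"
    and a: "a > 0" and \<kappa>: "\<kappa> > 0"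
    and desc: "\<And>d. d \<in> S \<Longrightarrow> q (T d) \<le> q d - a * (norm (T d - d))\<^sup>2"
    and gap: "\<And>d. d \<in> S \<Longrightarrow> \<kappa> * \<bar>q d\<bar> \<le> (norm (T d - d))\<^sup>2"
    and e0: "q e0 < 0"
  obtains \<eta> \<rho> \<epsilon> \<epsilon>0 where "\<eta> > 0" "\<rho> > 1" "\<epsilon> > 0" "\<epsilon>0 > 0"
    "\<And>d s. norm (d - s *\<^sub>R e0) \<le> \<epsilon>0 * \<bar>s\<bar> \<Longrightarrow> q d \<le> - \<eta> * (norm d)\<^sup>2"
    "\<And>d d'. P d \<in> S \<Longrightarrow> norm (d - P d) \<le> \<epsilon> * norm d \<Longrightarrow> norm (d' - T d) \<le> \<epsilon> * norm d \<Longrightarrow> q d \<le> - \<eta> * (norm d)\<^sup>2 \<Longrightarrow>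
        q d' \<le> - \<eta> * (norm d')\<^sup>2 \<and> q d' \<le> \<rho> * q d"
proof -
  obtain K where K: "K > 0" "\<And>x. norm (M x) \<le> K * norm x"
    using bounded_linear.pos_bounded[OF M] by (auto simp: mult.commute)
  obtain B where B: "B > 0" "\<And>x. norm (T x) \<le> B * norm x"
    using bounded_linear.pos_bounded[OF T] by (auto simp: mult.commute)
  have qd: "\<bar>q x - q y\<bar> \<le> K * norm (x - y) * (norm x + norm y)" for x y
    unfolding q_def by (rule quadratic_diff_bound[OF M K(2)])
  have linM: "linear M" using M by (rule bounded_linear.linear)
  have linT: "linear T" using T by (rule bounded_linear.linear)
  have e0nz: "e0 \<noteq> 0" using e0 linM by (auto simp: q_def linear_0)
  \<comment> \<open>The full gain a * \<kappa> is 4 * \<tau>. Half of \<open>a * s\<^sup>2\<close>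
    produces 2 * \<tau>, of which one \<tau> survives as growth and the other pays for the errors; a
    quarter of \<open>a * s\<^sup>2\<close> compensates the growth of the norm.\<close>
  define \<tau> where "\<tau> = a * \<kappa> / 4"
  have \<tau>: "\<tau> > 0" using a \<kappa> by (simp add: \<tau>_def)
  \<comment> \<open>The first bound lets \<open>a/4\<close> absorb the factor 1 + 1/\<tau> arising
    in \<open>D2\<close>; the second puts \<open>e0\<close> strictly inside the cone.\<close>
  define \<eta> where "\<eta> = min ((a/4) / (1 + 1/\<tau>)) (- q e0 / (2 * (norm e0)\<^sup>2))"
  have \<eta>: "\<eta> > 0" unfolding \<eta>_def using a \<tau> e0 e0nz by (auto intro!: divide_pos_pos add_pos_pos divide_neg_pos)
  have \<eta>1: "\<eta> * (1 + 1/\<tau>) \<le> a/4"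
  proof -
    have "\<eta> \<le> (a/4) / (1 + 1/\<tau>)" by (simp add: \<eta>_def)
    moreover have "0 < 1 + 1/\<tau>" using \<tau> by (simp add: add_pos_pos)
    ultimately show ?thesis using pos_le_divide_eq by blast
  qed
  have \<eta>2: "2 * \<eta> * (norm e0)\<^sup>2 \<le> - q e0"
  proof -
    have "\<eta> \<le> - q e0 / (2 * (norm e0)\<^sup>2)" by (simp add: \<eta>_def)
    moreover have "0 < 2 * (norm e0)\<^sup>2" using e0nz by simp
    ultimately have "\<eta> * (2 * (norm e0)\<^sup>2) \<le> - q e0" using pos_le_divide_eq by blast
    then show ?thesis by (simp add: mult_ac)
  qed
  \<comment> \<open>Dominates the three error constants listed in \<open>Cge\<close>. \<epsilon> is
    then chosen so that all errors together stay below \<tau> * \<eta> * |d|^2, hence below \<tau> *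
    |q d| on the cone.\<close>
  define C where "C = (1 + K) * (1 + B) * (1 + 3 * B) + 2 * K"
  have C: "C > 0" using K B by (simp add: C_def add_pos_pos)
  have Cge: "K * (1 + B) * (1 + 3 * B) \<le> C" "(1 + B) * (1 + 3 * B) \<le> C" "2 * K \<le> C"
    using K B by (auto simp: C_def algebra_simps)
  define \<epsilon> where "\<epsilon> = min 1 (\<tau> * \<eta> / (C * (2 + 2 * \<tau> + \<eta>)))"
  have \<epsilon>: "\<epsilon> > 0" "\<epsilon> \<le> 1" unfolding \<epsilon>_def using \<tau> \<eta> C by (auto intro!: divide_pos_pos mult_pos_pos add_pos_pos)
  have \<epsilon>C: "C * \<epsilon> * (2 + 2 * \<tau> + \<eta>) \<le> \<tau> * \<eta>"
  proof -
    have "\<epsilon> \<le> \<tau> * \<eta> / (C * (2 + 2 * \<tau> + \<eta>))" by (simp add: \<epsilon>_def)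
    moreover have "C * (2 + 2 * \<tau> + \<eta>) > 0" using C \<tau> \<eta> by simp
    ultimately show ?thesis by (simp add: pos_le_divide_eq mult_ac)
  qed
  have cone: "q d' \<le> - \<eta> * (norm d')\<^sup>2 \<and> q d' \<le> (1 + \<tau>) * q d"
    if psd_block: "P d \<in> S" and d1: "norm (d - P d) \<le> \<epsilon> * norm d" and d2: "norm (d' - T d) \<le> \<epsilon> * norm d" and d3: "q d \<le> - \<eta> * (norm d)\<^sup>2" for d d'
  proof -
    define N where "N = (norm d)\<^sup>2"
    define p where "p = P d"
    define D where "D = T p"
    define s where "s = norm (D - p)"
    define Q where "Q = - q d"
    define R where "R = - q p"
    have N0: "N \<ge> 0" by (simp add: N_def)
    have QN: "\<eta> * N \<le> Q" using d3 by (simp add: Q_def N_def)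
    have pn: "norm p \<le> norm d" unfolding p_def by (rule P)
    have "\<bar>q d - q p\<bar> \<le> K * norm (d - p) * (norm d + norm p)" by (rule qd)
    also have "\<dots> \<le> K * (\<epsilon> * norm d) * (norm d + norm d)"
      using d1 pn K \<epsilon> by (intro mult_mono add_mono) (auto simp: p_def)
    also have "\<dots> = (2 * K) * (\<epsilon> * N)" by (simp add: N_def power2_eq_square)
    also have "\<dots> \<le> C * (\<epsilon> * N)" using Cge \<epsilon> N0 by (intro mult_right_mono) auto
    finally have RQ: "Q - C * \<epsilon> * N \<le> R" by (simp add: Q_def R_def)
    have Dn: "norm D \<le> B * norm d" unfolding D_def using B(2)[of p] pn B(1) by (meson mult_left_mono less_imp_le order_trans)
    have dD: "norm (d' - D) \<le> \<epsilon> * (1 + B) * norm d"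
    proof -
      have "d' - D = (d' - T d) + T (d - p)" by (simp add: D_def linear_diff[OF linT])
      then have "norm (d' - D) \<le> norm (d' - T d) + norm (T (d - p))" by (simp only: norm_triangle_ineq)
      also have "\<dots> \<le> \<epsilon> * norm d + B * (\<epsilon> * norm d)"
        using d2 B d1 by (intro add_mono order_trans[OF B(2)] mult_left_mono) (auto simp: p_def)
      finally show ?thesis by (simp add: algebra_simps)
    qed
    have dn: "norm d' \<le> (1 + 2 * B) * norm d"
    proof -
      have "norm d' \<le> norm (d' - D) + norm D" using norm_triangle_ineq[of "d' - D" D] by simp
      also have "\<dots> \<le> 1 * (1 + B) * norm d + B * norm d"
        using dD Dn \<epsilon> B by (intro add_mono order_trans[OF dD] mult_right_mono) auto
      finally show ?thesis by (simp add: algebra_simps)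
    qed
    have sumn: "norm d' + norm D \<le> (1 + 3 * B) * norm d" using dn Dn by (simp add: algebra_simps)
    have prod: "norm (d' - D) * (norm d' + norm D) \<le> (\<epsilon> * (1 + B) * norm d) * ((1 + 3 * B) * norm d)"
      using dD sumn B \<epsilon> by (intro mult_mono) auto
    have prod': "(\<epsilon> * (1 + B) * norm d) * ((1 + 3 * B) * norm d) = (1 + B) * (1 + 3 * B) * (\<epsilon> * N)"
      by (simp add: N_def power2_eq_square mult_ac)
    have "\<bar>q d' - q D\<bar> \<le> K * (norm (d' - D) * (norm d' + norm D))" using qd[of d' D] by (simp add: mult.assoc)
    also have "\<dots> \<le> K * ((1 + B) * (1 + 3 * B) * (\<epsilon> * N))"
      using prod K unfolding prod' by (intro mult_left_mono) auto
    also have "\<dots> \<le> C * (\<epsilon> * N)" using mult_right_mono[OF Cge(1), of "\<epsilon> * N"] \<epsilon> N0 by (simp add: mult_ac)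
    finally have qD: "- q D - C * \<epsilon> * N \<le> - q d'" by simp
    have "(norm d')\<^sup>2 - (norm D)\<^sup>2 = (norm d' - norm D) * (norm d' + norm D)" by (simp add: power2_eq_square algebra_simps)
    also have "\<dots> \<le> norm (d' - D) * (norm d' + norm D)" by (intro mult_right_mono norm_triangle_ineq2) auto
    also have "\<dots> \<le> (1 + B) * (1 + 3 * B) * (\<epsilon> * N)" using prod unfolding prod' .
    also have "\<dots> \<le> C * (\<epsilon> * N)" using Cge \<epsilon> N0 by (intro mult_right_mono) auto
    finally have nD: "(norm d')\<^sup>2 \<le> (norm D)\<^sup>2 + C * \<epsilon> * N" by simp
    have CeN: "C * \<epsilon> * N * (2 + 2 * \<tau> + \<eta>) \<le> \<tau> * \<eta> * N"
      using mult_right_mono[OF \<epsilon>C N0] by (simp add: mult_ac)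
    have CeN0: "C * \<epsilon> * N \<ge> 0" using C \<epsilon> N0 by simp
    have "C * \<epsilon> * N * (2 + 2 * \<tau>) \<le> \<tau> * \<eta> * N"
      using CeN mult_nonneg_nonneg[OF CeN0, of \<eta>] \<eta> by (simp add: algebra_simps)
    have R0: "R \<ge> 0"
    proof -
      have "2 * \<tau> * (C * \<epsilon> * N) \<le> C * \<epsilon> * N * (2 + 2 * \<tau>)" using CeN0 by (simp add: algebra_simps)
      also have "\<dots> \<le> \<tau> * (\<eta> * N)" using \<open>C * \<epsilon> * N * (2 + 2 * \<tau>) \<le> \<tau> * \<eta> * N\<close> by simp
      finally have "\<tau> * (2 * (C * \<epsilon> * N)) \<le> \<tau> * (\<eta> * N)" by simp
      then have "2 * (C * \<epsilon> * N) \<le> \<eta> * N" using \<tau> by simp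
      then show ?thesis using RQ QN CeN0 by linarith
    qed
    have s2: "\<kappa> * R \<le> s\<^sup>2" using gap[OF psd_block] R0 by (simp add: R_def s_def D_def p_def)
    have "R + a * s\<^sup>2 \<le> - q D" using desc[OF psd_block] by (simp add: R_def s_def D_def p_def)
    moreover have "(a/2) * (\<kappa> * R) \<le> (a/2) * s\<^sup>2" using s2 a by (intro mult_left_mono) auto
    ultimately have qD2: "(1 + 2 * \<tau>) * R + (a/2) * s\<^sup>2 \<le> - q D" by (simp add: \<tau>_def algebra_simps)
    have R1: "(1 + 2 * \<tau>) * (Q - C * \<epsilon> * N) \<le> (1 + 2 * \<tau>) * R" using RQ \<tau> by (intro mult_left_mono) auto
    \<comment> \<open>Young's inequality with weight \<tau> limits the squared norm to the growth 1
      + \<tau>, less than the growth 1 + 2 * \<tau> of -q; the price is the factor 1 + 1/\<tau> on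
      the squared step.\<close>
    have D2: "(norm D)\<^sup>2 \<le> (1 + \<tau>) * N + (1 + 1/\<tau>) * s\<^sup>2"
    proof -
      have "norm D \<le> norm d + s" using norm_triangle_ineq[of p "D - p"] pn by (simp add: s_def)
      then have "(norm D)\<^sup>2 \<le> (norm d + s)\<^sup>2" by (intro power_mono) auto
      also have "\<dots> = N + s\<^sup>2 + 2 * norm d * s" by (simp add: N_def power2_eq_square algebra_simps)
      also have "2 * norm d * s \<le> \<tau> * N + (1/\<tau>) * s\<^sup>2"
      proof -
        have "0 \<le> (\<tau> * norm d - s)\<^sup>2" by simp
        then have "2 * norm d * s * \<tau> \<le> \<tau> * \<tau> * N + s\<^sup>2" by (simp add: N_def power2_eq_square algebra_simps)
        then show ?thesis using \<tau> by (simp add: field_simps)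
      qed
      finally show ?thesis by (simp add: algebra_simps)
    qed
    have "\<eta> * (norm D)\<^sup>2 \<le> \<eta> * ((1 + \<tau>) * N + (1 + 1/\<tau>) * s\<^sup>2)" using D2 \<eta> by (intro mult_left_mono) auto
    also have "\<dots> = (1 + \<tau>) * (\<eta> * N) + (\<eta> * (1 + 1/\<tau>)) * s\<^sup>2" by (simp add: algebra_simps)
    also have "\<dots> \<le> (1 + \<tau>) * Q + (a/4) * s\<^sup>2"
      using QN \<tau> \<eta>1 by (intro add_mono mult_left_mono mult_right_mono) auto
    finally have "\<eta> * (norm D)\<^sup>2 \<le> (1 + \<tau>) * Q + (a/4) * s\<^sup>2" .
    moreover have "(a/4) * s\<^sup>2 \<ge> 0" using a by simp
    ultimately have 1: "\<tau> * Q - (1 + 2 * \<tau>) * (C * \<epsilon> * N) \<le> - q D - \<eta> * (norm D)\<^sup>2"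
      using qD2 R1 by (simp add: algebra_simps)
    have "\<tau> * (\<eta> * N) \<le> \<tau> * Q" using QN \<tau> by (intro mult_left_mono) auto
    moreover have "\<eta> * (norm d')\<^sup>2 \<le> \<eta> * (norm D)\<^sup>2 + \<eta> * (C * \<epsilon> * N)"
      using mult_left_mono[OF nD, of \<eta>] \<eta> by (simp add: algebra_simps)
    ultimately have A: "q d' \<le> - \<eta> * (norm d')\<^sup>2"
      using 1 qD CeN by (simp add: algebra_simps)
    have "q d' \<le> (1 + \<tau>) * q d"
    proof -
      have "(1 + 2 * \<tau>) * Q - (2 + 2 * \<tau>) * (C * \<epsilon> * N) \<le> - q d'"
        using qD qD2 R1 \<open>(a/4) * s\<^sup>2 \<ge> 0\<close> by (simp add: algebra_simps)
      moreover have "(2 + 2 * \<tau>) * (C * \<epsilon> * N) \<le> \<tau> * Q"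
        using \<open>C * \<epsilon> * N * (2 + 2 * \<tau>) \<le> \<tau> * \<eta> * N\<close> \<open>\<tau> * (\<eta> * N) \<le> \<tau> * Q\<close> by (simp add: mult_ac)
      ultimately have "(1 + \<tau>) * Q \<le> - q d'" by (simp add: algebra_simps)
      then show ?thesis by (simp add: Q_def algebra_simps)
    qed
    with A show ?thesis by simp
  qed
  \<comment> \<open>\<open>g\<close> is continuous and homogeneous of degree two, so its negativity
    near \<open>e0\<close> transfers to every \<open>d\<close> close to
    \<open>s *\<^sub>R e0\<close>, for either sign of \<open>s\<close>.\<close>
  define g where "g x = q x + \<eta> * (norm x)\<^sup>2" for x
  have "continuous_on UNIV g" unfolding g_def q_def
    by (intro continuous_intros linear_continuous_on M)
  then have gc: "isCont g e0" by (simp add: continuous_on_eq_continuous_at)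
  have ge0: "g e0 < 0" using \<eta>2 e0 by (simp add: g_def)
  have "- g e0 > 0" using ge0 by simp
  then obtain r where r: "r > 0" "\<And>x. dist x e0 < r \<Longrightarrow> dist (g x) (g e0) < - g e0"
    using gc unfolding continuous_at_eps_delta by blast
  show ?thesis
  proof (rule that[of \<eta> "1 + \<tau>" \<epsilon> "r/2"])
    fix d s assume ds: "norm (d - s *\<^sub>R e0) \<le> r/2 * \<bar>s\<bar>"
    show "q d \<le> - \<eta> * (norm d)\<^sup>2"
    proof (cases "s = 0")
      case True
      then show ?thesis using ds linM by (simp add: q_def linear_0)
    next
      case False
      define x where "x = d /\<^sub>R s"
      have dx: "d = s *\<^sub>R x" using False by (simp add: x_def)
      have "\<bar>s\<bar> * norm (x - e0) = norm (d - s *\<^sub>R e0)" by (simp add: dx scaleR_diff_right[symmetric])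
      then have "\<bar>s\<bar> * norm (x - e0) \<le> \<bar>s\<bar> * (r/2)" using ds by (simp add: mult.commute)
      then have "norm (x - e0) \<le> r/2" using False by simp
      then have "dist (g x) (g e0) < - g e0" using r by (intro r(2)) (auto simp: dist_norm)
      then have "g x < 0" by (simp add: dist_real_def)
      moreover have "q d + \<eta> * (norm d)\<^sup>2 = s\<^sup>2 * g x"
        by (simp add: dx g_def q_def linear_scale[OF linM] power2_eq_square algebra_simps)
      ultimately show ?thesis by (smt (verit, best) mult_minus_left mult_nonneg_nonpos zero_le_power2)
    qed
  qed (use \<eta> \<tau> \<epsilon> r cone in auto)
qed

section \<open>The sweep linearised at a critical point\<close>

lemma norm_vec_mono:
  fixes x y :: "'e::real_normed_vector^'i::finite"
  assumes "\<And>i. norm (x $ i) \<le> r * norm (y $ i)" "r \<ge> 0"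
  shows "norm x \<le> r * norm y"
proof -
  have "norm x \<le> L2_set (\<lambda>i. r * norm (y $ i)) UNIV" unfolding norm_vec_def by (rule L2_set_mono) (use assms in auto)
  also have "\<dots> = r * norm y" unfolding norm_vec_def using assms(2) by (rule L2_set_right_distrib[symmetric])
  finally show ?thesis .
qed

lemma linear_axis: "linear (axis i :: 'e::real_vector \<Rightarrow> 'e^'i::finite)"
  by (rule linearI) (auto simp: axis_def vec_eq_iff)

lemma strict_deriv_axis:
  fixes g :: "'a::euclidean_space \<Rightarrow> 'e::euclidean_space"
  assumes "strict_deriv g B x"
  shows "strict_deriv (\<lambda>y. axis i (g y) :: 'e^'i::finite) (\<lambda>h. axis i (B h)) x"
  using strict_deriv_compose[OF assms strict_deriv_bounded_linear[OF linear_conv_bounded_linear[THEN iffD1, OF linear_axis], of i]] .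

lemma strict_deriv_vec:
  fixes g :: "'i::finite \<Rightarrow> 'a::euclidean_space \<Rightarrow> 'e::euclidean_space"
  assumes "\<And>i. strict_deriv (g i) (B i) x"
  shows "strict_deriv (\<lambda>y. \<chi> i. g i y) (\<lambda>h. \<chi> i. B i h) x"
proof -
  have zero: "strict_deriv (\<lambda>_. 0) (\<lambda>_. 0 :: 'e^'i) x"
    by (rule strict_deriv_bounded_linear) (rule bounded_linear_zero)
  have S: "strict_deriv (\<lambda>y. \<Sum>i\<in>F. axis i (g i y) :: 'e^'i) (\<lambda>h. \<Sum>i\<in>F. axis i (B i h)) x" if "finite F" for F
    using that
  proof induction
    case (insert i F)
    then show ?case using strict_deriv_add[OF strict_deriv_axis[OF assms[of i], of i] insert.IH] by simp
  qed (simp add: zero)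
  have E: "(\<Sum>i\<in>UNIV. axis i (h i)) = (\<chi> i. h i)" for h :: "'i \<Rightarrow> 'e"
    by (simp add: vec_eq_iff axis_def if_distrib[of "\<lambda>v. v $ _"] cong: if_cong)
  from S[OF finite, of UNIV] show ?thesis unfolding E .
qed

context mixing begin

text \<open>The derivative of \<open>step_map i\<close> at a critical point \<open>v\<close>.\<close>

definition D :: "real^'k^'i \<Rightarrow> 'i \<Rightarrow> real^'k^'i \<Rightarrow> real^'k^'i" where
  "D v i h = (\<chi> j. if j = i then
      ((h $ i - \<theta> *\<^sub>R G h $ i) - ((h $ i - \<theta> *\<^sub>R G h $ i) \<bullet> v $ i) *\<^sub>R v $ i) /\<^sub>R (1 - \<theta> * lam v i) else h $ j)"

lemma D_nth: "D v i h $ j = (if j = i then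
      ((h $ i - \<theta> *\<^sub>R G h $ i) - ((h $ i - \<theta> *\<^sub>R G h $ i) \<bullet> v $ i) *\<^sub>R v $ i) /\<^sub>R (1 - \<theta> * lam v i) else h $ j)"
  by (simp add: D_def)

lemma crit_lam_bounds:
  assumes v: "crit v"
  shows "0 < 1 - \<theta> * lam v i" "1 - \<theta> * lam v i \<le> 2"
proof -
  have vc: "v \<in> configs" using v by (simp add: crit_def)
  have "\<bar>\<theta> * lam v i\<bar> \<le> norm (\<theta> *\<^sub>R G v $ i) * norm (v $ i)"
    using Cauchy_Schwarz_ineq2[of "\<theta> *\<^sub>R G v $ i" "v $ i"] by (simp add: lam_def)
  also have "\<dots> \<le> norm (\<theta> *\<^sub>R G v $ i)" using configs_norm_le[OF vc, of i] by (simp add: mult_left_le)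
  also have "\<dots> < 1" by (rule norm_G_nth_less[OF configs_norm_le[OF vc]])
  finally show "0 < 1 - \<theta> * lam v i" "1 - \<theta> * lam v i \<le> 2" by (auto simp: abs_less_iff)
qed

lemma crit_arg: "crit v \<Longrightarrow> v $ i - \<theta> *\<^sub>R G v $ i = (1 - \<theta> * lam v i) *\<^sub>R v $ i"
  by (simp add: crit_G algebra_simps)

lemma crit_step_map:
  assumes v: "crit v" and i: "i \<in> A"
  shows "step_map i v = v"
proof -
  have n: "norm (v $ i) = 1" using v i by (simp add: crit_def configs_def)
  have "sgn ((1 - \<theta> * lam v i) *\<^sub>R v $ i) = v $ i"
    using crit_lam_bounds(1)[OF v, of i] n by (simp add: sgn_scaleR) (simp add: sgn_div_norm n)
  then show ?thesis by (simp add: vec_eq_iff step_map_nth crit_arg[OF v])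
qed

lemma strict_deriv_step_map:
  fixes v :: "real^'k^'i"
  assumes v: "crit v" and i: "i \<in> A"
  shows "strict_deriv (step_map i) (D v i) v"
proof -
  have n: "norm (v $ i) = 1" using v i by (simp add: crit_def configs_def)
  define l where "l = (\<lambda>x::real^'k^'i. x $ i - \<theta> *\<^sub>R G x $ i)"
  have lin: "linear l"
    by (rule linearI) (simp_all add: l_def G_add G_scale algebra_simps)
  have lv: "l v = (1 - \<theta> * lam v i) *\<^sub>R v $ i" by (simp add: l_def crit_arg[OF v])
  have pos: "0 < 1 - \<theta> * lam v i" by (rule crit_lam_bounds[OF v])
  have lnz: "l v \<noteq> 0" using pos n by (auto simp: lv)
  have sl: "sgn (l v) = v $ i" using pos n by (simp add: lv sgn_scaleR) (simp add: sgn_div_norm n)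
  have nl: "norm (l v) = 1 - \<theta> * lam v i" using pos n by (simp add: lv)
  have 1: "strict_deriv (\<lambda>x. sgn (l x)) (\<lambda>h. (l h - (l h \<bullet> v $ i) *\<^sub>R v $ i) /\<^sub>R (1 - \<theta> * lam v i)) v"
    using strict_deriv_compose[OF strict_deriv_bounded_linear[OF lin[unfolded linear_conv_bounded_linear]] strict_deriv_sgn[OF lnz]]
    unfolding sl nl .
  have "strict_deriv (\<lambda>x. \<chi> j. if j = i then sgn (l x) else x $ j) (\<lambda>h. \<chi> j. if j = i then (l h - (l h \<bullet> v $ i) *\<^sub>R v $ i) /\<^sub>R (1 - \<theta> * lam v i) else h $ j) v"
  proof (rule strict_deriv_vec)
    fix j
    show "strict_deriv (\<lambda>x. if j = i then sgn (l x) else x $ j) (\<lambda>h. if j = i then (l h - (l h \<bullet> v $ i) *\<^sub>R v $ i) /\<^sub>R (1 - \<theta> * lam v i) else h $ j) v"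
      using 1 strict_deriv_bounded_linear[OF bounded_linear_vec_nth[of j], of v] by (cases "j = i") simp_all
  qed
  moreover have "step_map i = (\<lambda>x. \<chi> j. if j = i then sgn (l x) else x $ j)"
    unfolding step_map_def l_def by (rule ext) (rule refl)
  moreover have "D v i = (\<lambda>h. \<chi> j. if j = i then (l h - (l h \<bullet> v $ i) *\<^sub>R v $ i) /\<^sub>R (1 - \<theta> * lam v i) else h $ j)"
    unfolding D_def l_def by (rule ext) (rule refl)
  ultimately show ?thesis by (simp only:)
qed

text \<open>Every coordinate step fixes a critical point, so all factors of the chain rule are taken
  at \<open>v\<close> itself.\<close>

lemma strict_deriv_fold:
  assumes v: "crit v"
  shows "set ys \<subseteq> A \<Longrightarrow> strict_deriv (fold step_map ys) (fold (D v) ys) v \<and> fold step_map ys v = v"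
proof (induction ys rule: rev_induct)
  case Nil
  then show ?case using strict_deriv_bounded_linear[OF bounded_linear_ident] by (simp add: id_def)
next
  case (snoc i ys)
  then have IH: "strict_deriv (fold step_map ys) (fold (D v) ys) v" "fold step_map ys v = v" and i: "i \<in> A" by auto
  have "strict_deriv (step_map i) (D v i) (fold step_map ys v)" using strict_deriv_step_map[OF v i] IH(2) by simp
  from strict_deriv_compose[OF IH(1) this] show ?case
    using IH(2) crit_step_map[OF v i] by (simp add: o_def)
qed

lemma norm_proj_le: "v \<in> configs \<Longrightarrow> norm (proj v d $ i) \<le> norm (d $ i)"
proof (cases "i \<in> A")
  case True
  assume "v \<in> configs"
  then have vv: "v $ i \<bullet> v $ i = 1" using True by (simp add: configs_def norm_eq_1)
  have "(norm (proj v d $ i))\<^sup>2 = (norm (d $ i))\<^sup>2 - (d $ i \<bullet> v $ i)\<^sup>2"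
    unfolding power2_norm_eq_inner proj_def vec_lambda_beta inner_diff_left inner_diff_right inner_scaleR_left inner_scaleR_right vv
      inner_commute[of "v $ i" "d $ i"]
    by (simp add: power2_eq_square)
  then have "(norm (proj v d $ i))\<^sup>2 \<le> (norm (d $ i))\<^sup>2" by simp
  then show ?thesis by (rule power2_le_imp_le) simp
qed (auto simp: configs_def proj_def)

text \<open>Infinitesimal counterpart of \<open>fold_facts\<close>, with \<open>L v\<close> in place
  of \<open>G\<close>: a linearised step moves column \<open>i\<close> along the projected gradient
  of the form \<open>q\<close> with step length \<theta> / m, and successive moves are again
  orthogonal.\<close>

lemma fold_D_facts:
  fixes v :: "real^'k^'i"
  assumes v: "crit v" and d: "d \<in> tangent v" and K: "\<And>h. norm (L v h) \<le> K * norm h" and K0: "K \<ge> 0"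
  defines "q \<equiv> \<lambda>h. h \<bullet> L v h"
  shows "distinct ys \<Longrightarrow> set ys \<subseteq> A \<Longrightarrow>
    fold (D v) ys d \<in> tangent v \<and>
    (\<forall>j. j \<notin> set ys \<longrightarrow> fold (D v) ys d $ j = d $ j) \<and>
    q (fold (D v) ys d) \<le> q d - (1/\<theta>) * (norm (fold (D v) ys d - d))\<^sup>2 \<and>
    (\<forall>i\<in>set ys. norm (proj v (L v d) $ i) \<le> (2/\<theta> + K) * norm (fold (D v) ys d - d))"
proof (induction ys rule: rev_induct)
  case Nil
  then show ?case using d by simp
next
  case (snoc i ys)
  define y where "y = fold (D v) ys d"
  have vc: "v \<in> configs" using v by (simp add: crit_def)
  have yt: "y \<in> tangent v" and IH: "\<And>j. j \<notin> set ys \<Longrightarrow> y $ j = d $ j" "q y \<le> q d - (1/\<theta>) * (norm (y - d))\<^sup>2"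
    "\<And>j. j \<in> set ys \<Longrightarrow> norm (proj v (L v d) $ j) \<le> (2/\<theta> + K) * norm (y - d)"
  proof -
    have "distinct ys" "set ys \<subseteq> A" using snoc.prems by auto
    note ih = snoc.IH[OF this, folded y_def]
    show "y \<in> tangent v" "\<And>j. j \<notin> set ys \<Longrightarrow> y $ j = d $ j" "q y \<le> q d - (1/\<theta>) * (norm (y - d))\<^sup>2"
      "\<And>j. j \<in> set ys \<Longrightarrow> norm (proj v (L v d) $ j) \<le> (2/\<theta> + K) * norm (y - d)"
      using ih by blast+
  qed
  have i: "i \<notin> set ys" "i \<in> A" using snoc.prems by auto
  have eq: "fold (D v) (ys @ [i]) d = D v i y" by (simp add: y_def)
  have vv: "v $ i \<bullet> v $ i = 1" using vc i(2) by (simp add: configs_def norm_eq_1)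
  have yv: "y $ i \<bullet> v $ i = 0" using yt by (simp add: tangent_def)
  \<comment> \<open>By \<open>crit_arg\<close> this is the length of column \<open>i\<close> of
    \<open>v\<close> before its renormalisation.\<close>
  define m where "m = 1 - \<theta> * lam v i"
  have m: "0 < m" "m \<le> 2" using crit_lam_bounds[OF v, of i] by (auto simp: m_def)
  define \<delta> where "\<delta> = - (\<theta> / m) *\<^sub>R proj v (L v y) $ i"
  have arg: "y $ i - \<theta> *\<^sub>R G y $ i = m *\<^sub>R y $ i - \<theta> *\<^sub>R L v y $ i"
    by (simp add: L_def m_def algebra_simps)
  have Di: "D v i y $ i = y $ i + \<delta>"
    unfolding D_nth arg m_def[symmetric] \<delta>_def proj_def using m yv
    by (simp add: inner_diff_left algebra_simps divide_inverse)
  have Dy: "D v i y = y + axis i \<delta>"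
    using Di by (auto simp: vec_eq_iff axis_def D_nth)
  have dv: "\<delta> \<bullet> v $ i = 0" by (simp add: \<delta>_def proj_def inner_diff_left vv)
  have dt: "D v i y \<in> tangent v"
    using yt dv i(2) by (auto simp: tangent_def Dy axis_def inner_add_left)
  have proj_inner: "\<delta> \<bullet> L v y $ i = \<delta> \<bullet> proj v (L v y) $ i"
    using dv by (simp add: proj_def inner_diff_right)
  have pL: "proj v (L v y) $ i = - (m / \<theta>) *\<^sub>R \<delta>" using m \<theta>_pos by (simp add: \<delta>_def)
  \<comment> \<open>Zero diagonal of \<open>c\<close> again: a move in column \<open>i\<close> alone
    meets only its multiplier.\<close>
  have Lax: "L v (axis i \<delta>) $ i = - lam v i *\<^sub>R \<delta>"
    by (auto simp: L_def G_nth axis_def c_diag intro!: sum.neutral)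
  have ql: "q (D v i y) = q y - ((1 + m) / \<theta>) * (norm \<delta>)\<^sup>2"
  proof -
    have "q (D v i y) = q y + 2 * (axis i \<delta> \<bullet> L v y) + axis i \<delta> \<bullet> L v (axis i \<delta>)"
      using L_selfadj[of v y "axis i \<delta>"]
      unfolding q_def Dy linear_add[OF linear_L] inner_add_left inner_add_right
      by (simp add: inner_commute[of "L v y"])
    also have "\<dots> = q y + 2 * (\<delta> \<bullet> L v y $ i) + \<delta> \<bullet> (- lam v i *\<^sub>R \<delta>)"
      unfolding inner_axis' Lax by simp
    also have "\<dots> = q y - (2 * (m / \<theta>) + lam v i) * (norm \<delta>)\<^sup>2"
      unfolding proj_inner pL by (simp add: power2_norm_eq_inner algebra_simps)
    also have "2 * (m / \<theta>) + lam v i = (1 + m) / \<theta>" using \<theta>_pos by (simp add: m_def field_simps)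
    finally show ?thesis .
  qed
  have nD: "norm (D v i y - y) = norm \<delta>" by (simp add: Dy norm_axis_vec)
  have orth: "(y - d) \<bullet> axis i \<delta> = 0" using IH(1)[OF i(1)] by (simp add: inner_axis)
  have pyth: "(norm (D v i y - d))\<^sup>2 = (norm (y - d))\<^sup>2 + (norm \<delta>)\<^sup>2"
  proof -
    have "D v i y - d = (y - d) + axis i \<delta>" by (simp add: Dy)
    then show ?thesis using norm_add_Pythagorean[of "y - d" "axis i \<delta>"] orth by (simp only: orthogonal_def norm_axis_vec)
  qed
  have le1: "norm (y - d) \<le> norm (D v i y - d)"
    by (rule power2_le_imp_le, simp add: pyth, simp)
  have le2: "norm \<delta> \<le> norm (D v i y - d)"
    by (rule power2_le_imp_le, simp add: pyth, simp)
  have Kle: "K * norm (y - d) \<le> K * norm (D v i y - d)" using le1 K0 by (rule mult_left_mono)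
  have "(1/\<theta>) * (norm \<delta>)\<^sup>2 \<le> ((1 + m) / \<theta>) * (norm \<delta>)\<^sup>2"
    using m \<theta>_pos by (intro mult_right_mono divide_right_mono) auto
  then have a: "q (D v i y) \<le> q d - (1/\<theta>) * (norm (D v i y - d))\<^sup>2"
    using IH(2) unfolding ql pyth by (simp add: algebra_simps add_divide_distrib)
  have b: "norm (proj v (L v d) $ j) \<le> (2/\<theta> + K) * norm (D v i y - d)" if "j \<in> insert i (set ys)" for j
  proof (cases "j = i")
    case True
    have "proj v (L v d) $ i = proj v (L v y) $ i - proj v (L v (y - d)) $ i"
      by (simp add: proj_def linear_diff[OF linear_L] algebra_simps inner_diff_left)
    then have "norm (proj v (L v d) $ i) \<le> norm (proj v (L v y) $ i) + norm (proj v (L v (y - d)) $ i)"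
      by (metis norm_triangle_ineq4)
    also have "norm (proj v (L v (y - d)) $ i) \<le> K * norm (y - d)"
      using norm_proj_le[OF vc, of "L v (y - d)" i] K[of "y - d"] Finite_Cartesian_Product.norm_nth_le[of "L v (y - d)" i] by linarith
    also have "norm (proj v (L v y) $ i) \<le> (2/\<theta>) * norm \<delta>"
      unfolding pL using m \<theta>_pos by (simp add: mult_right_mono divide_right_mono)
    also have "(2/\<theta>) * norm \<delta> \<le> (2/\<theta>) * norm (D v i y - d)" using le2 \<theta>_pos by (simp add: divide_right_mono)
    finally show ?thesis using True Kle by (simp add: algebra_simps)
  next
    case False
    then have "norm (proj v (L v d) $ j) \<le> (2/\<theta> + K) * norm (y - d)" using that by (intro IH(3)) auto
    also have "\<dots> \<le> (2/\<theta> + K) * norm (D v i y - d)"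
      using Kle mult_left_mono[OF le1, of "2/\<theta>"] \<theta>_pos by (simp add: algebra_simps)
    finally show ?thesis .
  qed
  have c: "D v i y $ j = d $ j" if "j \<notin> set (ys @ [i])" for j using that IH(1) by (simp add: D_nth)
  have s: "set (ys @ [i]) = insert i (set ys)" by simp
  show ?case unfolding eq using a b c dt unfolding s by blast
qed

lemma proj_selfadj: "proj v x \<bullet> y = x \<bullet> proj v y"
  unfolding inner_vec_def[of "proj v x"] inner_vec_def[of x]
  by (intro sum.cong refl) (simp add: proj_def inner_diff_left inner_diff_right inner_commute)

lemma linear_proj: "linear (proj v)"
  by (rule linearI) (auto simp: proj_def vec_eq_iff algebra_simps inner_add_left)

lemma proj_tangent: "d \<in> tangent v \<Longrightarrow> proj v d = d"
  by (auto simp: proj_def tangent_def vec_eq_iff)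

lemma proj_in_tangent:
  assumes v: "v \<in> configs" and d: "\<And>i. i \<notin> A \<Longrightarrow> d $ i = 0"
  shows "proj v d \<in> tangent v"
proof -
  have "proj v d $ i \<bullet> v $ i = 0" for i
    using v by (cases "i \<in> A") (auto simp: proj_def configs_def norm_eq_1 inner_diff_left)
  then show ?thesis using d by (simp add: tangent_def proj_def)
qed

text \<open>\<open>selfadjoint_form_bound\<close> for the compressed Hessian bounds |q d| by the
  squared projected gradient, and the linearised sweep moves at least proportionally to that
  gradient. Kernel directions, such as those of the rotation orbit, do no harm.\<close>

lemma sweep_gap:
  fixes v :: "real^'k^'i"
  assumes v: "crit v"
  defines "q \<equiv> \<lambda>h. h \<bullet> L v h"
  obtains \<kappa> where "\<kappa> > 0"
    "\<And>d. d \<in> tangent v \<Longrightarrow> q (fold (D v) xs d) \<le> q d - (1/\<theta>) * (norm (fold (D v) xs d - d))\<^sup>2"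
    "\<And>d. d \<in> tangent v \<Longrightarrow> \<kappa> * \<bar>q d\<bar> \<le> (norm (fold (D v) xs d - d))\<^sup>2"
proof -
  have vc: "v \<in> configs" using v by (simp add: crit_def)
  obtain K where K: "K > 0" "\<And>h. norm (L v h) \<le> K * norm h"
    using bounded_linear.pos_bounded[OF linear_L[unfolded linear_conv_bounded_linear], of v] by (auto simp: mult.commute)
  note F = fold_D_facts[OF v _ K(2) less_imp_le[OF K(1)] distinct_xs, unfolded set_xs, OF _ subset_refl]
  define T where "T x = proj v (L v (proj v x))" for x
  have linT: "linear T" unfolding T_def
    using linear_compose[OF linear_compose[OF linear_proj linear_L] linear_proj] by (simp add: o_def)
  have saT: "T x \<bullet> y = x \<bullet> T y" for x y unfolding T_def by (simp add: proj_selfadj L_selfadj)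
  obtain c where c: "c > 0" "\<And>x. \<bar>x \<bullet> T x\<bar> \<le> c * (norm (T x))\<^sup>2"
    using selfadjoint_form_bound[OF linT saT] by metis
  define B where "B = real CARD('i) * (2/\<theta> + K)"
  have B: "B > 0" using \<theta>_pos K by (simp add: B_def add_pos_pos)
  show ?thesis
  proof (rule that[of "1 / (c * B\<^sup>2)"])
    show "1 / (c * B\<^sup>2) > 0" using c B by simp
    fix d :: "real^'k^'i" assume d: "d \<in> tangent v"
    show "q (fold (D v) xs d) \<le> q d - (1/\<theta>) * (norm (fold (D v) xs d - d))\<^sup>2"
      using F[OF d] unfolding q_def by blast
    have Td: "T d = proj v (L v d)" using proj_tangent[OF d] by (simp add: T_def)
    have "d \<bullet> T d = q d" unfolding Td proj_selfadj[symmetric] proj_tangent[OF d] q_def ..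
    then have qT: "\<bar>q d\<bar> \<le> c * (norm (T d))\<^sup>2" using c(2)[of d] by simp
    have "norm (T d) \<le> B * norm (fold (D v) xs d - d)"
    proof -
      have "norm (T d) \<le> (\<Sum>i\<in>UNIV. norm (T d $ i))" by (simp add: norm_vec_def L2_set_le_sum)
      also have "\<dots> \<le> (\<Sum>i\<in>(UNIV::'i set). (2/\<theta> + K) * norm (fold (D v) xs d - d))"
      proof (rule sum_mono)
        fix i
        show "norm (T d $ i) \<le> (2/\<theta> + K) * norm (fold (D v) xs d - d)"
        proof (cases "i \<in> A")
          case True
          then show ?thesis using F[OF d] unfolding Td by blast
        next
          case False
          then have "T d $ i = 0" using d unfolding Td by (simp add: proj_def L_def G_out tangent_def)
          then show ?thesis using \<theta>_pos K by simp
        qed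
      qed
      finally show ?thesis by (simp add: B_def)
    qed
    then have "c * (norm (T d))\<^sup>2 \<le> c * (B * norm (fold (D v) xs d - d))\<^sup>2"
      using c(1) by (intro mult_left_mono power_mono) auto
    with qT have "\<bar>q d\<bar> \<le> c * (B * norm (fold (D v) xs d - d))\<^sup>2" by linarith
    then show "1 / (c * B\<^sup>2) * \<bar>q d\<bar> \<le> (norm (fold (D v) xs d - d))\<^sup>2"
      using c B by (simp add: field_simps power_mult_distrib)
  qed
qed

end

section \<open>Initial points trapped near a saddle, and null preimages under the sweep\<close>

lemma borel_measurable_vec_lambda:
  fixes g :: "'i::finite \<Rightarrow> 'a \<Rightarrow> 'e::euclidean_space"
  assumes "\<And>i. g i \<in> borel_measurable M"
  shows "(\<lambda>x. \<chi> i. g i x) \<in> borel_measurable M"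
proof (subst borel_measurable_euclidean_space, intro ballI)
  fix b :: "'e^'i" assume "b \<in> Basis"
  then obtain i u where b: "b = axis i u" "u \<in> Basis" by (auto simp: Basis_vec_def)
  then show "(\<lambda>x. (\<chi> i. g i x) \<bullet> b) \<in> borel_measurable M"
    using assms[of i] by (simp add: inner_axis)
qed

lemma borel_measurable_sgn_vec: "g \<in> borel_measurable M \<Longrightarrow> (\<lambda>x. sgn (g x) :: 'e::euclidean_space) \<in> borel_measurable M"
  unfolding sgn_div_norm by measurable

lemma norm_sgn_diff_le:
  fixes a b :: "'e::real_normed_vector"
  assumes "a \<noteq> 0" "b \<noteq> 0"
  shows "norm (sgn a - sgn b) \<le> 2 / norm b * norm (a - b)"
proof -
  have "sgn a - sgn b = (1 / norm b) *\<^sub>R (a - b) + (1 / norm a - 1 / norm b) *\<^sub>R a"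
    by (simp add: sgn_div_norm algebra_simps divide_inverse)
  then have "norm (sgn a - sgn b) \<le> norm ((1 / norm b) *\<^sub>R (a - b)) + norm ((1 / norm a - 1 / norm b) *\<^sub>R a)"
    by (simp only: norm_triangle_ineq)
  also have "norm ((1 / norm a - 1 / norm b) *\<^sub>R a) = \<bar>norm b - norm a\<bar> / norm b"
  proof -
    have "\<bar>1 / norm a - 1 / norm b\<bar> * norm a = \<bar>(1 / norm a - 1 / norm b) * norm a\<bar>" by (simp add: abs_mult)
    also have "(1 / norm a - 1 / norm b) * norm a = (norm b - norm a) / norm b" using assms by (simp add: field_simps)
    finally show ?thesis by simp
  qed
  also have "\<dots> \<le> norm (a - b) / norm b"
    using norm_triangle_ineq3[of a b] by (intro divide_right_mono) (auto simp: abs_minus_commute)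
  finally show ?thesis by simp
qed

context mixing begin

text \<open>Starting points are parametrised by unnormalised columns, so that all null sets live in
  a vector space with Lebesgue measure and not on a product of spheres.\<close>

definition normalized :: "real^'k^'i \<Rightarrow> real^'k^'i" where "normalized W = (\<chi> i. if i \<in> A then sgn (W $ i) else 0)"

definition nonzero_cols :: "(real^'k^'i) set" where "nonzero_cols = {W. \<forall>i\<in>A. W $ i \<noteq> 0}"

definition saddle :: "real^'k^'i \<Rightarrow> bool" where "saddle v \<longleftrightarrow> crit v \<and> (\<exists>e\<in>tangent v. e \<bullet> L v e < 0)"

lemma normalized_nth: "normalized W $ i = (if i \<in> A then sgn (W $ i) else 0)" by (simp add: normalized_def)

lemma normalized_configs: "W \<in> nonzero_cols \<Longrightarrow> normalized W \<in> configs" by (auto simp: nonzero_cols_def configs_def normalized_nth norm_sgn)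

lemma measurable_step_map: "step_map i \<in> borel_measurable borel"
proof -
  have G: "(\<lambda>x. G x $ i) \<in> borel_measurable borel" for i
    by (rule borel_measurable_continuous_onI) (intro continuous_intros continuous_on_G)
  have n: "(\<lambda>x. x $ j) \<in> borel_measurable borel" for j :: 'i
    by (rule borel_measurable_continuous_onI) (intro continuous_intros)
  have "(\<lambda>x. if j = i then sgn (x $ i - \<theta> *\<^sub>R G x $ i) else x $ j) \<in> borel_measurable borel" for j
    by (cases "j = i") (use G n in \<open>auto intro!: borel_measurable_sgn_vec borel_measurable_diff borel_measurable_scaleR\<close>)
  then show ?thesis unfolding step_map_def[abs_def] by (rule borel_measurable_vec_lambda)
qed

lemma measurable_sweep: "sweep \<in> borel_measurable borel"
proof -
  have "fold step_map ys \<in> borel_measurable borel" for ys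
  proof (induction ys)
    case (Cons i ys)
    then show ?case using measurable_comp[OF measurable_step_map Cons] by (simp add: o_def)
  qed (simp add: id_def)
  then show ?thesis by (simp add: sweep_def[abs_def])
qed

lemma measurable_normalized: "(normalized :: real^'k^'i \<Rightarrow> _) \<in> borel_measurable borel"
proof -
  have n: "(\<lambda>x::real^'k^'i. x $ j) \<in> borel_measurable borel" for j :: 'i
    by (rule borel_measurable_continuous_onI) (intro continuous_intros)
  have "(\<lambda>x::real^'k^'i. if j \<in> A then sgn (x $ j) else 0) \<in> borel_measurable borel" for j
    by (cases "j \<in> A") (use n in \<open>auto intro!: borel_measurable_sgn_vec\<close>)
  then show ?thesis unfolding normalized_def[abs_def] by (rule borel_measurable_vec_lambda)
qed

lemma measurable_sweep_normalized: "(\<lambda>W. (sweep ^^ t) (normalized W)) \<in> borel_measurable borel"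
proof (induction t)
  case (Suc t)
  have "(sweep ^^ Suc t) (normalized W) = sweep ((sweep ^^ t) (normalized W))" for W :: "real^'k^'i"
    by (simp add: funpow_swap1 funpow_Suc_right)
  then show ?case using measurable_comp[OF Suc measurable_sweep] by (simp add: o_def)
qed (simp add: measurable_normalized)

text \<open>The difference of two trapped orbits that start nearly along \<open>e0\<close> stays in
  the expanding cone, where -q grows at least like \<open>\<rho> ^ t\<close>, while its norm never
  exceeds 2 * \<delta>. Hence the initial difference vanishes.\<close>

lemma trapped_pair:
  fixes v :: "real^'k^'i"
  assumes v: "crit v" and e0: "e0 \<in> tangent v" "e0 \<bullet> L v e0 < 0"
  obtains \<delta> \<epsilon>0 where "\<delta> > 0" "\<epsilon>0 > 0" "\<delta> * norm e0 \<le> \<epsilon>0 / 2"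
    "\<And>x y s. x \<in> configs \<Longrightarrow> y \<in> configs \<Longrightarrow> (\<And>t. (sweep ^^ t) x \<in> ball v \<delta>) \<Longrightarrow> (\<And>t. (sweep ^^ t) y \<in> ball v \<delta>) \<Longrightarrow>
       norm (y - x - s *\<^sub>R e0) \<le> \<epsilon>0 * \<bar>s\<bar> \<Longrightarrow> s = 0"
proof -
  have vc: "v \<in> configs" using v by (simp add: crit_def)
  have e0nz: "e0 \<noteq> 0" using e0(2) by auto
  have sd: "strict_deriv sweep (fold (D v) xs) v"
    using strict_deriv_fold[OF v, of xs] by (simp add: sweep_def[abs_def] set_xs)
  have bl: "bounded_linear (fold (D v) xs)" using sd by (simp add: strict_deriv_def)
  have bL: "bounded_linear (L v)" using linear_L linear_conv_bounded_linear by blast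
  obtain \<kappa> where \<kappa>: "\<kappa> > 0"
    "\<And>d. d \<in> tangent v \<Longrightarrow> fold (D v) xs d \<bullet> L v (fold (D v) xs d) \<le> d \<bullet> L v d - (1/\<theta>) * (norm (fold (D v) xs d - d))\<^sup>2"
    "\<And>d. d \<in> tangent v \<Longrightarrow> \<kappa> * \<bar>d \<bullet> L v d\<bar> \<le> (norm (fold (D v) xs d - d))\<^sup>2"
    using sweep_gap[OF v] by blast
  have Pn: "norm (proj v d) \<le> norm d" for d
    using norm_vec_mono[of "proj v d" 1 d] norm_proj_le[OF vc, of d] by simp
  obtain \<eta> \<rho> \<epsilon> \<epsilon>1 where c: "\<eta> > 0" "\<rho> > 1" "\<epsilon> > 0" "\<epsilon>1 > 0"
    and start: "\<And>d s. norm (d - s *\<^sub>R e0) \<le> \<epsilon>1 * \<bar>s\<bar> \<Longrightarrow> d \<bullet> L v d \<le> - \<eta> * (norm d)\<^sup>2"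
    and grow: "\<And>d d'. proj v d \<in> tangent v \<Longrightarrow> norm (d - proj v d) \<le> \<epsilon> * norm d \<Longrightarrow> norm (d' - fold (D v) xs d) \<le> \<epsilon> * norm d \<Longrightarrow>
        d \<bullet> L v d \<le> - \<eta> * (norm d)\<^sup>2 \<Longrightarrow> d' \<bullet> L v d' \<le> - \<eta> * (norm d')\<^sup>2 \<and> d' \<bullet> L v d' \<le> \<rho> * (d \<bullet> L v d)"
    using expanding_cone[OF bL bl Pn _ \<kappa>(1) \<kappa>(2,3) e0(2)] \<theta>_pos by (metis zero_less_divide_1_iff)
  obtain \<delta>1 where \<delta>1: "\<delta>1 > 0"
    "\<And>y z. y \<in> ball v \<delta>1 \<Longrightarrow> z \<in> ball v \<delta>1 \<Longrightarrow> norm (sweep z - sweep y - fold (D v) xs (z - y)) \<le> \<epsilon> * norm (z - y)"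
    using strict_derivD[OF sd c(3)] by metis
  \<comment> \<open>\<open>\<epsilon>0 \<le> norm e0 / 2\<close> leaves s = 0 as the only choice
    once the initial difference vanishes. In the next line, \<open>\<delta> \<le> \<epsilon>\<close>
    makes differences of configurations nearly tangent, and the last bound keeps the tilt
    \<open>N E - e0\<close> in \<open>trap_negligible\<close> within half of
    \<open>\<epsilon>0\<close>.\<close>
  define \<epsilon>0 where "\<epsilon>0 = min \<epsilon>1 (norm e0 / 2)"
  define \<delta> where "\<delta> = min \<delta>1 (min \<epsilon> (\<epsilon>0 / (2 * norm e0)))"
  have \<epsilon>0: "\<epsilon>0 > 0" "\<epsilon>0 \<le> \<epsilon>1" "\<epsilon>0 \<le> norm e0 / 2" using c e0nz by (auto simp: \<epsilon>0_def)
  have \<delta>: "\<delta> > 0" "\<delta> \<le> \<delta>1" "\<delta> \<le> \<epsilon>" using \<delta>1 c \<epsilon>0 e0nz by (auto simp: \<delta>_def)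
  have \<delta>e: "\<delta> * norm e0 \<le> \<epsilon>0 / 2"
  proof -
    have "\<delta> \<le> \<epsilon>0 / (2 * norm e0)" by (simp add: \<delta>_def)
    then have "\<delta> * (2 * norm e0) \<le> \<epsilon>0" using e0nz pos_le_divide_eq[of "2 * norm e0"] by simp
    then show ?thesis by simp
  qed
  obtain K where K: "K > 0" "\<And>h. norm (L v h) \<le> K * norm h"
    using bounded_linear.pos_bounded[OF bL] by (auto simp: mult.commute)
  have main: "s = 0" if x: "x \<in> configs" and y: "y \<in> configs" and tx: "\<And>t. (sweep ^^ t) x \<in> ball v \<delta>" and ty: "\<And>t. (sweep ^^ t) y \<in> ball v \<delta>"
    and s: "norm (y - x - s *\<^sub>R e0) \<le> \<epsilon>0 * \<bar>s\<bar>" for x y s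
  proof -
    define d where "d t = (sweep ^^ t) y - (sweep ^^ t) x" for t
    define q where "q t = d t \<bullet> L v (d t)" for t
    have pd: "norm (d t - proj v (d t)) \<le> \<epsilon> * norm (d t) \<and> proj v (d t) \<in> tangent v" for t
    proof
      define a where "a = (sweep ^^ t) x"
      define b where "b = (sweep ^^ t) y"
      have ab: "a \<in> configs" "b \<in> configs" "norm (a - v) < \<delta>" "norm (b - v) < \<delta>"
        using funpow_sweep_configs[OF x] funpow_sweep_configs[OF y] tx[of t] ty[of t] by (auto simp: a_def b_def dist_norm norm_minus_commute)
      have dab: "d t = b - a" by (simp add: d_def a_def b_def)
      show "proj v (d t) \<in> tangent v"
        by (rule proj_in_tangent[OF vc]) (use ab in \<open>simp add: dab configs_def\<close>)
      show "norm (d t - proj v (d t)) \<le> \<epsilon> * norm (d t)"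
      proof (rule norm_vec_mono)
        fix i
        have aa: "a $ i \<bullet> a $ i = b $ i \<bullet> b $ i"
          using ab by (cases "i \<in> A") (auto simp: configs_def norm_eq_1)
        \<comment> \<open>The chord between two vectors of equal length is orthogonal to their sum,
          so its component along \<open>v $ i\<close> is seen only by the offset of
          \<open>v $ i\<close> from their midpoint, which is at most \<delta>.\<close>
        define m where "m = v $ i - (1/2) *\<^sub>R (a $ i + b $ i)"
        have "d t $ i \<bullet> (a $ i + b $ i) = 0"
          using aa by (simp add: dab inner_diff_left inner_add_right inner_commute[of "b $ i" "a $ i"])
        then have "d t $ i \<bullet> v $ i = d t $ i \<bullet> m" by (simp add: m_def inner_diff_right)
        also have "\<bar>\<dots>\<bar> \<le> norm (d t $ i) * norm m" by (rule Cauchy_Schwarz_ineq2)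
        also have "norm m \<le> \<delta>"
        proof -
          have "m = (1/2) *\<^sub>R ((v - a) $ i + (v - b) $ i)" by (simp add: m_def vec_eq_iff field_simps)
          then have "norm m \<le> (norm ((v - a) $ i) + norm ((v - b) $ i)) / 2"
            using norm_triangle_ineq[of "(v - a) $ i" "(v - b) $ i"] by simp
          also have "\<dots> \<le> \<delta>"
            using Finite_Cartesian_Product.norm_nth_le[of "v - a" i] Finite_Cartesian_Product.norm_nth_le[of "v - b" i] ab(3,4)
            by (simp add: norm_minus_commute)
          finally show ?thesis .
        qed
        finally have 1: "\<bar>d t $ i \<bullet> v $ i\<bar> \<le> norm (d t $ i) * \<delta>" by (simp add: mult_left_mono)
        have "norm ((d t - proj v (d t)) $ i) = \<bar>d t $ i \<bullet> v $ i\<bar> * norm (v $ i)" by (simp add: proj_def)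
        also have "\<dots> \<le> \<bar>d t $ i \<bullet> v $ i\<bar>" using configs_norm_le[OF vc] by (simp add: mult_left_le)
        also have "\<dots> \<le> \<epsilon> * norm (d t $ i)" using 1 \<delta>(3) mult_left_mono[of \<delta> \<epsilon> "norm (d t $ i)"] by (simp add: mult.commute)
        finally show "norm ((d t - proj v (d t)) $ i) \<le> \<epsilon> * norm (d t $ i)" .
      qed (use c in simp)
    qed
    have Suc_eq: "(sweep ^^ Suc t) w = sweep ((sweep ^^ t) w)" for t and w :: "real^'k^'i"
      by (simp add: funpow_swap1 funpow_Suc_right)
    have step: "norm (d (Suc t) - fold (D v) xs (d t)) \<le> \<epsilon> * norm (d t)" for t
      unfolding d_def Suc_eq using tx[of t] ty[of t] \<delta>(2) by (intro \<delta>1(2)) auto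
    have "norm (d 0 - s *\<^sub>R e0) \<le> \<epsilon>1 * \<bar>s\<bar>"
      using s mult_right_mono[OF \<epsilon>0(2), of "\<bar>s\<bar>"] by (simp add: d_def)
    from start[OF this] have init: "q 0 \<le> - \<eta> * (norm (d 0))\<^sup>2" by (simp add: q_def)
    have ind: "q t \<le> - \<eta> * (norm (d t))\<^sup>2 \<and> q t \<le> \<rho> ^ t * q 0" for t
    proof (induction t)
      case 0 then show ?case using init by simp
    next
      case (Suc t)
      have "q (Suc t) \<le> - \<eta> * (norm (d (Suc t)))\<^sup>2 \<and> q (Suc t) \<le> \<rho> * q t"
        unfolding q_def by (rule grow) (use pd[of t] step[of t] Suc in \<open>auto simp: q_def\<close>)
      moreover have "\<rho> * q t \<le> \<rho> * (\<rho> ^ t * q 0)" using Suc c(2) by (intro mult_left_mono) auto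
      ultimately show ?case by simp
    qed
    have "q 0 \<ge> 0"
    proof (rule ccontr)
      assume "\<not> q 0 \<ge> 0"
      then have neg: "- q 0 > 0" by simp
      \<comment> \<open>A time at which the geometric lower bound for -q exceeds what any difference
        inside the trap can reach.\<close>
      obtain t where t: "K * (2 * \<delta>)\<^sup>2 / (- q 0) < \<rho> ^ t" using real_arch_pow[OF c(2)] by blast
      have "norm (d t) \<le> 2 * \<delta>"
        using norm_triangle_ineq4[of "(sweep ^^ t) y - v" "(sweep ^^ t) x - v"] tx[of t] ty[of t]
        by (simp add: d_def dist_norm norm_minus_commute)
      have "- q t \<le> norm (d t) * norm (L v (d t))"
        using Cauchy_Schwarz_ineq2[of "d t" "L v (d t)"] by (simp add: q_def abs_le_iff)
      also have "\<dots> \<le> norm (d t) * (K * norm (d t))" by (intro mult_left_mono K) auto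
      also have "\<dots> = K * (norm (d t))\<^sup>2" by (simp add: power2_eq_square)
      also have "\<dots> \<le> K * (2 * \<delta>)\<^sup>2" using \<open>norm (d t) \<le> 2 * \<delta>\<close> K by (intro mult_left_mono power_mono) auto
      also have "\<dots> < \<rho> ^ t * (- q 0)" using t pos_divide_less_eq[OF neg] by blast
      also have "\<dots> \<le> - q t" using ind[of t] by simp
      finally show False by simp
    qed
    then have "\<eta> * (norm (d 0))\<^sup>2 \<le> 0" using init by simp
    then have "d 0 = 0" using c(1) by (simp add: mult_le_0_iff)
    then have "\<bar>s\<bar> * norm e0 \<le> \<epsilon>0 * \<bar>s\<bar>" using s by (simp add: d_def)
    also have "\<dots> \<le> \<bar>s\<bar> * (norm e0 / 2)" using mult_right_mono[OF \<epsilon>0(3), of "\<bar>s\<bar>"] by (simp add: mult.commute)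
    finally show "s = 0" using e0nz by (simp add: field_simps mult_le_0_iff)
  qed
  show ?thesis by (rule that[OF \<delta>(1) \<epsilon>0(1) \<delta>e main])
qed

lemma strict_deriv_normalized:
  assumes W: "W \<in> nonzero_cols"
  shows "strict_deriv normalized (\<lambda>h. \<chi> i. if i \<in> A then (h $ i - (h $ i \<bullet> sgn (W $ i)) *\<^sub>R sgn (W $ i)) /\<^sub>R norm (W $ i) else 0) W"
  unfolding normalized_def[abs_def]
proof (rule strict_deriv_vec)
  fix i
  show "strict_deriv (\<lambda>x. if i \<in> A then sgn (x $ i) else 0)
     (\<lambda>h. if i \<in> A then (h $ i - (h $ i \<bullet> sgn (W $ i)) *\<^sub>R sgn (W $ i)) /\<^sub>R norm (W $ i) else 0) W"
  proof (cases "i \<in> A")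
    case True
    then have "W $ i \<noteq> 0" using W by (simp add: nonzero_cols_def)
    from strict_deriv_compose[OF strict_deriv_bounded_linear[OF bounded_linear_vec_nth[of i]] strict_deriv_sgn[OF this]]
    show ?thesis using True by simp
  next
    case False
    then show ?thesis by (simp add: strict_deriv_bounded_linear[OF bounded_linear_zero])
  qed
qed

text \<open>Moving \<open>W\<close> along a suitable \<open>E\<close> moves
  \<open>normalized W\<close> nearly along \<open>e0\<close>, so by \<open>trapped_pair\<close> each
  line in direction \<open>E\<close> meets the trapped set at most once near \<open>W0\<close>. As
  \<open>E\<close> depends on \<open>W0\<close>, this is a local statement, and negligibility is
  patched together at the end.\<close>

lemma trap_negligible:
  fixes v :: "real^'k^'i"
  assumes v: "saddle v"
  obtains \<delta> where "\<delta> > 0" "negligible {W \<in> nonzero_cols. \<forall>t. (sweep ^^ t) (normalized W) \<in> ball v \<delta>}"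
proof -
  obtain e0 where cv: "crit v" and e0: "e0 \<in> tangent v" "e0 \<bullet> L v e0 < 0" using v by (auto simp: saddle_def)
  have e0nz: "e0 \<noteq> 0" using e0(2) by auto
  obtain \<delta> \<epsilon>0 where \<delta>: "\<delta> > 0" "\<epsilon>0 > 0" "\<delta> * norm e0 \<le> \<epsilon>0 / 2"
    and pair: "\<And>x y s. x \<in> configs \<Longrightarrow> y \<in> configs \<Longrightarrow> (\<And>t. (sweep ^^ t) x \<in> ball v \<delta>) \<Longrightarrow> (\<And>t. (sweep ^^ t) y \<in> ball v \<delta>) \<Longrightarrow>
       norm (y - x - s *\<^sub>R e0) \<le> \<epsilon>0 * \<bar>s\<bar> \<Longrightarrow> s = 0"
    using trapped_pair[OF cv e0] by metis
  define T where "T = {W \<in> nonzero_cols. \<forall>t. (sweep ^^ t) (normalized W) \<in> ball v \<delta>}"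
  have NZb: "(nonzero_cols :: (real^'k^'i) set) \<in> sets borel"
  proof -
    have "open (nonzero_cols :: (real^'k^'i) set)"
    proof -
      have "(nonzero_cols :: (real^'k^'i) set) = (\<Inter>i\<in>A. {W. W $ i \<noteq> 0})" by (auto simp: nonzero_cols_def)
      then show ?thesis by (simp only:) (intro open_INT ballI open_Collect_neq continuous_intros finite)
    qed
    then show ?thesis by simp
  qed
  have Tb: "T \<in> sets borel"
  proof -
    have eq: "T = nonzero_cols \<inter> (\<Inter>t. (\<lambda>W. (sweep ^^ t) (normalized W)) -` ball v \<delta>)" by (auto simp: T_def)
    have "(\<lambda>W. (sweep ^^ t) (normalized W)) -` ball v \<delta> \<in> sets borel" for t
      using measurable_sets[OF measurable_sweep_normalized[of t], of "ball v \<delta>"] by simp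
    then show ?thesis unfolding eq using NZb by (intro sets.Int sets.countable_INT) auto
  qed
  have "\<exists>U. openin (top_of_set T) U \<and> W0 \<in> U \<and> negligible U" if W0: "W0 \<in> T" for W0
  proof -
    have W0': "W0 \<in> nonzero_cols" "normalized W0 \<in> ball v \<delta>" using W0 by (auto simp: T_def dest: spec[of _ 0])
    \<comment> \<open>The column lengths undo the division by the norm in the derivative
      \<open>N\<close> of \<open>normalized\<close>, so \<open>N E\<close> is \<open>e0\<close>
      without its radial parts at \<open>W0\<close>.\<close>
    define E where "E = (\<chi> i. norm (W0 $ i) *\<^sub>R e0 $ i)"
    define N where "N = (\<lambda>h. \<chi> i. if i \<in> A then (h $ i - (h $ i \<bullet> sgn (W0 $ i)) *\<^sub>R sgn (W0 $ i)) /\<^sub>R norm (W0 $ i) else 0)"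
    have sd: "strict_deriv normalized N W0" unfolding N_def by (rule strict_deriv_normalized[OF W0'(1)])
    have Enz: "E \<noteq> 0"
    proof
      assume "E = 0"
      then have *: "norm (W0 $ i) *\<^sub>R e0 $ i = 0" for i by (simp add: E_def vec_eq_iff)
      have "e0 $ i = 0" for i
        using *[of i] W0'(1) e0(1) by (cases "i \<in> A") (auto simp: nonzero_cols_def tangent_def)
      then show False using e0nz by (simp add: vec_eq_iff)
    qed
    have NE: "norm (N E - e0) \<le> \<delta> * norm e0"
    proof (rule norm_vec_mono)
      fix i
      show "norm ((N E - e0) $ i) \<le> \<delta> * norm (e0 $ i)"
      proof (cases "i \<in> A")
        case True
        then have w: "norm (W0 $ i) \<noteq> 0" using W0'(1) by (simp add: nonzero_cols_def)
        have "N E $ i - e0 $ i = - (e0 $ i \<bullet> sgn (W0 $ i)) *\<^sub>R sgn (W0 $ i)"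
          using True w by (simp add: N_def E_def algebra_simps)
        then have "norm ((N E - e0) $ i) = \<bar>e0 $ i \<bullet> sgn (W0 $ i)\<bar>" using w by (simp add: norm_sgn)
        \<comment> \<open>\<open>e0\<close> is orthogonal to the columns of \<open>v\<close>, so
          only the deviation of \<open>normalized W0\<close> from \<open>v\<close> enters, which is
          below \<delta>.\<close>
        also have "e0 $ i \<bullet> sgn (W0 $ i) = e0 $ i \<bullet> (normalized W0 - v) $ i"
          using e0(1) True by (simp add: tangent_def inner_diff_right normalized_nth)
        also have "\<bar>\<dots>\<bar> \<le> norm (e0 $ i) * norm ((normalized W0 - v) $ i)" by (rule Cauchy_Schwarz_ineq2)
        also have "\<dots> \<le> norm (e0 $ i) * \<delta>"
          using Finite_Cartesian_Product.norm_nth_le[of "normalized W0 - v" i] W0'(2)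
          by (intro mult_left_mono) (auto simp: dist_norm norm_minus_commute)
        finally show ?thesis by (simp add: mult.commute)
      next
        case False
        then show ?thesis using e0(1) \<delta>(1) by (simp add: N_def tangent_def)
      qed
    qed (use \<delta> in simp)
    have "\<epsilon>0 / (2 * norm E) > 0" using \<delta> Enz by simp
    then obtain r where r: "r > 0"
      "\<And>y z. y \<in> ball W0 r \<Longrightarrow> z \<in> ball W0 r \<Longrightarrow> norm (normalized z - normalized y - N (z - y)) \<le> \<epsilon>0 / (2 * norm E) * norm (z - y)"
      using strict_derivD[OF sd] by metis
    have linN: "linear N" using sd by (simp add: strict_deriv_def bounded_linear.linear)
    have "negligible (T \<inter> ball W0 r)"
    proof (rule negligible_thin_translates[OF _ _ Enz])
      show "T \<inter> ball W0 r \<in> sets lebesgue" using Tb by (intro sets_completionI_sets) auto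
      show "bounded (T \<inter> ball W0 r)" by (rule bounded_subset[OF bounded_ball]) auto
      fix W s assume W: "W \<in> T \<inter> ball W0 r" "W + s *\<^sub>R E \<in> T \<inter> ball W0 r"
      show "s = 0"
      proof (rule pair[of "normalized W" "normalized (W + s *\<^sub>R E)"])
        have "norm (normalized (W + s *\<^sub>R E) - normalized W - N (s *\<^sub>R E)) \<le> \<epsilon>0 / (2 * norm E) * norm (s *\<^sub>R E)"
          using r(2)[of W "W + s *\<^sub>R E"] W by simp
        also have "\<dots> = \<epsilon>0 / 2 * \<bar>s\<bar>" using Enz by simp
        finally have 1: "norm (normalized (W + s *\<^sub>R E) - normalized W - N (s *\<^sub>R E)) \<le> \<epsilon>0 / 2 * \<bar>s\<bar>" .
        have "N (s *\<^sub>R E) - s *\<^sub>R e0 = s *\<^sub>R (N E - e0)" by (simp add: linear_scale[OF linN] scaleR_diff_right)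
        then have "norm (N (s *\<^sub>R E) - s *\<^sub>R e0) \<le> \<bar>s\<bar> * (\<delta> * norm e0)" using NE by (simp add: mult_left_mono)
        also have "\<dots> \<le> \<bar>s\<bar> * (\<epsilon>0 / 2)" using \<delta>(3) by (intro mult_left_mono) auto
        finally have 2: "norm (N (s *\<^sub>R E) - s *\<^sub>R e0) \<le> \<epsilon>0 / 2 * \<bar>s\<bar>" by (simp add: mult.commute)
        have "norm (normalized (W + s *\<^sub>R E) - normalized W - s *\<^sub>R e0) \<le> norm (normalized (W + s *\<^sub>R E) - normalized W - N (s *\<^sub>R E)) + norm (N (s *\<^sub>R E) - s *\<^sub>R e0)"
        proof -
          have "normalized (W + s *\<^sub>R E) - normalized W - s *\<^sub>R e0 = (normalized (W + s *\<^sub>R E) - normalized W - N (s *\<^sub>R E)) + (N (s *\<^sub>R E) - s *\<^sub>R e0)" by simp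
          then show ?thesis by (simp only: norm_triangle_ineq)
        qed
        then show "norm (normalized (W + s *\<^sub>R E) - normalized W - s *\<^sub>R e0) \<le> \<epsilon>0 * \<bar>s\<bar>" using 1 2 by simp
      qed (use W in \<open>auto simp: T_def normalized_configs\<close>)
    qed
    moreover have "openin (top_of_set T) (T \<inter> ball W0 r)" by (simp add: openin_open_Int)
    ultimately show ?thesis using W0 r(1) by (intro exI[of _ "T \<inter> ball W0 r"]) auto
  qed
  then have "negligible T" by (subst locally_negligible_alt) blast
  then show ?thesis using that[OF \<delta>(1)] by (simp add: T_def)
qed

text \<open>A lift of \<open>step_map i\<close> along \<open>normalized\<close> that is homogeneous in each column, hence injective;
  the step itself collapses the radial directions.\<close>

definition lifted_step :: "'i \<Rightarrow> real^'k^'i \<Rightarrow> real^'k^'i" where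
  "lifted_step i W = (\<chi> j. if j = i then W $ i - (\<theta> * norm (W $ i)) *\<^sub>R G (normalized W) $ i else W $ j)"

lemma lifted_step_nth: "lifted_step i W $ j = (if j = i then W $ i - (\<theta> * norm (W $ i)) *\<^sub>R G (normalized W) $ i else W $ j)"
  by (simp add: lifted_step_def)

lemma normalized_le1: "norm (normalized W $ i) \<le> 1" by (simp add: normalized_nth norm_sgn)

lemma lifted_step_factor:
  assumes "W \<in> nonzero_cols" "i \<in> A"
  shows "lifted_step i W $ i = norm (W $ i) *\<^sub>R (normalized W $ i - \<theta> *\<^sub>R G (normalized W) $ i)"
  using assms by (simp add: lifted_step_nth normalized_nth sgn_div_norm nonzero_cols_def algebra_simps)

lemma lifted_step_nonzero_cols: "W \<in> nonzero_cols \<Longrightarrow> i \<in> A \<Longrightarrow> lifted_step i W \<in> nonzero_cols"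
proof -
  assume W: "W \<in> nonzero_cols" and i: "i \<in> A"
  have "lifted_step i W $ i \<noteq> 0"
    using step_map_arg_nonzero[OF normalized_configs[OF W] i] W i unfolding lifted_step_factor[OF W i] by (simp add: nonzero_cols_def)
  moreover have "lifted_step i W $ j = W $ j" if "j \<noteq> i" for j using that by (simp add: lifted_step_nth)
  ultimately show "lifted_step i W \<in> nonzero_cols" using W unfolding nonzero_cols_def by fastforce
qed

lemma normalized_lifted_step:
  assumes W: "W \<in> nonzero_cols" and i: "i \<in> A"
  shows "normalized (lifted_step i W) = step_map i (normalized W)"
proof -
  have "sgn (lifted_step i W $ i) = sgn (normalized W $ i - \<theta> *\<^sub>R G (normalized W) $ i)"
    using W i unfolding lifted_step_factor[OF W i] sgn_scaleR by (simp add: nonzero_cols_def)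
  then have "normalized (lifted_step i W) $ j = step_map i (normalized W) $ j" for j
    using i by (cases "j = i") (auto simp: step_map_nth normalized_nth[of "lifted_step i W"], auto simp: lifted_step_nth normalized_nth)
  then show ?thesis by (simp add: vec_eq_iff)
qed

text \<open>Columns other than \<open>i\<close> pass unchanged, so the normalised columns entering
  \<open>G\<close> vary at rate at most 2 / |W j|. In column \<open>i\<close> the step subtracts
  from the identity a term with Lipschitz constant \<beta> < 1 in that column, by the step size
  bound, so \<open>norm \<Delta>\<close> can be absorbed. The constant depends on \<open>W\<close>
  but not on \<open>W'\<close>.\<close>

lemma lifted_step_lower_bound:
  fixes W :: "real^'k^'i"
  assumes W: "W \<in> nonzero_cols"
  shows "\<exists>B. \<forall>W'\<in>nonzero_cols. norm (W' - W) \<le> B * norm (lifted_step i W' - lifted_step i W)"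
proof -
  define \<beta> where "\<beta> = \<theta> * (\<Sum>j\<in>UNIV. \<bar>c i j\<bar>)"
  have \<beta>: "\<beta> < 1" unfolding \<beta>_def by (rule \<theta>_less)
  define B1 where "B1 = (\<Sum>j\<in>UNIV. \<bar>c i j\<bar> * (2 / norm (W $ j)))"
  define B where "B = (1 + \<theta> * norm (W $ i) * B1) / (1 - \<beta>) + 1"
  have B1: "B1 \<ge> 0" unfolding B1_def by (intro sum_nonneg) auto
  have Bp: "B \<ge> 1" unfolding B_def using \<beta> B1 \<theta>_pos by simp
  have "norm (W' - W) \<le> (real CARD('i) * B) * norm (lifted_step i W' - lifted_step i W)" if W': "W' \<in> nonzero_cols" for W'
  proof -
    define z where "z = lifted_step i W' - lifted_step i W"
    have zj: "norm (z $ j) \<le> norm z" for j by (rule Finite_Cartesian_Product.norm_nth_le)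
    have other: "norm ((W' - W) $ j) \<le> norm z" if "j \<noteq> i" for j
      using zj[of j] that by (simp add: z_def lifted_step_nth)
    have g: "norm (G (normalized W') $ i - G (normalized W) $ i) \<le> B1 * norm z"
    proof -
      have "G (normalized W') $ i - G (normalized W) $ i = (\<Sum>j\<in>UNIV. c i j *\<^sub>R (normalized W' $ j - normalized W $ j))"
        by (simp add: G_nth sum_subtractf scaleR_diff_right)
      also have "norm \<dots> \<le> (\<Sum>j\<in>UNIV. \<bar>c i j\<bar> * (2 / norm (W $ j)) * norm z)"
      proof (rule order_trans[OF norm_sum], rule sum_mono)
        fix j
        show "norm (c i j *\<^sub>R (normalized W' $ j - normalized W $ j)) \<le> \<bar>c i j\<bar> * (2 / norm (W $ j)) * norm z"
        proof (cases "j \<in> A \<and> j \<noteq> i")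
          case True
          then have "norm (normalized W' $ j - normalized W $ j) \<le> 2 / norm (W $ j) * norm (W' $ j - W $ j)"
            using W W' norm_sgn_diff_le[of "W' $ j" "W $ j"] by (simp add: normalized_nth nonzero_cols_def)
          also have "\<dots> \<le> 2 / norm (W $ j) * norm z" using other[of j] True by (intro mult_left_mono) auto
          finally have "norm (normalized W' $ j - normalized W $ j) \<le> 2 / norm (W $ j) * norm z" .
          from mult_left_mono[OF this abs_ge_zero[of "c i j"]] show ?thesis by (simp only: norm_scaleR mult.assoc)
        next
          case False
          then have "c i j = 0" using c_diag c_out[of j i] c_sym[of i j] by auto
          then show ?thesis by simp
        qed
      qed
      finally show ?thesis by (simp add: B1_def sum_distrib_right)
    qed
    have gi: "\<theta> * norm (G (normalized W') $ i) \<le> \<beta>"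
    proof -
      have "norm (G (normalized W') $ i) \<le> (\<Sum>j\<in>UNIV. \<bar>c i j\<bar>)"
        unfolding G_nth by (rule order_trans[OF norm_sum]) (auto intro!: sum_mono mult_left_le simp: normalized_le1)
      then show ?thesis using \<theta>_pos by (simp add: \<beta>_def)
    qed
    define \<Delta> where "\<Delta> = W' $ i - W $ i"
    have "\<Delta> = z $ i + (\<theta> * (norm (W' $ i) - norm (W $ i))) *\<^sub>R G (normalized W') $ i + (\<theta> * norm (W $ i)) *\<^sub>R (G (normalized W') $ i - G (normalized W) $ i)"
      by (simp add: \<Delta>_def z_def lifted_step_nth algebra_simps)
    then have "norm \<Delta> \<le> norm (z $ i) + norm ((\<theta> * (norm (W' $ i) - norm (W $ i))) *\<^sub>R G (normalized W') $ i) + norm ((\<theta> * norm (W $ i)) *\<^sub>R (G (normalized W') $ i - G (normalized W) $ i))"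
      by (simp only:) (rule order_trans[OF norm_triangle_ineq add_right_mono[OF norm_triangle_ineq]])
    also have "\<dots> \<le> norm z + \<beta> * norm \<Delta> + (\<theta> * norm (W $ i)) * (B1 * norm z)"
    proof (intro add_mono zj)
      have "norm ((\<theta> * (norm (W' $ i) - norm (W $ i))) *\<^sub>R G (normalized W') $ i) = \<bar>norm (W' $ i) - norm (W $ i)\<bar> * (\<theta> * norm (G (normalized W') $ i))"
        using \<theta>_pos by (simp add: abs_mult)
      also have "\<dots> \<le> norm \<Delta> * \<beta>"
        using gi \<theta>_pos by (intro mult_mono) (auto simp: \<Delta>_def norm_triangle_ineq3)
      finally show "norm ((\<theta> * (norm (W' $ i) - norm (W $ i))) *\<^sub>R G (normalized W') $ i) \<le> \<beta> * norm \<Delta>" by (simp add: mult.commute)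
      show "norm ((\<theta> * norm (W $ i)) *\<^sub>R (G (normalized W') $ i - G (normalized W) $ i)) \<le> (\<theta> * norm (W $ i)) * (B1 * norm z)"
        using g \<theta>_pos by (simp add: mult_left_mono abs_mult)
    qed
    finally have "(1 - \<beta>) * norm \<Delta> \<le> (1 + \<theta> * norm (W $ i) * B1) * norm z" by (simp add: algebra_simps)
    then have "norm \<Delta> \<le> (1 + \<theta> * norm (W $ i) * B1) / (1 - \<beta>) * norm z"
      using \<beta> by (simp add: pos_le_divide_eq mult.commute)
    also have "\<dots> \<le> B * norm z" unfolding B_def by (rule mult_right_mono) auto
    finally have Di: "norm ((W' - W) $ i) \<le> B * norm z" by (simp add: \<Delta>_def)
    have "norm (W' - W) \<le> (\<Sum>j\<in>UNIV. norm ((W' - W) $ j))" by (simp add: norm_vec_def L2_set_le_sum)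
    also have "\<dots> \<le> (\<Sum>j\<in>(UNIV::'i set). B * norm z)"
    proof (rule sum_mono)
      fix j
      show "norm ((W' - W) $ j) \<le> B * norm z"
        using Di other[of j] mult_right_mono[OF Bp, of "norm z"] by (cases "j = i") auto
    qed
    finally show ?thesis by (simp add: z_def)
  qed
  then show ?thesis by blast
qed

text \<open>The preimage is the image of a subset of \<open>N\<close> under the inverse map, which
  is Lipschitz at each point by \<open>lifted_step_lower_bound\<close>; that bound is global in the
  second point, so the whole space serves as neighbourhood.\<close>

lemma lifted_step_vimage_negligible:
  fixes N :: "(real^'k^'i) set"
  assumes N: "negligible N"
  shows "negligible {W \<in> nonzero_cols. lifted_step i W \<in> N}"
proof -
  define S where "S = {W \<in> nonzero_cols. lifted_step i W \<in> N}"
  have inj: "inj_on (lifted_step i) S"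
  proof (rule inj_onI)
    fix W W' assume "W \<in> S" "W' \<in> S" "lifted_step i W = lifted_step i W'"
    then show "W = W'" using lifted_step_lower_bound[of W i] by (force simp: S_def)
  qed
  have "negligible (inv_into S (lifted_step i) ` (lifted_step i ` S))"
  proof (rule negligible_locally_Lipschitz_image)
    show "negligible (lifted_step i ` S)" using N by (rule negligible_subset) (auto simp: S_def)
    fix x assume "x \<in> lifted_step i ` S"
    then obtain W where W: "W \<in> S" "x = lifted_step i W" by auto
    obtain B where B: "\<forall>W'\<in>nonzero_cols. norm (W' - W) \<le> B * norm (lifted_step i W' - lifted_step i W)"
      using lifted_step_lower_bound[of W i] W(1) by (auto simp: S_def)
    show "\<exists>T B. open T \<and> x \<in> T \<and> (\<forall>y\<in>lifted_step i ` S \<inter> T. norm (inv_into S (lifted_step i) y - inv_into S (lifted_step i) x) \<le> B * norm (y - x))"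
      using B W inj by (intro exI[of _ UNIV] exI[of _ B]) (auto simp: S_def)
  qed simp
  then show ?thesis using inj by (simp add: S_def[symmetric])
qed

lemma fold_lifted_step: "W \<in> nonzero_cols \<Longrightarrow> set ys \<subseteq> A \<Longrightarrow> fold lifted_step ys W \<in> nonzero_cols \<and> normalized (fold lifted_step ys W) = fold step_map ys (normalized W)"
  by (induction ys arbitrary: W) (auto simp: lifted_step_nonzero_cols normalized_lifted_step)

lemma fold_lifted_step_vimage_negligible:
  fixes N :: "(real^'k^'i) set"
  assumes "negligible N"
  shows "set ys \<subseteq> A \<Longrightarrow> negligible {W \<in> nonzero_cols. fold lifted_step ys W \<in> N}"
proof (induction ys)
  case Nil
  then show ?case using assms by (auto intro: negligible_subset)
next
  case (Cons i ys)
  then have "negligible {W \<in> nonzero_cols. lifted_step i W \<in> {W \<in> nonzero_cols. fold lifted_step ys W \<in> N}}" by (intro lifted_step_vimage_negligible) auto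
  then show ?case by (rule negligible_subset) (use Cons.prems in \<open>auto simp: lifted_step_nonzero_cols\<close>)
qed

text \<open>\<open>normalized\<close> intertwines the lifted sweep with the sweep, so the null set
  can be pulled back among unnormalised columns, one sweep at a time.\<close>

lemma sweep_vimage_negligible:
  fixes Q :: "real^'k^'i \<Rightarrow> bool"
  assumes "negligible {W \<in> nonzero_cols. Q (normalized W)}"
  shows "negligible {W \<in> nonzero_cols. Q ((sweep ^^ t) (normalized W))}"
proof (induction t)
  case 0
  then show ?case using assms by simp
next
  case (Suc t)
  from fold_lifted_step_vimage_negligible[OF Suc, of xs]
  have "negligible {W \<in> nonzero_cols. fold lifted_step xs W \<in> {W \<in> nonzero_cols. Q ((sweep ^^ t) (normalized W))}}" by (simp add: set_xs)
  then show ?case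
    by (rule negligible_subset) (auto simp: fold_lifted_step set_xs funpow_swap1 sweep_def[symmetric])
qed

text \<open>Convergence to a saddle confines the orbit to a ball of the countable subcover only from
  some time \<open>t0\<close> on; hence the second countable union and the preimages under
  \<open>t0\<close> sweeps.\<close>

lemma saddle_avoidance:
  "negligible {W :: real^'k^'i. W \<in> nonzero_cols \<and> (\<exists>v. saddle v \<and> (\<lambda>t. (sweep ^^ t) (normalized W)) \<longlonglongrightarrow> v)}"
proof -
  define r where "r v = (SOME \<delta>. \<delta> > 0 \<and> negligible {W \<in> nonzero_cols. \<forall>t. (sweep ^^ t) (normalized W) \<in> ball v \<delta>})" for v :: "real^'k^'i"
  have r: "r v > 0" "negligible {W \<in> nonzero_cols. \<forall>t. (sweep ^^ t) (normalized W) \<in> ball v (r v)}" if "saddle v" for v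
    using someI_ex[of "\<lambda>\<delta>. \<delta> > 0 \<and> negligible {W \<in> nonzero_cols. \<forall>t. (sweep ^^ t) (normalized W) \<in> ball v \<delta>}"] trap_negligible[OF that]
    unfolding r_def by blast+
  obtain \<F> where F: "\<F> \<subseteq> (\<lambda>v. ball v (r v)) ` {v. saddle v}" "countable \<F>" "\<Union>\<F> = \<Union>((\<lambda>v. ball v (r v)) ` {v. saddle v})"
    using Lindelof[of "(\<lambda>v. ball v (r v)) ` {v. saddle v}"] by (metis (no_types, lifting) imageE open_ball)
  have neg: "negligible (\<Union>U\<in>\<F>. \<Union>t0. {W \<in> nonzero_cols. \<forall>t. (sweep ^^ t) ((sweep ^^ t0) (normalized W)) \<in> U})"
  proof (intro negligible_countable_Union countable_image F(2) countableI_type)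
    have "negligible {W \<in> nonzero_cols. \<forall>t. (sweep ^^ t) ((sweep ^^ t0) (normalized W)) \<in> U}" if U: "U \<in> \<F>" for U t0
    proof -
      obtain v where "saddle v" "U = ball v (r v)" using F(1) U by blast
      then have N: "negligible {W \<in> nonzero_cols. \<forall>t. (sweep ^^ t) (normalized W) \<in> U}" using r(2) by simp
      show ?thesis by (rule sweep_vimage_negligible[where Q="\<lambda>x. \<forall>t. (sweep ^^ t) x \<in> U" and t=t0, OF N])
    qed
    then show "negligible X" if "X \<in> (\<lambda>U. \<Union>t0. {W \<in> nonzero_cols. \<forall>t. (sweep ^^ t) ((sweep ^^ t0) (normalized W)) \<in> U}) ` \<F>" for X
      using that by (auto intro!: negligible_countable_Union)
  qed
  show ?thesis
  proof (rule negligible_subset[OF neg], safe)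
    fix W v :: "real^'k^'i" assume W: "W \<in> nonzero_cols" "saddle v" "(\<lambda>t. (sweep ^^ t) (normalized W)) \<longlonglongrightarrow> v"
    have "v \<in> \<Union>\<F>" unfolding F(3) using W(2) r(1)[OF W(2)] by auto
    then obtain U where U: "U \<in> \<F>" "v \<in> U" by auto
    moreover have "open U" using F(1) U(1) by auto
    ultimately have "\<forall>\<^sub>F t in sequentially. (sweep ^^ t) (normalized W) \<in> U" using W(3) topological_tendstoD by blast
    then obtain t0 where t0: "\<And>t. t \<ge> t0 \<Longrightarrow> (sweep ^^ t) (normalized W) \<in> U" by (auto simp: eventually_sequentially)
    have "\<forall>t. (sweep ^^ t) ((sweep ^^ t0) (normalized W)) \<in> U"
      using t0 by (auto simp: funpow_add[unfolded o_def fun_eq_iff, rule_format, symmetric])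
    then show "W \<in> (\<Union>U\<in>\<F>. \<Union>t0. {W \<in> nonzero_cols. \<forall>t. (sweep ^^ t) ((sweep ^^ t0) (normalized W)) \<in> U})"
      using W(1) U(1) by auto
  qed
qed

end

section \<open>Almost every cost matrix is Morse--Bott\<close>

lemma negligible_critical_values:
  fixes \<Phi> :: "real^'m::{finite,wellorder} \<Rightarrow> real^'m::_"
  assumes der: "\<And>x. (\<Phi> has_derivative D x) (at x)"
  shows "negligible (\<Phi> ` {x. \<exists>h. h \<noteq> 0 \<and> D x h = 0})"
proof (rule baby_Sard)
  fix x assume x: "x \<in> {x. \<exists>h. h \<noteq> 0 \<and> D x h = 0}"
  show "(\<Phi> has_derivative D x) (at x within {x. \<exists>h. h \<noteq> 0 \<and> D x h = 0})"
    by (rule has_derivative_at_withinI[OF der])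
  have lin: "linear (D x)" using der[of x] by (rule has_derivative_linear)
  obtain h where "h \<noteq> 0" "D x h = 0" using x by auto
  then have "\<not> inj (D x)" using lin by (metis injD linear_0)
  then show "rank (matrix (D x)) < CARD('m)" using lin by (simp add: less_rank_noninjective matrix_vector_mul)
qed simp

text \<open>\<open>J\<close> is a spanning set of columns of least cardinality, so its columns are
  independent. By symmetry every row is a combination of the rows in \<open>J\<close>, which turns
  this into injectivity of the principal block on \<open>J\<close>. The sign of \<open>k\<close>
  makes the columns of (k, 1) kernel vectors of \<open>S\<close>.\<close>

lemma independent_column_set:
  fixes S :: "nat \<Rightarrow> nat \<Rightarrow> real"
  assumes sym: "\<And>i j. S i j = S j i"
  obtains J k where "J \<subseteq> {..<n}"
    "\<forall>y. (\<forall>a\<in>J. (\<Sum>b\<in>J. S a b * y b) = 0) \<longrightarrow> (\<forall>b\<in>J. y b = 0)"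
    "\<And>a i. a < n \<Longrightarrow> i < n \<Longrightarrow> S a i = - (\<Sum>j\<in>J. S a j * k j i)"
proof -
  define sp where "sp J \<longleftrightarrow> J \<subseteq> {..<n} \<and> (\<forall>i<n. \<exists>w. \<forall>a<n. S a i = (\<Sum>j\<in>J. S a j * w j))" for J
  have "sp {..<n}"
    unfolding sp_def
  proof (intro conjI allI impI subset_refl)
    fix i assume "i < n"
    then show "\<exists>w. \<forall>a<n. S a i = (\<Sum>j<n. S a j * w j)"
      by (intro exI[of _ "\<lambda>j. if j = i then 1 else 0"]) (simp add: if_distrib[of "\<lambda>x. _ * x"] cong: if_cong)
  qed
  then obtain J where J: "sp J" and min: "\<And>J'. sp J' \<Longrightarrow> card J \<le> card J'"
    using ex_has_least_nat[of sp _ card] by blast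
  have Jn: "J \<subseteq> {..<n}" and fin: "finite J" using J finite_subset by (auto simp: sp_def)
  have "\<exists>w. \<forall>i<n. \<forall>a<n. S a i = (\<Sum>j\<in>J. S a j * w i j)" using J unfolding sp_def by metis
  then obtain w where w: "\<And>i a. i < n \<Longrightarrow> a < n \<Longrightarrow> S a i = (\<Sum>j\<in>J. S a j * w i j)" by blast
  have indep: "y b = 0" if y: "\<And>a. a < n \<Longrightarrow> (\<Sum>j\<in>J. S a j * y j) = 0" and b: "b \<in> J" for y b
  proof (rule ccontr)
    assume yb: "y b \<noteq> 0"
    have Sb: "S a b = (\<Sum>j\<in>J - {b}. S a j * (- y j / y b))" if "a < n" for a
    proof -
      have "S a b * y b + (\<Sum>j\<in>J - {b}. S a j * y j) = 0" using y[OF that] b fin by (simp add: sum.remove)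
      then have "S a b = - (\<Sum>j\<in>J - {b}. S a j * y j) / y b" using yb by (simp add: field_simps)
      then show ?thesis by (simp add: sum_divide_distrib sum_negf)
    qed
    have "sp (J - {b})"
      unfolding sp_def
    proof (intro conjI allI impI)
      fix i assume i: "i < n"
      show "\<exists>w. \<forall>a<n. S a i = (\<Sum>j\<in>J - {b}. S a j * w j)"
      proof (intro exI allI impI)
        fix a assume a: "a < n"
        have "S a i = S a b * w i b + (\<Sum>j\<in>J - {b}. S a j * w i j)" using w[OF i a] b fin by (simp add: sum.remove)
        also have "\<dots> = (\<Sum>j\<in>J - {b}. S a j * (w i j + w i b * (- y j / y b)))"
          unfolding Sb[OF a] sum_distrib_right sum.distrib[symmetric] by (rule sum.cong) (simp_all add: algebra_simps)
        finally show "S a i = (\<Sum>j\<in>J - {b}. S a j * (w i j + w i b * (- y j / y b)))" .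
      qed
    qed (use Jn in auto)
    from min[OF this] card_Diff1_less[OF fin b] show False by linarith
  qed
  show ?thesis
  proof (rule that[of J "\<lambda>j i. - w i j"])
    show "S a i = - (\<Sum>j\<in>J. S a j * - w i j)" if "a < n" "i < n" for a i
      using w[OF that(2,1)] by (simp add: sum_negf)
    show "\<forall>y. (\<forall>a\<in>J. (\<Sum>b\<in>J. S a b * y b) = 0) \<longrightarrow> (\<forall>b\<in>J. y b = 0)"
    proof (intro allI impI ballI)
      fix y b assume y: "\<forall>a\<in>J. (\<Sum>b\<in>J. S a b * y b) = 0" and b: "b \<in> J"
      show "y b = 0"
    proof (rule indep[OF _ b])
      fix a assume a: "a < n"
      have "(\<Sum>j\<in>J. S a j * y j) = (\<Sum>j\<in>J. \<Sum>l\<in>J. w a l * (S l j * y j))"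
      proof (rule sum.cong[OF refl])
        fix j assume "j \<in> J"
        then have "S a j = (\<Sum>l\<in>J. S j l * w a l)" using w[OF a, of j] Jn sym[of a j] by auto
        then show "S a j * y j = (\<Sum>l\<in>J. w a l * (S l j * y j))"
          by (simp add: sum_distrib_left sym[of j] mult_ac)
      qed
      also have "\<dots> = (\<Sum>l\<in>J. w a l * (\<Sum>j\<in>J. S l j * y j))"
        by (subst sum.swap) (simp add: sum_distrib_left)
      also have "\<dots> = 0" using y by simp
      finally show "(\<Sum>j\<in>J. S a j * y j) = 0" .
    qed
    qed
  qed (rule Jn)
qed

text \<open>Vectors representing the coordinate functionals give the pairing; projecting them
  orthogonally to the span of the \<open>V i\<close> preserves it and secures the second conclusion,
  which \<open>degenerate_in_image\<close> needs to expand the \<open>V b\<close> in the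
  \<open>U a\<close>.\<close>

lemma dual_family:
  fixes V :: "nat \<Rightarrow> 'e::euclidean_space"
  assumes fin: "finite I" and indep0: "\<forall>y. (\<Sum>i\<in>I. y i *\<^sub>R V i) = 0 \<longrightarrow> (\<forall>i\<in>I. y i = 0)"
  obtains U where "\<And>i j. i \<in> I \<Longrightarrow> j \<in> I \<Longrightarrow> U i \<bullet> V j = (if i = j then 1 else 0)"
    "\<And>i. i \<in> I \<Longrightarrow> U i \<in> span (V ` I)"
proof -
  have indep: "y i = 0" if "(\<Sum>i\<in>I. y i *\<^sub>R V i) = 0" "i \<in> I" for y i using indep0 that by blast
  have inj: "inj_on V I"
  proof (rule inj_onI, rule ccontr)
    fix i j assume ij: "i \<in> I" "j \<in> I" "V i = V j" "i \<noteq> j"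
    have "(\<Sum>l\<in>I. (if l = i then 1 else if l = j then -1 else (0::real)) *\<^sub>R V l) = (\<Sum>l\<in>{i,j}. (if l = i then 1 else if l = j then -1 else 0) *\<^sub>R V l)"
      using ij fin by (intro sum.mono_neutral_right) auto
    also have "\<dots> = 0" using ij by simp
    finally have "(if i = i then 1 else if i = j then -1 else (0::real)) = 0" by (rule indep) (rule ij)
    then show False by simp
  qed
  have ind: "independent (V ` I)"
  proof
    assume "dependent (V ` I)"
    then obtain u v where uv: "v \<in> V ` I" "u v \<noteq> 0" "(\<Sum>v\<in>V ` I. u v *\<^sub>R v) = 0"
      using fin by (auto simp: dependent_finite)
    then have "(\<Sum>i\<in>I. u (V i) *\<^sub>R V i) = 0" using inj by (simp add: sum.reindex)
    then have "u (V i) = 0" if "i \<in> I" for i using indep[of "\<lambda>i. u (V i)"] that by blast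
    then show False using uv by auto
  qed
  have "\<exists>x. (\<forall>j\<in>I. x \<bullet> V j = (if i = j then 1 else 0)) \<and> x \<in> span (V ` I)" if i: "i \<in> I" for i
  proof -
    obtain g where g: "linear g" "\<And>x. x \<in> V ` I \<Longrightarrow> g x = (if x = V i then 1 else (0::real))"
      using linear_independent_extend[OF ind, of "\<lambda>x. if x = V i then 1 else (0::real)"] by blast
    define a where "a = adjoint g 1"
    have ga: "a \<bullet> x = g x" for x using adjoint_works[OF g(1), of x 1] by (simp add: a_def inner_commute)
    obtain y z where yz: "y \<in> span (V ` I)" "\<And>w. w \<in> span (V ` I) \<Longrightarrow> orthogonal z w" "a = y + z"
      using orthogonal_subspace_decomp_exists[of "V ` I" a] by blast
    have "y \<bullet> V j = (if i = j then 1 else 0)" if j: "j \<in> I" for j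
    proof -
      have "z \<bullet> V j = 0" using yz(2)[of "V j"] j by (simp add: span_base orthogonal_def)
      then have "y \<bullet> V j = g (V j)" using ga[of "V j"] yz(3) by (simp add: inner_add_left)
      then show ?thesis using g(2)[of "V j"] j i inj by (auto simp: inj_on_def)
    qed
    then show ?thesis using yz(1) by blast
  qed
  then have "\<exists>U. \<forall>i\<in>I. (\<forall>j\<in>I. U i \<bullet> V j = (if i = j then 1 else 0)) \<and> U i \<in> span (V ` I)" by metis
  then show ?thesis using that by blast
qed

text \<open>With the \<open>d i\<close> and \<open>U i\<close> as columns of matrices D and U,
  \<Omega> is D U^T - U D^T - U B U^T, where B has the entries V_i . d_j. The first term maps V_l to
  d_l, the second makes it skew, and the third cancels the error of the second; it is itself skew by
  the hypothesis \<open>skew\<close>.\<close>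

lemma skew_extension:
  fixes V d U :: "nat \<Rightarrow> real^'k"
  assumes fin: "finite I" and dual: "\<And>i j. i \<in> I \<Longrightarrow> j \<in> I \<Longrightarrow> U i \<bullet> V j = (if i = j then 1 else 0)"
    and skew: "\<And>i j. i \<in> I \<Longrightarrow> j \<in> I \<Longrightarrow> d i \<bullet> V j + V i \<bullet> d j = 0"
  obtains \<Omega> where "transpose \<Omega> = - \<Omega>" "\<And>i. i \<in> I \<Longrightarrow> \<Omega> *v V i = d i"
proof -
  define Q where "Q p q = (\<Sum>i\<in>I. \<Sum>j\<in>I. (V i \<bullet> d j) * (U i $ p * U j $ q))" for p q
  define \<Omega> where "\<Omega> = (\<chi> p q. (\<Sum>i\<in>I. d i $ p * U i $ q - U i $ p * d i $ q) - Q p q)"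
  have Q: "Q q p = - Q p q" for p q
  proof -
    have "Q q p = (\<Sum>j\<in>I. \<Sum>i\<in>I. (V i \<bullet> d j) * (U i $ q * U j $ p))" unfolding Q_def by (rule sum.swap)
    also have "\<dots> = (\<Sum>j\<in>I. \<Sum>i\<in>I. - ((V j \<bullet> d i) * (U j $ p * U i $ q)))"
    proof (intro sum.cong refl)
      fix i j assume "j \<in> I" "i \<in> I"
      then have "V i \<bullet> d j = - (V j \<bullet> d i)" using skew[of j i] by (simp add: inner_commute[of "d j"])
      then show "(V i \<bullet> d j) * (U i $ q * U j $ p) = - ((V j \<bullet> d i) * (U j $ p * U i $ q))" by simp
    qed
    finally show ?thesis by (simp add: Q_def sum_negf)
  qed
  show ?thesis
  proof (rule that[of \<Omega>])
    show "transpose \<Omega> = - \<Omega>"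
    proof -
      have sk: "\<Omega> $ q $ p = - \<Omega> $ p $ q" for p q
      proof -
        have "(\<Sum>i\<in>I. d i $ q * U i $ p - U i $ q * d i $ p) = - (\<Sum>i\<in>I. d i $ p * U i $ q - U i $ p * d i $ q)"
          unfolding sum_negf[symmetric] by (rule sum.cong) auto
        then show ?thesis unfolding \<Omega>_def vec_lambda_beta Q[of q p] by linarith
      qed
      show ?thesis
        unfolding vec_eq_iff transpose_def vec_lambda_beta vector_uminus_component using sk by blast
    qed
    fix l assume l: "l \<in> I"
    have "(\<Omega> *v V l) $ p = d l $ p" for p
    proof -
      have "(\<Omega> *v V l) $ p = (\<Sum>i\<in>I. d i $ p * (U i \<bullet> V l) - U i $ p * (d i \<bullet> V l)) - (\<Sum>q\<in>UNIV. Q p q * V l $ q)"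
      proof -
        have in1: "(\<Sum>q\<in>UNIV. (d i $ p * U i $ q - U i $ p * d i $ q) * V l $ q) = d i $ p * (U i \<bullet> V l) - U i $ p * (d i \<bullet> V l)" for i
          unfolding inner_vec_def[of "U i"] inner_vec_def[of "d i"] sum_distrib_left sum_subtractf[symmetric]
          by (rule sum.cong) (auto simp: algebra_simps)
        have "(\<Omega> *v V l) $ p = (\<Sum>q\<in>UNIV. \<Sum>i\<in>I. (d i $ p * U i $ q - U i $ p * d i $ q) * V l $ q) - (\<Sum>q\<in>UNIV. Q p q * V l $ q)"
          unfolding matrix_vector_mult_def vec_lambda_beta sum_subtractf[symmetric] sum_distrib_right[symmetric]
          by (rule sum.cong) (simp_all only: \<Omega>_def vec_lambda_beta left_diff_distrib)
        also have "(\<Sum>q\<in>UNIV. \<Sum>i\<in>I. (d i $ p * U i $ q - U i $ p * d i $ q) * V l $ q) = (\<Sum>i\<in>I. d i $ p * (U i \<bullet> V l) - U i $ p * (d i \<bullet> V l))"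
          by (subst sum.swap) (simp only: in1)
        finally show ?thesis .
      qed
      also have "(\<Sum>q\<in>UNIV. Q p q * V l $ q) = (\<Sum>i\<in>I. \<Sum>j\<in>I. (V i \<bullet> d j) * (U i $ p * (U j \<bullet> V l)))"
        unfolding Q_def inner_vec_def[of "U _"] sum_distrib_right sum_distrib_left
        by (subst sum.swap, intro sum.cong refl, subst sum.swap, intro sum.cong refl) (simp add: mult_ac)
      also have "\<dots> = (\<Sum>i\<in>I. (V i \<bullet> d l) * U i $ p)"
        using l fin by (simp add: dual if_distrib[of "\<lambda>x. _ * x"] cong: if_cong)
      also have "(\<Sum>i\<in>I. d i $ p * (U i \<bullet> V l) - U i $ p * (d i \<bullet> V l)) = d l $ p - (\<Sum>i\<in>I. U i $ p * (d i \<bullet> V l))"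
        using l fin by (simp add: dual sum_subtractf if_distrib[of "\<lambda>x. _ * x"] cong: if_cong)
      also have "d l $ p - (\<Sum>i\<in>I. U i $ p * (d i \<bullet> V l)) - (\<Sum>i\<in>I. (V i \<bullet> d l) * U i $ p) = d l $ p - (\<Sum>i\<in>I. U i $ p * (d i \<bullet> V l + V i \<bullet> d l))"
        by (simp add: sum.distrib algebra_simps)
      also have "\<dots> = d l $ p" using skew l by simp
      finally show ?thesis .
    qed
    then show "\<Omega> *v V l = d l" by (simp add: vec_eq_iff)
  qed
qed

lemma inner_double_sum:
  "(\<Sum>a\<in>A. f a *\<^sub>R X a) \<bullet> (\<Sum>b\<in>B. g b *\<^sub>R Y b) = (\<Sum>a\<in>A. \<Sum>b\<in>B. f a * (X a \<bullet> Y b) * g b)"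
  by (subst inner_sum_left, rule sum.cong[OF refl], subst inner_sum_right, rule sum.cong[OF refl]) simp

section \<open>Parametrising the cost matrices with a degenerate critical point\<close>

locale sym_coords =
  fixes n :: nat and e :: "nat \<times> nat \<Rightarrow> 'm::{finite,wellorder}"
  assumes inj_e: "inj_on e {(i, j). i \<le> j \<and> j < n}"
begin

abbreviation P :: "(nat \<times> nat) set" where "P \<equiv> {(i, j). i \<le> j \<and> j < n}"

definition entry :: "real^'m::_ \<Rightarrow> nat \<Rightarrow> nat \<Rightarrow> real" where "entry x i j = x $ e (min i j, max i j)"

text \<open>Spare coordinates, those outside the image of the triangle, are copied from
  \<open>p\<close>. A map x -> mk (M x) x is then the identity there, so domain and range agree as
  Sard's theorem demands, and spare directions add nothing to the kernel of the derivative.\<close>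

definition mk :: "(nat \<Rightarrow> nat \<Rightarrow> real) \<Rightarrow> real^'m::_ \<Rightarrow> real^'m::_" where
  "mk M p = (\<chi> m. if m \<in> e ` P then case_prod M (the_inv_into P e m) else p $ m)"

lemma mk_e: "i \<le> j \<Longrightarrow> j < n \<Longrightarrow> mk M p $ e (i, j) = M i j"
  using the_inv_into_f_f[OF inj_e, of "(i, j)"] by (simp add: mk_def)

lemma mk_out: "m \<notin> e ` P \<Longrightarrow> mk M p $ m = p $ m" by (simp add: mk_def)

lemma mk_eqI:
  assumes "\<And>i j. i \<le> j \<Longrightarrow> j < n \<Longrightarrow> M i j = z $ e (i, j)" "\<And>m. m \<notin> e ` P \<Longrightarrow> p $ m = z $ m"
  shows "mk M p = z"
proof -
  have "mk M p $ m = z $ m" for m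
    using assms by (cases "m \<in> e ` P") (auto simp: mk_e mk_out)
  then show ?thesis by (simp add: vec_eq_iff)
qed

lemma entry_mk:
  assumes "\<And>i j. M i j = M j i" "i < n" "j < n"
  shows "entry (mk M p) i j = M i j"
  using assms mk_e[of i j M p] mk_e[of j i M p] by (cases "i \<le> j") (auto simp: entry_def min_def max_def)

lemma entry_deriv: "((\<lambda>x. entry x i j) has_derivative (\<lambda>h. entry h i j)) F"
  unfolding entry_def by (rule bounded_linear_imp_has_derivative) (rule bounded_linear_vec_nth)

lemma has_derivative_mk:
  assumes "\<And>i j. i \<le> j \<Longrightarrow> j < n \<Longrightarrow> ((\<lambda>x. M x i j) has_derivative (\<lambda>h. M' h i j)) (at x within S)"
  shows "((\<lambda>x. mk (M x) x) has_derivative (\<lambda>h. mk (M' h) h)) (at x within S)"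
proof (subst has_derivative_componentwise_within, intro ballI)
  fix b :: "real^'m::_" assume "b \<in> Basis"
  then obtain m where b: "b = axis m 1" by (auto simp: Basis_vec_def)
  have "((\<lambda>x. mk (M x) x $ m) has_derivative (\<lambda>h. mk (M' h) h $ m)) (at x within S)"
  proof (cases "m \<in> e ` P")
    case True
    then obtain i j where "m = e (i, j)" "i \<le> j" "j < n" by auto
    then show ?thesis using assms by (simp add: mk_e)
  next
    case False
    then show ?thesis by (simp add: mk_out bounded_linear_imp_has_derivative bounded_linear_vec_nth)
  qed
  then show "((\<lambda>x. mk (M x) x \<bullet> b) has_derivative (\<lambda>h. mk (M' h) h \<bullet> b)) (at x within S)"
    by (simp add: b inner_axis)
qed

definition Ic :: "nat set \<Rightarrow> nat set" where "Ic J = {..<n} - J"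

text \<open>A point \<open>x\<close> encodes the blocks \<open>T\<close> (on \<open>J \<times> J\<close>), \<open>k\<close> (on \<open>J \<times> I\<close>) and \<open>Y\<close> (on \<open>I \<times> I\<close>) of a symmetric matrix.
  Off the diagonal, \<open>F\<close> is the matrix with blocks \<open>T\<close>, \<open>- T k\<close>, \<open>k\<^sup>T T k\<close>, whose kernel is spanned by the columns of \<open>(k, 1)\<close>;
  on the diagonal it is the diagonal of the Gram matrix \<open>(k, 1) Y (k, 1)\<^sup>T\<close>.  \<open>F'\<close> is its derivative.\<close>

definition F :: "nat set \<Rightarrow> real^'m::_ \<Rightarrow> nat \<Rightarrow> nat \<Rightarrow> real" where
  "F J x i j = (if i = j then
       (if i \<in> J then \<Sum>a\<in>Ic J. \<Sum>b\<in>Ic J. entry x i a * entry x a b * entry x i b else entry x i i)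
     else if i \<in> J \<and> j \<in> J then entry x i j
     else if i \<in> J then - (\<Sum>l\<in>J. entry x i l * entry x l j)
     else if j \<in> J then - (\<Sum>l\<in>J. entry x j l * entry x l i)
     else \<Sum>a\<in>J. \<Sum>b\<in>J. entry x a i * entry x a b * entry x b j)"

definition F' :: "nat set \<Rightarrow> real^'m::_ \<Rightarrow> real^'m::_ \<Rightarrow> nat \<Rightarrow> nat \<Rightarrow> real" where
  "F' J x h i j = (if i = j then
       (if i \<in> J then \<Sum>a\<in>Ic J. \<Sum>b\<in>Ic J. entry h i a * entry x a b * entry x i b + entry x i a * entry h a b * entry x i b + entry x i a * entry x a b * entry h i b else entry h i i)
     else if i \<in> J \<and> j \<in> J then entry h i j
     else if i \<in> J then - (\<Sum>l\<in>J. entry h i l * entry x l j + entry x i l * entry h l j)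
     else if j \<in> J then - (\<Sum>l\<in>J. entry h j l * entry x l i + entry x j l * entry h l i)
     else \<Sum>a\<in>J. \<Sum>b\<in>J. entry h a i * entry x a b * entry x b j + entry x a i * entry h a b * entry x b j + entry x a i * entry x a b * entry h b j)"

definition \<Phi> :: "nat set \<Rightarrow> real^'m::_ \<Rightarrow> real^'m::_" where "\<Phi> J x = mk (F J x) x"

definition \<Phi>' :: "nat set \<Rightarrow> real^'m::_ \<Rightarrow> real^'m::_ \<Rightarrow> real^'m::_" where "\<Phi>' J x h = mk (F' J x h) h"

lemma \<Phi>_deriv: "(\<Phi> J has_derivative \<Phi>' J x) (at x)"
proof -
  have F: "((\<lambda>x. F J x i j) has_derivative (\<lambda>h. F' J x h i j)) (at x)" for i j
  proof -
    have p3: "((\<lambda>x. entry x a b * entry x c d * entry x g h) has_derivative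
        (\<lambda>y. entry y a b * entry x c d * entry x g h + entry x a b * entry y c d * entry x g h + entry x a b * entry x c d * entry y g h)) (at x)" for a b c d g h
      by (rule has_derivative_eq_rhs[OF has_derivative_mult[OF has_derivative_mult[OF entry_deriv entry_deriv] entry_deriv]]) (simp add: algebra_simps)
    have p2: "((\<lambda>x. entry x a b * entry x c d) has_derivative (\<lambda>y. entry y a b * entry x c d + entry x a b * entry y c d)) (at x)" for a b c d
      by (rule has_derivative_eq_rhs[OF has_derivative_mult[OF entry_deriv entry_deriv]]) (simp add: algebra_simps)
    consider "i = j" "i \<in> J" | "i = j" "i \<notin> J" | "i \<noteq> j" "i \<in> J" "j \<in> J" | "i \<noteq> j" "i \<in> J" "j \<notin> J"
      | "i \<noteq> j" "i \<notin> J" "j \<in> J" | "i \<noteq> j" "i \<notin> J" "j \<notin> J" by blast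
    then show ?thesis
      by cases (simp_all add: F_def F'_def entry_deriv has_derivative_minus has_derivative_sum p2 p3)
  qed
  show ?thesis unfolding \<Phi>_def[abs_def] \<Phi>'_def[abs_def] by (rule has_derivative_mk[OF F])
qed

definition critical_params :: "nat set \<Rightarrow> (real^'m::_) set" where "critical_params J = {x. \<exists>h. h \<noteq> 0 \<and> \<Phi>' J x h = 0}"

definition psd_block :: "nat set \<Rightarrow> (real^'m::_) set" where
  "psd_block I = {x. \<forall>y::nat\<Rightarrow>real. 0 \<le> (\<Sum>a\<in>I. \<Sum>b\<in>I. y a * entry x a b * y b)}"

definition singular_psd_block :: "nat set \<Rightarrow> (real^'m::_) set" where
  "singular_psd_block I = {x \<in> psd_block I. \<exists>y::nat\<Rightarrow>real. (\<exists>a\<in>I. y a \<noteq> 0) \<and> (\<Sum>a\<in>I. \<Sum>b\<in>I. y a * entry x a b * y b) = 0}"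

text \<open>Subtracting a small multiple of the identity makes the form negative at
  \<open>y\<close>, so a singular point lies on the boundary of the convex cone, and boundaries of
  convex sets are null.\<close>

lemma negligible_singular_psd_block:
  assumes I: "I \<subseteq> {..<n}"
  shows "negligible (singular_psd_block I)"
proof -
  have fin: "finite I" using I finite_subset by blast
  have entry_lin: "entry (u *\<^sub>R x + v *\<^sub>R y) a b = u * entry x a b + v * entry y a b" for u v x y a b by (simp add: entry_def)
  have lin: "(\<Sum>a\<in>I. \<Sum>b\<in>I. w a * entry (u *\<^sub>R x + v *\<^sub>R z) a b * w b) =
      u * (\<Sum>a\<in>I. \<Sum>b\<in>I. w a * entry x a b * w b) + v * (\<Sum>a\<in>I. \<Sum>b\<in>I. w a * entry z a b * w b)" for u v x z and w :: "nat \<Rightarrow> real"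
    by (simp add: entry_lin sum_distrib_left sum.distrib[symmetric] algebra_simps)
  have "convex (psd_block I)"
    unfolding convex_def psd_block_def by (auto simp: lin)
  moreover have "singular_psd_block I \<subseteq> frontier (psd_block I)"
  proof
    fix x assume x: "x \<in> singular_psd_block I"
    then obtain y where y: "\<exists>a\<in>I. y a \<noteq> 0" "(\<Sum>a\<in>I. \<Sum>b\<in>I. y a * entry x a b * y b) = 0" and xp: "x \<in> psd_block I"
      by (auto simp: singular_psd_block_def)
    define E where "E = mk (\<lambda>a b. if a = b then 1 else 0) 0"
    have cdE: "entry E a b = (if a = b then 1 else 0)" if "a \<in> I" "b \<in> I" for a b
      unfolding E_def using that I by (subst entry_mk) auto
    have yE: "(\<Sum>a\<in>I. \<Sum>b\<in>I. y a * entry E a b * y b) = (\<Sum>a\<in>I. (y a)\<^sup>2)"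
    proof (rule sum.cong[OF refl])
      fix a assume a: "a \<in> I"
      have "(\<Sum>b\<in>I. y a * entry E a b * y b) = (\<Sum>b\<in>I. if a = b then y a * y b else 0)"
        using a by (intro sum.cong) (auto simp: cdE)
      then show "(\<Sum>b\<in>I. y a * entry E a b * y b) = (y a)\<^sup>2" using a fin by (simp add: power2_eq_square)
    qed
    obtain a where a: "a \<in> I" "y a \<noteq> 0" using y(1) by blast
    have "0 < (y a)\<^sup>2" using a by simp
    also have "\<dots> \<le> (\<Sum>a\<in>I. (y a)\<^sup>2)" using a fin by (intro member_le_sum) auto
    finally have pos: "(\<Sum>a\<in>I. (y a)\<^sup>2) > 0" .
    have "x \<notin> interior (psd_block I)"
    proof
      assume "x \<in> interior (psd_block I)"
      then obtain r where r: "r > 0" "ball x r \<subseteq> psd_block I" by (meson mem_interior)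
      define t where "t = r / (2 * (norm E + 1))"
      have t: "t > 0" using r norm_ge_zero[of E] by (simp add: t_def add_nonneg_pos)
      have "t * norm E < r"
      proof -
        have "t * norm E \<le> t * (norm E + 1)" using t by simp
        also have "\<dots> = r / 2" using norm_ge_zero[of E] by (simp add: t_def field_simps add_nonneg_eq_0_iff)
        finally show ?thesis using r by simp
      qed
      then have "1 *\<^sub>R x + (-t) *\<^sub>R E \<in> ball x r" using t by (simp add: dist_norm)
      then have "1 *\<^sub>R x + (-t) *\<^sub>R E \<in> psd_block I" using r by blast
      then have "0 \<le> (\<Sum>a\<in>I. \<Sum>b\<in>I. y a * entry (1 *\<^sub>R x + (-t) *\<^sub>R E) a b * y b)" unfolding psd_block_def by blast
      then show False unfolding lin y(2) yE using mult_pos_pos[OF t pos] by simp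
    qed
    then show "x \<in> frontier (psd_block I)" using xp closure_subset by (auto simp: frontier_def)
  qed
  ultimately show ?thesis using negligible_convex_frontier negligible_subset by blast
qed

lemma negligible_\<Phi>_image:
  "negligible (\<Phi> J ` (singular_psd_block (Ic J) \<union> critical_params J))"
proof -
  have "negligible (\<Phi> J ` singular_psd_block (Ic J))"
  proof (rule negligible_differentiable_image_negligible)
    show "negligible (singular_psd_block (Ic J))" by (rule negligible_singular_psd_block) (auto simp: Ic_def)
    show "\<Phi> J differentiable_on singular_psd_block (Ic J)"
      unfolding differentiable_on_def differentiable_def
      using has_derivative_at_withinI[OF \<Phi>_deriv] by blast
  qed simp
  moreover have "negligible (\<Phi> J ` critical_params J)"
    unfolding critical_params_def by (rule negligible_critical_values) (rule \<Phi>_deriv)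
  ultimately show ?thesis by (simp add: image_Un)
qed

end

text \<open>Off the diagonal \<open>C\<close> equals S = C - diag(lam), which its block on
  \<open>J\<close> and the kernel data \<open>k\<close> determine; this gives
  \<open>\<Phi> J x = z\<close>. The vector \<open>h\<close> is the variation of these data along V
  + t d with multipliers lam + t \<gamma>: by \<open>Cd\<close> and \<open>dV\<close> neither
  \<open>C\<close> nor the column norms change to first order. If \<open>h\<close> vanished,
  \<open>d\<close> would be an infinitesimal rotation, contrary to \<open>nosk\<close>.\<close>

lemma (in sym_coords) degenerate_in_image:
  fixes C :: "nat \<Rightarrow> nat \<Rightarrow> real" and V d :: "nat \<Rightarrow> real^'k" and lam \<gamma> :: "nat \<Rightarrow> real" and z :: "real^'m::_"
  assumes sym: "\<And>i j. C i j = C j i" and diag: "\<And>i. C i i = 0"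
    and CV: "\<And>i. i < n \<Longrightarrow> (\<Sum>j<n. C i j *\<^sub>R V j) = lam i *\<^sub>R V i"
    and dV: "\<And>i. i < n \<Longrightarrow> d i \<bullet> V i = 0"
    and Cd: "\<And>i. i < n \<Longrightarrow> (\<Sum>j<n. C i j *\<^sub>R d j) - lam i *\<^sub>R d i = \<gamma> i *\<^sub>R V i"
    and nosk: "\<And>\<Omega>. transpose \<Omega> = - \<Omega> \<Longrightarrow> \<exists>i<n. d i \<noteq> \<Omega> *v V i"
    and z: "\<And>i j. i < j \<Longrightarrow> j < n \<Longrightarrow> z $ e (i, j) = C i j" "\<And>i. i < n \<Longrightarrow> z $ e (i, i) = V i \<bullet> V i"
  shows "\<exists>J\<subseteq>{..<n}. z \<in> \<Phi> J ` (singular_psd_block (Ic J) \<union> critical_params J)"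
proof -
  define S where "S i j = C i j - (if i = j then lam i else 0)" for i j
  have symS: "S i j = S j i" for i j using sym[of i j] by (simp add: S_def)
  have S_sum: "(\<Sum>j<n. S i j *\<^sub>R x j) = (\<Sum>j<n. C i j *\<^sub>R x j) - lam i *\<^sub>R x i" if "i < n" for i and x :: "nat \<Rightarrow> real^'k"
    using that by (simp add: S_def scaleR_diff_left sum_subtractf if_distrib[of "\<lambda>r. r *\<^sub>R _"] cong: if_cong)
  have SV: "(\<Sum>j<n. S i j *\<^sub>R V j) = 0" if "i < n" for i using S_sum[OF that] CV[OF that] by simp
  have Sd: "(\<Sum>j<n. S i j *\<^sub>R d j) = \<gamma> i *\<^sub>R V i" if "i < n" for i using S_sum[OF that] Cd[OF that] by simp
  obtain J k where J: "J \<subseteq> {..<n}"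
    and Jinj0: "\<forall>y. (\<forall>a\<in>J. (\<Sum>b\<in>J. S a b * y b) = 0) \<longrightarrow> (\<forall>b\<in>J. y b = 0)"
    and Jk: "\<And>a i. a < n \<Longrightarrow> i < n \<Longrightarrow> S a i = - (\<Sum>j\<in>J. S a j * k j i)"
    by (rule independent_column_set[of S n, OF symS]) (rule that)
  have Jinj: "y b = 0" if "\<And>a. a \<in> J \<Longrightarrow> (\<Sum>b\<in>J. S a b * y b) = 0" "b \<in> J" for y b using Jinj0 that by blast
  define I where "I = Ic J"
  have fin: "finite I" "finite J" using J finite_subset by (auto simp: I_def Ic_def)
  have split: "{..<n} = J \<union> I" "J \<inter> I = {}" using J by (auto simp: I_def Ic_def)
  have sumsplit: "(\<Sum>j<n. g j) = (\<Sum>j\<in>J. g j) + (\<Sum>i\<in>I. g i)" for g :: "nat \<Rightarrow> 'a::comm_monoid_add"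
    unfolding split(1) by (rule sum.union_disjoint[OF fin(2,1) split(2)])
  have Jn: "j < n" "j \<notin> I" if "j \<in> J" for j using J that split by auto
  have In: "i < n" "i \<notin> J" if "i \<in> I" for i using that by (auto simp: I_def Ic_def)
  have kerr: "x j = (\<Sum>i\<in>I. k j i * x i)" if x: "\<And>a. a < n \<Longrightarrow> (\<Sum>b<n. S a b * x b) = 0" and j: "j \<in> J" for x :: "nat \<Rightarrow> real" and j
  proof -
    have "x j - (\<Sum>i\<in>I. k j i * x i) = 0"
    proof (rule Jinj[OF _ j])
      fix a assume a: "a \<in> J"
      have "(\<Sum>b\<in>J. S a b * (x b - (\<Sum>i\<in>I. k b i * x i))) = (\<Sum>b\<in>J. S a b * x b) - (\<Sum>b\<in>J. \<Sum>i\<in>I. S a b * k b i * x i)"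
        by (simp add: right_diff_distrib sum_subtractf sum_distrib_left mult.assoc)
      also have "(\<Sum>b\<in>J. \<Sum>i\<in>I. S a b * k b i * x i) = (\<Sum>i\<in>I. (\<Sum>b\<in>J. S a b * k b i) * x i)"
        by (subst sum.swap) (simp add: sum_distrib_right)
      also have "\<dots> = (\<Sum>i\<in>I. - (S a i * x i))"
        using Jk[of a] Jn(1)[OF a] In(1) by (intro sum.cong refl) (metis minus_minus mult_minus_left)
      finally show "(\<Sum>b\<in>J. S a b * (x b - (\<Sum>i\<in>I. k b i * x i))) = 0"
        using x[OF Jn(1)[OF a]] by (simp add: sumsplit sum_negf)
    qed
    then show ?thesis by simp
  qed
  have ker: "x j = (\<Sum>i\<in>I. k j i *\<^sub>R x i)" if x: "\<And>a. a < n \<Longrightarrow> (\<Sum>b<n. S a b *\<^sub>R x b) = 0" and j: "j \<in> J" for x :: "nat \<Rightarrow> real^'k" and j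
  proof -
    have "x j $ p = (\<Sum>i\<in>I. k j i *\<^sub>R x i) $ p" for p
      using kerr[of "\<lambda>i. x i $ p" j] x j by (simp add: vec_eq_iff)
    then show ?thesis by (simp add: vec_eq_iff)
  qed
  have Vk: "V j = (\<Sum>i\<in>I. k j i *\<^sub>R V i)" if "j \<in> J" for j by (rule ker[OF SV that])
  \<comment> \<open>Rows of the kernel basis (k, 1), expressing every column \<open>V a\<close>
    through those in \<open>I\<close>.\<close>
  define K where "K a i = (if a \<in> I then (if a = i then 1 else 0) else k a i)" for a i
  have VK: "V a = (\<Sum>i\<in>I. K a i *\<^sub>R V i)" if "a < n" for a
  proof (cases "a \<in> I")
    case True
    then show ?thesis using fin by (simp add: K_def if_distrib[of "\<lambda>r. r *\<^sub>R _"] cong: if_cong)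
  next
    case False
    then have "a \<in> J" using that split by auto
    then show ?thesis using Vk False by (simp add: K_def)
  qed
  have SK: "(\<Sum>b<n. S a b * K b i) = 0" if "a < n" "i \<in> I" for a i
  proof -
    have "(\<Sum>b\<in>J. S a b * K b i) = (\<Sum>b\<in>J. S a b * k b i)" using Jn by (intro sum.cong) (auto simp: K_def)
    moreover have "(\<Sum>b\<in>I. S a b * K b i) = S a i"
      using that fin by (simp add: K_def if_distrib[of "\<lambda>r. _ * r"] cong: if_cong)
    ultimately show ?thesis using Jk[of a i] that In(1) by (simp add: sumsplit)
  qed
  define Mt where "Mt a b = (if a \<in> J \<and> b \<in> J then S a b else if a \<in> J then k a b else if b \<in> J then k b a else V a \<bullet> V b)" for a b
  have symM: "Mt a b = Mt b a" for a b using symS[of a b] by (simp add: Mt_def inner_commute)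
  define x where "x = mk Mt z"
  have cx: "entry x a b = Mt a b" if "a < n" "b < n" for a b unfolding x_def by (rule entry_mk[OF symM that])
  have cJJ: "entry x a b = S a b" if "a \<in> J" "b \<in> J" for a b using that Jn by (simp add: cx Mt_def)
  have cJI: "entry x a b = k a b" if "a \<in> J" "b \<in> I" for a b using that Jn In by (simp add: cx Mt_def)
  have cII: "entry x a b = V a \<bullet> V b" if "a \<in> I" "b \<in> I" for a b using that In by (simp add: cx Mt_def)
  have SkI: "(\<Sum>l\<in>J. S a l * k l i) = - S a i" if "a < n" "i \<in> I" for a i using Jk[of a i] that In by simp
  have "F J x i j = z $ e (i, j)" if ij: "i \<le> j" "j < n" for i j
  proof -
    have mem: "i \<in> J \<or> i \<in> I" "j \<in> J \<or> j \<in> I" using ij split by auto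
    consider "i = j" "i \<in> J" | "i = j" "i \<in> I" | "i < j" "i \<in> J" "j \<in> J" | "i < j" "i \<in> J" "j \<in> I"
      | "i < j" "i \<in> I" "j \<in> J" | "i < j" "i \<in> I" "j \<in> I" using mem ij by fastforce
    then show ?thesis
    proof cases
      case 1
      have "F J x i j = (\<Sum>a\<in>I. \<Sum>b\<in>I. k i a * (V a \<bullet> V b) * k i b)"
        using 1 by (simp add: F_def I_def[symmetric] cJI cII)
      also have "\<dots> = (\<Sum>a\<in>I. k i a *\<^sub>R V a) \<bullet> (\<Sum>b\<in>I. k i b *\<^sub>R V b)"
        by (rule inner_double_sum[symmetric])
      also have "\<dots> = V i \<bullet> V i" using Vk[OF 1(2)] by simp
      finally show ?thesis using z(2)[of i] 1 ij by simp
    next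
      case 2
      then show ?thesis using z(2)[of i] ij In by (simp add: F_def cII)
    next
      case 3
      then show ?thesis using z(1)[of i j] ij by (simp add: F_def cJJ S_def)
    next
      case 4
      then have "F J x i j = - (\<Sum>l\<in>J. S i l * k l j)" using In by (simp add: F_def cJJ cJI)
      then show ?thesis using 4 SkI[of i j] z(1)[of i j] ij Jn by (simp add: S_def)
    next
      case 5
      then have "F J x i j = - (\<Sum>l\<in>J. S j l * k l i)" using In by (simp add: F_def cJJ cJI)
      then show ?thesis using 5 SkI[of j i] z(1)[of i j] ij Jn sym[of i j] by (simp add: S_def)
    next
      case 6
      then have "F J x i j = (\<Sum>a\<in>J. \<Sum>b\<in>J. k a i * S a b * k b j)"
        using In by (simp add: F_def cJJ cJI)
      also have "\<dots> = (\<Sum>a\<in>J. k a i * (- S a j))"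
        using SkI[of _ j] Jn 6 by (intro sum.cong refl) (simp add: sum_distrib_left[symmetric] mult.assoc)
      also have "\<dots> = - (\<Sum>a\<in>J. S j a * k a i)" by (simp add: sum_negf symS[of j] mult.commute)
      also have "\<dots> = C i j" using SkI[of j i] 6 ij sym[of i j] by (simp add: S_def)
      finally show ?thesis using z(1)[of i j] 6 ij by simp
    qed
  qed
  then have \<Phi>x: "\<Phi> J x = z"
    unfolding \<Phi>_def by (intro mk_eqI) (auto simp: x_def mk_out)
  have psd: "(\<Sum>a\<in>I. \<Sum>b\<in>I. y a * entry x a b * y b) = (\<Sum>a\<in>I. y a *\<^sub>R V a) \<bullet> (\<Sum>a\<in>I. y a *\<^sub>R V a)" for y :: "nat \<Rightarrow> real"
    unfolding inner_double_sum by (intro sum.cong refl) (simp add: cII)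
  have xPS: "x \<in> psd_block I" unfolding psd_block_def by (simp add: psd)
  \<comment> \<open>Dependent columns in \<open>I\<close> make their Gram matrix singular, the
    boundary case of the cone; otherwise they have a dual family and the derivative of
    \<open>\<Phi> J\<close> is shown to be singular.\<close>
  show ?thesis
  proof (cases "\<exists>y. (\<exists>a\<in>I. y a \<noteq> 0) \<and> (\<Sum>a\<in>I. y a *\<^sub>R V a) = 0")
    case True
    then have "x \<in> singular_psd_block I" using xPS unfolding singular_psd_block_def by (auto simp: psd)
    then show ?thesis using \<Phi>x J unfolding I_def by blast
  next
    case False
    then have "\<forall>y. (\<Sum>i\<in>I. y i *\<^sub>R V i) = 0 \<longrightarrow> (\<forall>i\<in>I. y i = 0)" by blast
    then obtain U where U: "\<And>i j. i \<in> I \<Longrightarrow> j \<in> I \<Longrightarrow> U i \<bullet> V j = (if i = j then 1 else 0)"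
      and Usp: "\<And>i. i \<in> I \<Longrightarrow> U i \<in> span (V ` I)"
      by (rule dual_family[OF fin(1)]) (rule that)
    \<comment> \<open>The sum is the orthogonal projection of \<open>w\<close> to the span. It
      suffices to expand \<open>V b\<close> in the \<open>U a\<close> with coefficients V_a . V_b;
      the remainder \<open>r\<close> lies in the span and is orthogonal to it.\<close>
    have proj: "(\<Sum>a\<in>I. (w \<bullet> U a) *\<^sub>R V a) \<bullet> V b = w \<bullet> V b" if b: "b \<in> I" for w b
    proof -
      define r where "r = V b - (\<Sum>a\<in>I. (V a \<bullet> V b) *\<^sub>R U a)"
      have rsp: "r \<in> span (V ` I)" unfolding r_def
        by (intro span_diff span_sum span_scale Usp) (auto intro: span_base b)
      have rV: "r \<bullet> V j = 0" if j: "j \<in> I" for j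
      proof -
        have "(\<Sum>a\<in>I. (V a \<bullet> V b) *\<^sub>R U a) \<bullet> V j = (\<Sum>a\<in>I. if a = j then V a \<bullet> V b else 0)"
          unfolding inner_sum_left using j by (intro sum.cong refl) (simp add: U)
        also have "\<dots> = V j \<bullet> V b" using j fin by simp
        finally show ?thesis unfolding r_def inner_diff_left by (simp add: inner_commute[of "V b" "V j"])
      qed
      have "r \<bullet> y = 0" if "y \<in> span (V ` I)" for y
        using that by (induction rule: span_induct_alt) (auto simp: inner_add_right rV)
      from this[OF rsp] have "r = 0" by simp
      then have "V b = (\<Sum>a\<in>I. (V a \<bullet> V b) *\<^sub>R U a)" by (simp add: r_def)
      then have "w \<bullet> V b = w \<bullet> (\<Sum>a\<in>I. (V a \<bullet> V b) *\<^sub>R U a)" by simp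
      also have "\<dots> = (\<Sum>a\<in>I. (w \<bullet> U a) *\<^sub>R V a) \<bullet> V b"
        unfolding inner_sum_left inner_sum_right by (intro sum.cong refl) (simp add: mult.commute)
      finally show ?thesis by simp
    qed
    define E where "E a i = d a \<bullet> U i" for a i
    \<comment> \<open>Obtained by differentiating V_j = sum of k_ji V_i along \<open>d\<close> and
      pairing with the dual family.\<close>
    define k' where "k' j i = E j i - (\<Sum>i'\<in>I. k j i' * E i' i)" for j i
    have Sk': "(\<Sum>l\<in>J. S a l * k' l i) = \<gamma> a * K a i" if a: "a < n" and i: "i \<in> I" for a i
    proof -
      have "(\<Sum>b<n. S a b * E b i) = (\<Sum>b<n. S a b *\<^sub>R d b) \<bullet> U i" by (simp add: E_def inner_sum_left)
      also have "\<dots> = \<gamma> a * (V a \<bullet> U i)" using Sd[OF a] by simp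
      also have "V a \<bullet> U i = (\<Sum>i'\<in>I. if i' = i then K a i' else 0)"
        unfolding VK[OF a] inner_sum_left using i by (intro sum.cong refl) (simp add: U inner_commute[of "V _"])
      also have "\<dots> = K a i" using i fin by simp
      finally have 1: "(\<Sum>b<n. S a b * E b i) = \<gamma> a * K a i" .
      have 2: "(\<Sum>b<n. S a b * (\<Sum>i'\<in>I. K b i' * E i' i)) = 0"
      proof -
        have "(\<Sum>b<n. S a b * (\<Sum>i'\<in>I. K b i' * E i' i)) = (\<Sum>b<n. \<Sum>i'\<in>I. S a b * K b i' * E i' i)"
          by (simp add: sum_distrib_left mult.assoc)
        also have "\<dots> = (\<Sum>i'\<in>I. (\<Sum>b<n. S a b * K b i') * E i' i)"
          by (subst sum.swap) (simp add: sum_distrib_right)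
        finally show ?thesis using SK[OF a] by simp
      qed
      have "(\<Sum>b<n. S a b * (E b i - (\<Sum>i'\<in>I. K b i' * E i' i))) = \<gamma> a * K a i"
        using 1 2 by (simp add: right_diff_distrib sum_subtractf)
      moreover have "(\<Sum>b\<in>I. S a b * (E b i - (\<Sum>i'\<in>I. K b i' * E i' i))) = 0"
        using fin by (intro sum.neutral ballI) (simp add: K_def if_distrib[of "\<lambda>r. r * _"] cong: if_cong)
      moreover have "(\<Sum>b\<in>J. S a b * (E b i - (\<Sum>i'\<in>I. K b i' * E i' i))) = (\<Sum>b\<in>J. S a b * k' b i)"
        using Jn by (intro sum.cong refl) (simp add: K_def k'_def)
      ultimately show ?thesis by (simp add: sumsplit)
    qed
    \<comment> \<open>Blockwise variation of \<open>Mt\<close>: on \<open>J\<close> the block of S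
      changes only through the multipliers, hence by -\<gamma> on its diagonal, and the Gram block
      follows the product rule.\<close>
    define Ht where "Ht a b = (if a \<in> J \<and> b \<in> J then (if a = b then - \<gamma> a else 0) else if a \<in> J then k' a b else if b \<in> J then k' b a
        else d a \<bullet> V b + V a \<bullet> d b)" for a b
    have symH: "Ht a b = Ht b a" for a b by (simp add: Ht_def inner_commute)
    define h where "h = mk Ht 0"
    have ch: "entry h a b = Ht a b" if "a < n" "b < n" for a b unfolding h_def by (rule entry_mk[OF symH that])
    have hJJ: "entry h a b = (if a = b then - \<gamma> a else 0)" if "a \<in> J" "b \<in> J" for a b using that Jn by (simp add: ch Ht_def)
    have hJI: "entry h a b = k' a b" if "a \<in> J" "b \<in> I" for a b using that Jn In by (simp add: ch Ht_def)
    have hII: "entry h a b = d a \<bullet> V b + V a \<bullet> d b" if "a \<in> I" "b \<in> I" for a b using that In by (simp add: ch Ht_def)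
    have KJ: "K a i = k a i" if "a \<in> J" for a i using Jn[OF that] by (simp add: K_def)
    \<comment> \<open>With T the block of S on \<open>J\<close>, the variation of T k is T' k + T k'
      = -\<gamma> k + \<gamma> k = 0.\<close>
    have off: "(\<Sum>l\<in>J. entry h i l * entry x l j + entry x i l * entry h l j) = 0" if i: "i \<in> J" and j: "j \<in> I" for i j
    proof -
      have "(\<Sum>l\<in>J. entry h i l * entry x l j) = (\<Sum>l\<in>J. if i = l then - \<gamma> i * k l j else 0)"
        using i j by (intro sum.cong refl) (simp add: hJJ cJI)
      also have "\<dots> = - \<gamma> i * k i j" using i fin by simp
      finally have "(\<Sum>l\<in>J. entry h i l * entry x l j) = - \<gamma> i * k i j" .
      moreover have "(\<Sum>l\<in>J. entry x i l * entry h l j) = \<gamma> i * k i j"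
        using Sk'[of i j] Jn[OF i] i j by (simp add: cJJ hJI KJ)
      ultimately show ?thesis by (simp add: sum.distrib)
    qed
    have "F' J x h i j = 0" if ij: "i \<le> j" "j < n" for i j
    proof -
      have mem: "i \<in> J \<or> i \<in> I" "j \<in> J \<or> j \<in> I" using ij split by auto
      consider "i = j" "i \<in> J" | "i = j" "i \<in> I" | "i < j" "i \<in> J" "j \<in> J" | "i < j" "i \<in> J" "j \<in> I"
        | "i < j" "i \<in> I" "j \<in> J" | "i < j" "i \<in> I" "j \<in> I" using mem ij by fastforce
      then show ?thesis
      proof cases
        case 1
        define q where "q = (\<Sum>a\<in>I. k' i a *\<^sub>R V a) \<bullet> V i"
        define p where "p = (\<Sum>a\<in>I. k i a *\<^sub>R d a) \<bullet> V i"
        have Vi: "V i = (\<Sum>b\<in>I. k i b *\<^sub>R V b)" by (rule Vk[OF 1(2)])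
        have t1: "(\<Sum>a\<in>I. \<Sum>b\<in>I. k' i a * (V a \<bullet> V b) * k i b) = q"
          unfolding q_def inner_double_sum[symmetric] Vi[symmetric] ..
        have t3: "(\<Sum>a\<in>I. \<Sum>b\<in>I. k i a * (V a \<bullet> V b) * k' i b) = q"
          unfolding q_def inner_double_sum[symmetric] Vi[symmetric] by (rule inner_commute)
        have t2: "(\<Sum>a\<in>I. \<Sum>b\<in>I. k i a * (d a \<bullet> V b) * k i b) = p"
          unfolding p_def inner_double_sum[symmetric] Vi[symmetric] ..
        have t2': "(\<Sum>a\<in>I. \<Sum>b\<in>I. k i a * (V a \<bullet> d b) * k i b) = p"
          unfolding p_def inner_double_sum[symmetric] Vi[symmetric] by (rule inner_commute)
        have "F' J x h i j = (\<Sum>a\<in>I. \<Sum>b\<in>I. k' i a * (V a \<bullet> V b) * k i b + (k i a * (d a \<bullet> V b) * k i b + k i a * (V a \<bullet> d b) * k i b) + k i a * (V a \<bullet> V b) * k' i b)"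
          using 1 by (simp add: F'_def I_def[symmetric] cJI cII hJI hII algebra_simps)
        also have "\<dots> = 2 * q + 2 * p" by (simp add: sum.distrib t1 t2 t2' t3)
        \<comment> \<open>The squared norm of V_i varies by 2 (q + p), and q + p is
          \<open>d i \<bullet> V i\<close>, which vanishes by \<open>dV\<close>.\<close>
        also have "q = - p"
        proof -
          have pr: "(\<Sum>a\<in>I. (w \<bullet> U a) *\<^sub>R V a) \<bullet> V i = w \<bullet> V i" for w
            unfolding Vi inner_sum_right by (intro sum.cong refl) (simp add: proj)
          have "(\<Sum>a\<in>I. k' i a *\<^sub>R V a) = (\<Sum>a\<in>I. (d i \<bullet> U a) *\<^sub>R V a) - (\<Sum>a\<in>I. ((\<Sum>i'\<in>I. k i i' *\<^sub>R d i') \<bullet> U a) *\<^sub>R V a)"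
            by (simp add: k'_def E_def scaleR_diff_left sum_subtractf inner_sum_left)
          then have "q = d i \<bullet> V i - p" unfolding q_def p_def by (simp add: inner_diff_left pr)
          then show ?thesis using dV[of i] Jn 1 by simp
        qed
        finally show ?thesis by simp
      next
        case 2
        then have "V i \<bullet> d i = 0" using dV[of i] In by (simp add: inner_commute)
        then show ?thesis using dV[of i] In 2 by (simp add: F'_def hII)
      next
        case 3
        then show ?thesis by (simp add: F'_def hJJ)
      next
        case 4
        then show ?thesis using off[of i j] In by (simp add: F'_def)
      next
        case 5
        then show ?thesis using off[of j i] In by (simp add: F'_def)
      next
        case 6
        have a1: "(\<Sum>a\<in>J. \<Sum>b\<in>J. entry h a i * entry x a b * entry x b j) = 0"
        proof -
          have "(\<Sum>a\<in>J. \<Sum>b\<in>J. entry h a i * entry x a b * entry x b j) = (\<Sum>a\<in>J. k' a i * (\<Sum>b\<in>J. S a b * k b j))"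
            using 6 by (simp add: hJI cJJ cJI sum_distrib_left mult.assoc)
          also have "\<dots> = - (\<Sum>a\<in>J. S j a * k' a i)"
            using SkI[of _ j] Jn 6 by (simp add: sum_negf symS[of j] mult.commute)
          \<comment> \<open>\<open>i\<close> and \<open>j\<close> are different elements of
            \<open>I\<close>, so \<open>K j i = 0\<close>; \<gamma> would show up only on the
            diagonal, which \<open>F\<close> reserves for the column norms.\<close>
          also have "\<dots> = 0" using Sk'[of j i] 6 ij by (simp add: K_def)
          finally show ?thesis .
        qed
        have a2: "(\<Sum>a\<in>J. \<Sum>b\<in>J. entry x a i * entry h a b * entry x b j + entry x a i * entry x a b * entry h b j) = 0"
        proof (rule sum.neutral, rule ballI)
          fix a assume a: "a \<in> J"
          have "(\<Sum>b\<in>J. entry x a i * entry h a b * entry x b j + entry x a i * entry x a b * entry h b j) = entry x a i * (\<Sum>b\<in>J. entry h a b * entry x b j + entry x a b * entry h b j)"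
            by (simp add: sum_distrib_left algebra_simps)
          then show "(\<Sum>b\<in>J. entry x a i * entry h a b * entry x b j + entry x a i * entry x a b * entry h b j) = 0" using off[OF a, of j] 6 by simp
        qed
        have "F' J x h i j = (\<Sum>a\<in>J. \<Sum>b\<in>J. entry h a i * entry x a b * entry x b j) + (\<Sum>a\<in>J. \<Sum>b\<in>J. entry x a i * entry h a b * entry x b j + entry x a i * entry x a b * entry h b j)"
          using 6 In by (simp add: F'_def sum.distrib add.assoc)
        then show ?thesis using a1 a2 by simp
      qed
    qed
    then have \<Phi>h: "\<Phi>' J x h = 0" unfolding \<Phi>'_def by (intro mk_eqI) (auto simp: h_def mk_out)
    have "h \<noteq> 0"
    proof
      assume "h = 0"
      then have h0: "entry h a b = 0" for a b by (simp add: entry_def)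
      have k0: "k' a i = 0" if "a \<in> J" "i \<in> I" for a i using hJI[OF that] h0 by simp
      \<comment> \<open>On \<open>J\<close> read off the diagonal of the first block; on
        \<open>I\<close> a consequence of \<open>Sk'\<close>, because \<open>K a a = 1\<close>
        there.\<close>
      have \<gamma>0: "\<gamma> a = 0" if a: "a < n" for a
      proof (cases "a \<in> J")
        case True
        then show ?thesis using hJJ[of a a] h0 by simp
      next
        case False
        then have aI: "a \<in> I" using a split by auto
        have "\<gamma> a * K a a = 0" using Sk'[OF a aI] k0 aI by simp
        then show ?thesis using aI by (simp add: K_def)
      qed
      have dk: "d j = (\<Sum>i\<in>I. k j i *\<^sub>R d i)" if "j \<in> J" for j
        by (rule ker[OF _ that]) (simp add: Sd \<gamma>0)
      have sk: "d i \<bullet> V j + V i \<bullet> d j = 0" if "i \<in> I" "j \<in> I" for i j using hII[OF that] h0 by simp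
      obtain \<Omega> where \<Omega>: "transpose \<Omega> = - \<Omega>" "\<And>i. i \<in> I \<Longrightarrow> \<Omega> *v V i = d i"
        by (rule skew_extension[of I U V d]; (rule fin(1) | (rule U; assumption) | (rule sk; assumption) | (rule that; assumption)))
      have "d i = \<Omega> *v V i" if "i < n" for i
      proof (cases "i \<in> I")
        case False
        then have iJ: "i \<in> J" using that split by auto
        have "\<Omega> *v V i = (\<Sum>a\<in>I. k i a *\<^sub>R (\<Omega> *v V a))"
          unfolding Vk[OF iJ] by (simp add: linear_sum[OF matrix_vector_mul_linear] matrix_vector_mult_scaleR o_def)
        then show ?thesis using dk[OF iJ] \<Omega>(2) by simp
      qed (use \<Omega> in simp)
      then show False using nosk[OF \<Omega>(1)] by blast
    qed
    then have "x \<in> critical_params J" using \<Phi>h unfolding critical_params_def by blast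
    then show ?thesis using \<Phi>x J by blast
  qed
qed

text \<open>An index type large enough for the \<open>n (n + 1) / 2\<close> entries of a symmetric matrix when \<open>2 n < k\<^sup>2\<close>; the
  well-order is required by the library version of Sard's theorem.\<close>

typedef ('k::finite) idx = "{..<CARD('k) ^ 4}"
  by (rule exI[of _ 0]) simp

instantiation idx :: (finite) wellorder
begin

definition less_eq_idx :: "'a idx \<Rightarrow> 'a idx \<Rightarrow> bool" where "less_eq_idx x y \<longleftrightarrow> Rep_idx x \<le> Rep_idx y"

definition less_idx :: "'a idx \<Rightarrow> 'a idx \<Rightarrow> bool" where "less_idx x y \<longleftrightarrow> Rep_idx x < Rep_idx y"

instance
proof
  fix x y z :: "'a idx"
  show "x < y \<longleftrightarrow> x \<le> y \<and> \<not> y \<le> x" by (auto simp: less_eq_idx_def less_idx_def)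
  show "x \<le> x" by (simp add: less_eq_idx_def)
  show "x \<le> y \<Longrightarrow> y \<le> z \<Longrightarrow> x \<le> z" by (simp add: less_eq_idx_def)
  show "x \<le> y \<Longrightarrow> y \<le> x \<Longrightarrow> x = y" by (simp add: less_eq_idx_def Rep_idx_inject)
  show "x \<le> y \<or> y \<le> x" by (auto simp: less_eq_idx_def)
  fix P and a :: "'a idx"
  assume ind: "\<And>x::'a idx. (\<And>y. y < x \<Longrightarrow> P y) \<Longrightarrow> P x"
  show "P a" by (induction a rule: measure_induct_rule[of Rep_idx]) (auto intro: ind simp: less_idx_def)
qed

end

lemma card_UNIV_idx: "CARD('k::finite idx) = CARD('k) ^ 4"
  using type_definition.card[OF type_definition_idx[where 'k='k]] by simp

instance idx :: (finite) finite
proof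
  have "UNIV = (Abs_idx ` {..<CARD('a) ^ 4} :: 'a idx set)"
    by (auto simp: image_iff) (metis Rep_idx Rep_idx_inverse lessThan_iff)
  then show "finite (UNIV :: 'a idx set)" by (metis finite_imageI finite_lessThan)
qed

section \<open>Dropping the column norms, and the final null set\<close>

context sym_coords begin

definition positive_diag :: "(real^'m::_) set" where "positive_diag = {y. \<forall>i<n. entry y i i > 0}"

text \<open>Rescales columns of squared norm \<open>N i\<close> to unit norm and keeps \<open>ln (N i) / 2\<close> as a free coordinate.  A degenerate
  cost matrix therefore yields points of the negligible set for all values of these coordinates, which is
  what allows them to be dropped by Fubini.\<close>

definition \<Theta> :: "real^'m::_ \<Rightarrow> real^'m::_" where
  "\<Theta> y = mk (\<lambda>i j. if i = j then ln (entry y i i) / 2 else sqrt (entry y i i) * sqrt (entry y j j) * entry y i j) y"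

definition degenerate :: "(real^'m::_) set" where
  "degenerate = \<Theta> ` (positive_diag \<inter> (\<Union>J\<in>Pow {..<n}. \<Phi> J ` (singular_psd_block (Ic J) \<union> critical_params J)))"

lemma negligible_degenerate: "negligible degenerate"
  unfolding degenerate_def
proof (rule negligible_differentiable_image_negligible)
  have "negligible (\<Union>J\<in>Pow {..<n}. \<Phi> J ` (singular_psd_block (Ic J) \<union> critical_params J))"
    by (rule negligible_Union) (auto intro: negligible_\<Phi>_image)
  then show "negligible (positive_diag \<inter> (\<Union>J\<in>Pow {..<n}. \<Phi> J ` (singular_psd_block (Ic J) \<union> critical_params J)))"
    by (rule negligible_subset) auto
  have "\<exists>D. (\<Theta> has_derivative D) (at y within S)" if y: "y \<in> positive_diag" for y S
  proof -
    have ex: "\<exists>D. ((\<lambda>y. if i = j then ln (entry y i i) / 2 else sqrt (entry y i i) * sqrt (entry y j j) * entry y i j) has_derivative D) (at y within S)"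
      if "i \<le> j" "j < n" for i j
    proof -
      have p: "entry y i i > 0" "entry y j j > 0" using y that by (auto simp: positive_diag_def)
      have "(\<lambda>y. ln (entry y i i) / 2) differentiable at y within S"
        using p differentiableI[OF has_derivative_ln[OF p(1) entry_deriv]] by (intro derivative_intros) auto
      moreover have "(\<lambda>y. sqrt (entry y i i) * sqrt (entry y j j) * entry y i j) differentiable at y within S"
        using p differentiableI[OF has_derivative_real_sqrt[OF p(1) entry_deriv]] differentiableI[OF has_derivative_real_sqrt[OF p(2) entry_deriv]] differentiableI[OF entry_deriv]
        by (intro differentiable_mult) auto
      ultimately show ?thesis by (cases "i = j") (auto simp: differentiable_def)
    qed
    define D where "D i j = (SOME D. ((\<lambda>y. if i = j then ln (entry y i i) / 2 else sqrt (entry y i i) * sqrt (entry y j j) * entry y i j) has_derivative D) (at y within S))" for i j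
    have D: "((\<lambda>y. if i = j then ln (entry y i i) / 2 else sqrt (entry y i i) * sqrt (entry y j j) * entry y i j) has_derivative D i j) (at y within S)"
      if "i \<le> j" "j < n" for i j
      unfolding D_def by (rule someI_ex[OF ex[OF that]])
    show ?thesis unfolding \<Theta>_def[abs_def]
      by (rule exI, rule has_derivative_mk[where M'="\<lambda>h i j. D i j h"], rule D)
  qed
  then show "\<Theta> differentiable_on (positive_diag \<inter> (\<Union>J\<in>Pow {..<n}. \<Phi> J ` (singular_psd_block (Ic J) \<union> critical_params J)))"
    unfolding differentiable_on_def differentiable_def by blast
qed simp

text \<open>The diagonal of \<open>z\<close> is arbitrary: s_i = exp(z_ii) prescribes the column
  lengths. Scaling columns and \<open>d\<close> by s_i, C by 1 / (s_i s_j), and \<open>lam\<close>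
  and \<open>\<gamma>\<close> by 1 / s_i^2 preserves all equations, so the scaled data lie in the
  image of some \<open>\<Phi> J\<close>, and \<open>\<Theta>\<close> maps them back to
  \<open>z\<close>.\<close>

lemma degenerate_in_degenerate:
  fixes C :: "nat \<Rightarrow> nat \<Rightarrow> real" and V d :: "nat \<Rightarrow> real^'k" and lam \<gamma> :: "nat \<Rightarrow> real" and z :: "real^'m::_"
  assumes sym: "\<And>i j. C i j = C j i" and diag: "\<And>i. C i i = 0"
    and CV: "\<And>i. i < n \<Longrightarrow> (\<Sum>j<n. C i j *\<^sub>R V j) = lam i *\<^sub>R V i"
    and dV: "\<And>i. i < n \<Longrightarrow> d i \<bullet> V i = 0"
    and Cd: "\<And>i. i < n \<Longrightarrow> (\<Sum>j<n. C i j *\<^sub>R d j) - lam i *\<^sub>R d i = \<gamma> i *\<^sub>R V i"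
    and nosk: "\<And>\<Omega>. transpose \<Omega> = - \<Omega> \<Longrightarrow> \<exists>i<n. d i \<noteq> \<Omega> *v V i"
    and nV: "\<And>i. i < n \<Longrightarrow> V i \<bullet> V i = 1"
    and z: "\<And>i j. i < j \<Longrightarrow> j < n \<Longrightarrow> z $ e (i, j) = C i j"
  shows "z \<in> degenerate"
proof -
  define s where "s i = exp (z $ e (i, i))" for i
  have s: "s i > 0" for i by (simp add: s_def)
  define M where "M i j = (if i = j then s i * s i else C i j / (s i * s j))" for i j
  have symM: "M i j = M j i" for i j using sym[of i j] by (simp add: M_def mult.commute)
  define y where "y = mk M z"
  have cy: "entry y i j = M i j" if "i < n" "j < n" for i j unfolding y_def by (rule entry_mk[OF symM that])
  have "y \<in> positive_diag" using s by (auto simp: positive_diag_def cy M_def)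
  moreover have "\<exists>J\<subseteq>{..<n}. y \<in> \<Phi> J ` (singular_psd_block (Ic J) \<union> critical_params J)"
  proof (rule degenerate_in_image[where C="\<lambda>i j. C i j / (s i * s j)" and V="\<lambda>i. s i *\<^sub>R V i" and d="\<lambda>i. s i *\<^sub>R d i"
        and lam="\<lambda>i. lam i / (s i * s i)" and \<gamma>="\<lambda>i. \<gamma> i / (s i * s i)"])
    have sc: "(\<Sum>j<n. (C i j / (s i * s j)) *\<^sub>R (s j *\<^sub>R x j)) = (1 / s i) *\<^sub>R (\<Sum>j<n. C i j *\<^sub>R x j)" for i and x :: "nat \<Rightarrow> real^'k"
      unfolding scaleR_sum_right by (intro sum.cong refl) (use s in \<open>simp add: less_imp_neq[OF s, symmetric]\<close>)
    show "C i j / (s i * s j) = C j i / (s j * s i)" for i j using sym[of i j] by (simp add: mult.commute)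
    show "C i i / (s i * s i) = 0" for i by (simp add: diag)
    show "(\<Sum>j<n. (C i j / (s i * s j)) *\<^sub>R (s j *\<^sub>R V j)) = (lam i / (s i * s i)) *\<^sub>R (s i *\<^sub>R V i)" if "i < n" for i
      unfolding sc CV[OF that] using less_imp_neq[OF s[of i]] by simp
    show "(s i *\<^sub>R d i) \<bullet> (s i *\<^sub>R V i) = 0" if "i < n" for i using dV[OF that] by simp
    show "(\<Sum>j<n. (C i j / (s i * s j)) *\<^sub>R (s j *\<^sub>R d j)) - (lam i / (s i * s i)) *\<^sub>R (s i *\<^sub>R d i) = (\<gamma> i / (s i * s i)) *\<^sub>R (s i *\<^sub>R V i)" if "i < n" for i
    proof -
      have "(\<Sum>j<n. (C i j / (s i * s j)) *\<^sub>R (s j *\<^sub>R d j)) - (lam i / (s i * s i)) *\<^sub>R (s i *\<^sub>R d i) = (1 / s i) *\<^sub>R ((\<Sum>j<n. C i j *\<^sub>R d j) - lam i *\<^sub>R d i)"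
        unfolding sc using less_imp_neq[OF s[of i]] by (simp add: scaleR_diff_right)
      then show ?thesis unfolding Cd[OF that] using less_imp_neq[OF s[of i]] by simp
    qed
    show "\<exists>i<n. s i *\<^sub>R d i \<noteq> \<Omega> *v (s i *\<^sub>R V i)" if "transpose \<Omega> = - \<Omega>" for \<Omega>
      using nosk[OF that] s by (metis less_irrefl matrix_vector_mult_scaleR scaleR_left_imp_eq)
    show "y $ e (i, j) = C i j / (s i * s j)" if "i < j" "j < n" for i j
      using that by (simp add: y_def mk_e M_def)
    show "y $ e (i, i) = (s i *\<^sub>R V i) \<bullet> (s i *\<^sub>R V i)" if "i < n" for i
      using that nV[OF that] by (simp add: y_def mk_e M_def)
  qed
  moreover have "\<Theta> y = z"
    unfolding \<Theta>_def
  proof (rule mk_eqI)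
    fix i j assume ij: "i \<le> j" "j < n"
    then have "ln (s i * s i) / 2 = z $ e (i, i)" using s[of i] by (simp add: ln_mult) (simp add: s_def)
    then show "(if i = j then ln (entry y i i) / 2 else sqrt (entry y i i) * sqrt (entry y j j) * entry y i j) = z $ e (i, j)"
      using ij z[of i j] s[of i] s[of j] by (auto simp: cy M_def)
  qed (simp add: y_def mk_out)
  ultimately show ?thesis unfolding degenerate_def by blast
qed

end

text \<open>Dimension count: orthogonality to the k(k-1)/2 elementary skew matrices makes
  \<open>Z\<close> symmetric, orthogonality to the matrices v_i v_i^T gives the rest, and by
  \<open>card\<close> these are fewer than k^2 linear conditions.\<close>

lemma sym_matrix_annihilating:
  fixes v :: "'i::finite \<Rightarrow> real^'k"
  assumes card: "2 * card A < CARD('k) * CARD('k)"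
  obtains Z :: "real^'k^'k" where "Z \<noteq> 0" "transpose Z = Z" "\<And>i. i \<in> A \<Longrightarrow> (Z *v v i) \<bullet> v i = 0"
proof -
  obtain h :: "'k \<Rightarrow> nat" where h: "inj h" using finite_imp_inj_to_nat_seg[OF finite_class.finite_UNIV] by blast
  \<comment> \<open>The injection \<open>h\<close> only serves to order the index type, so that each
    pair of distinct indices is counted once.\<close>
  define Lo where "Lo = {(a, b). h a < h b}"
  define vv where "vv i = (\<chi> p q. v i $ p * v i $ q)" for i
  define E where "E = (\<lambda>(a, b). (\<chi> p q. (if p = a \<and> q = b then 1 else 0) - (if p = b \<and> q = a then 1 else 0)) :: real^'k^'k)"
  define B where "B = vv ` A \<union> E ` Lo"
  have cL: "2 * card Lo + CARD('k) = CARD('k) * CARD('k)"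
  proof -
    have U: "(UNIV :: ('k \<times> 'k) set) = Lo \<union> prod.swap ` Lo \<union> (\<lambda>a. (a, a)) ` UNIV"
      using h by (auto simp: Lo_def inj_def image_iff)
    have "card (UNIV :: ('k \<times> 'k) set) = card Lo + card (prod.swap ` Lo) + card ((\<lambda>a::'k. (a, a)) ` UNIV)"
      unfolding U by (subst card_Un_disjoint, auto simp: Lo_def, subst card_Un_disjoint, auto)
    moreover have "card (prod.swap ` Lo) = card Lo" by (rule card_image) simp
    moreover have "card ((\<lambda>a::'k. (a, a)) ` UNIV) = CARD('k)" by (rule card_image) (simp add: inj_def)
    moreover have "card (UNIV :: ('k \<times> 'k) set) = CARD('k) * CARD('k)" by (simp add: card_prod)
    ultimately show ?thesis by simp
  qed
  have fin: "finite A" "finite Lo" by auto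
  have "dim B \<le> card B" by (rule dim_le_card') (simp add: B_def fin)
  also have "\<dots> \<le> card A + card Lo"
    unfolding B_def using card_Un_le[of "vv ` A" "E ` Lo"] card_image_le[OF fin(1), of vv] card_image_le[OF fin(2), of E] by linarith
  also have "\<dots> < CARD('k) * CARD('k)" using card cL by linarith
  finally have "dim B < DIM(real^'k^'k)" by simp
  then obtain Z where Z: "Z \<noteq> 0" "\<And>y. y \<in> span B \<Longrightarrow> orthogonal Z y" by (rule orthogonal_to_subspace_exists) (rule that)
  have inner_mat: "X \<bullet> Y = (\<Sum>p\<in>UNIV. \<Sum>q\<in>UNIV. X $ p $ q * Y $ p $ q)" for X Y :: "real^'k^'k"
    by (simp add: inner_vec_def)
  show ?thesis
  proof (rule that[OF Z(1)])
    have lo: "Z $ a $ b = Z $ b $ a" if "h a < h b" for a b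
    proof -
      have "Z \<bullet> E (a, b) = 0" using Z(2)[of "E (a, b)"] that by (auto simp: B_def Lo_def orthogonal_def intro: span_base)
      moreover have "Z \<bullet> E (a, b) = Z $ a $ b - Z $ b $ a"
      proof -
        have delta: "(\<Sum>p\<in>UNIV. \<Sum>q\<in>UNIV. Z $ p $ q * (if p = a \<and> q = b then 1 else 0)) = Z $ a $ b" for a b
        proof -
          have "(\<Sum>p\<in>UNIV. \<Sum>q\<in>UNIV. Z $ p $ q * (if p = a \<and> q = b then 1 else 0)) = (\<Sum>p\<in>UNIV. if p = a then (\<Sum>q\<in>UNIV. if q = b then Z $ p $ q else 0) else 0)"
            by (intro sum.cong refl) (auto simp: if_distrib[of "\<lambda>r. _ * r"] cong: if_cong)
          then show ?thesis by simp
        qed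
        show ?thesis unfolding inner_mat E_def prod.case vec_lambda_beta right_diff_distrib sum_subtractf delta ..
      qed
      ultimately show ?thesis by simp
    qed
    have "Z $ a $ b = Z $ b $ a" for a b
    proof (cases "a = b")
      case False
      then have "h a < h b \<or> h b < h a" using h by (metis injD nat_neq_iff)
      then show ?thesis using lo by metis
    qed simp
    then show "transpose Z = Z" by (simp add: transpose_def vec_eq_iff)
    fix i assume "i \<in> A"
    then have "Z \<bullet> vv i = 0" using Z(2)[of "vv i"] by (auto simp: B_def orthogonal_def intro: span_base)
    moreover have "(Z *v v i) \<bullet> v i = Z \<bullet> vv i"
      unfolding inner_mat by (simp add: inner_vec_def matrix_vector_mult_def vv_def sum_distrib_left mult_ac)
    ultimately show "(Z *v v i) \<bullet> v i = 0" by simp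
  qed
qed

context mixing begin

lemma L_rot: "L v (rot R x) = rot R (L v x)"
proof -
  have "L v (rot R x) $ i = rot R (L v x) $ i" for i
    unfolding L_def G_rot by (simp add: rot_def matrix_vector_mult_diff_distrib matrix_vector_mult_scaleR)
  then show ?thesis by (simp add: vec_eq_iff[of "L v (rot R x)"])
qed

text \<open>For the symmetric \<open>Z\<close> of \<open>sym_matrix_annihilating\<close>,
  \<open>rot Z v\<close> is tangent and in the Hessian kernel, hence equal to
  \<open>rot \<Omega> v\<close> with skew \<Omega>. If the columns of \<open>v\<close> spanned the
  space, Z = \<Omega> would be both symmetric and skew, hence zero.\<close>

lemma crit_rank_deficient:
  fixes v :: "real^'k^'i"
  assumes v: "crit v" and morse_bott: "morse_bott v" and card: "2 * card A < CARD('k) * CARD('k)"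
  obtains u where "u \<noteq> 0" "\<And>i. u \<bullet> v $ i = 0"
proof (rule ccontr)
  assume no: "\<not> thesis"
  note wit = that
  have triv: "u = 0" if "\<And>i. u \<bullet> v $ i = 0" for u using wit[of u] that no by blast
  obtain Z :: "real^'k^'k" where Z: "Z \<noteq> 0" "transpose Z = Z" "\<And>i. i \<in> A \<Longrightarrow> (Z *v v $ i) \<bullet> v $ i = 0"
    using sym_matrix_annihilating[OF card, of "\<lambda>i. v $ i"] by blast
  have vc: "v \<in> configs" using v by (simp add: crit_def)
  have "(Z *v v $ i) \<bullet> v $ i = 0" for i using Z(3)[of i] configs_out[OF vc, of i] by (cases "i \<in> A") auto
  then have "rot Z v \<in> tangent v" using configs_out[OF vc] by (auto simp: tangent_def rot_def)
  moreover have "proj v (L v (rot Z v)) = 0"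
    unfolding L_rot crit_L[OF v] by (simp add: proj_def rot_def vec_eq_iff)
  ultimately obtain \<Omega> where \<Omega>: "transpose \<Omega> = - \<Omega>" "rot Z v = rot \<Omega> v" using morse_bott unfolding morse_bott_def by blast
  have "(Z - \<Omega>) $ p = 0" for p
  proof (rule triv)
    fix i
    have "(Z - \<Omega>) *v v $ i = 0"
      using \<Omega>(2) by (simp add: rot_def vec_eq_iff[of "\<chi> i. Z *v v $ i"] matrix_vector_mult_diff_rdistrib)
    then have "((Z - \<Omega>) *v v $ i) $ p = 0" by simp
    then show "(Z - \<Omega>) $ p \<bullet> v $ i = 0" by (simp add: matrix_vector_mul_component)
  qed
  then have "Z = \<Omega>" by (simp add: vec_eq_iff)
  then have "Z = - Z" using Z(2) \<Omega>(1) by simp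
  then have "Z $ p $ q = - Z $ p $ q" for p q by (metis vector_uminus_component)
  then have "Z = 0" by (simp add: vec_eq_iff)
  then show False using Z(1) by simp
qed

lemma crit_saddle_or_psd:
  fixes v :: "real^'k^'i"
  assumes v: "crit v" and morse_bott: "morse_bott v" and card: "2 * card A < CARD('k) * CARD('k)" and ns: "\<not> saddle v"
  shows "0 \<le> (\<Sum>i\<in>A. \<Sum>j\<in>A. z i * (c i j - (if i = j then lam v i else 0)) * z j)"
proof (rule ccontr)
  assume neg: "\<not> ?thesis"
  obtain u where u: "u \<noteq> 0" "\<And>i. u \<bullet> v $ i = 0" using crit_rank_deficient[OF v morse_bott card] by blast
  define E where "E = (\<chi> i. (if i \<in> A then z i else 0) *\<^sub>R u)"
  have Et: "E \<in> tangent v" using u by (simp add: tangent_def E_def)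
  have "E \<bullet> L v E = (\<Sum>i\<in>UNIV. (if i \<in> A then z i else 0) * ((\<Sum>j\<in>UNIV. c i j * (if j \<in> A then z j else 0)) - lam v i * (if i \<in> A then z i else 0)) * (u \<bullet> u))"
    unfolding inner_vec_def[of E] 
    by (intro sum.cong refl) (simp add: E_def L_def G_nth inner_diff_right inner_sum_right algebra_simps sum_distrib_left sum_distrib_right)
  also have "\<dots> = (\<Sum>i\<in>A. z i * ((\<Sum>j\<in>A. c i j * z j) - lam v i * z i) * (u \<bullet> u))"
  proof (rule sum.mono_neutral_cong_right)
    fix i assume "i \<in> A"
    have "(\<Sum>j\<in>UNIV. c i j * (if j \<in> A then z j else 0)) = (\<Sum>j\<in>A. c i j * z j)"
      by (rule sum.mono_neutral_cong_right) auto
    then show "(if i \<in> A then z i else 0) * ((\<Sum>j\<in>UNIV. c i j * (if j \<in> A then z j else 0)) - lam v i * (if i \<in> A then z i else 0)) * (u \<bullet> u) = z i * ((\<Sum>j\<in>A. c i j * z j) - lam v i * z i) * (u \<bullet> u)"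
      using \<open>i \<in> A\<close> by simp
  qed auto
  also have "\<dots> = (\<Sum>i\<in>A. z i * ((\<Sum>j\<in>A. c i j * z j) - lam v i * z i)) * (u \<bullet> u)" by (rule sum_distrib_right[symmetric])
  also have "(\<Sum>i\<in>A. z i * ((\<Sum>j\<in>A. c i j * z j) - lam v i * z i)) = (\<Sum>i\<in>A. \<Sum>j\<in>A. z i * (c i j - (if i = j then lam v i else 0)) * z j)"
  proof (rule sum.cong[OF refl])
    fix i assume i: "i \<in> A"
    have "(\<Sum>j\<in>A. z i * (c i j - (if i = j then lam v i else 0)) * z j) = (\<Sum>j\<in>A. z i * (c i j * z j)) - (\<Sum>j\<in>A. if i = j then z i * lam v i * z j else 0)"
      unfolding sum_subtractf[symmetric] by (intro sum.cong refl) (simp add: algebra_simps)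
    also have "\<dots> = z i * ((\<Sum>j\<in>A. c i j * z j) - lam v i * z i)"
      using i by (simp add: sum_distrib_left algebra_simps)
    finally show "z i * ((\<Sum>j\<in>A. c i j * z j) - lam v i * z i) = (\<Sum>j\<in>A. z i * (c i j - (if i = j then lam v i else 0)) * z j)" by simp
  qed
  finally have "E \<bullet> L v E < 0" using neg u(1) by (simp add: mult_neg_pos)
  then show False using ns v Et unfolding saddle_def by blast
qed

end

section \<open>Transfer to configurations indexed by natural numbers\<close>

locale embedded_mixing =
  fixes n :: nat and C :: "nat \<Rightarrow> nat \<Rightarrow> real" and \<theta> :: real and \<iota> :: "nat \<Rightarrow> 'i::finite"
  assumes C_sym: "C i j = C j i" and C_diag: "C i i = 0" and inj_\<iota>: "inj_on \<iota> {..<n}"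
    and \<theta>_gt_0: "\<theta> > 0" and \<theta>_col_norm1: "i < n \<Longrightarrow> \<theta> * col_norm1 n C i < 1"
begin

definition cc :: "'i \<Rightarrow> 'i \<Rightarrow> real" where
  "cc a b = (if a \<in> \<iota> ` {..<n} \<and> b \<in> \<iota> ` {..<n} then C (the_inv_into {..<n} \<iota> a) (the_inv_into {..<n} \<iota> b) else 0)"

lemma inv_\<iota>: "i < n \<Longrightarrow> the_inv_into {..<n} \<iota> (\<iota> i) = i"
  using the_inv_into_f_f[OF inj_\<iota>] by simp

lemma cc_\<iota>: "i < n \<Longrightarrow> j < n \<Longrightarrow> cc (\<iota> i) (\<iota> j) = C i j"
  by (simp add: cc_def inv_\<iota>)

lemma sum_\<iota>: "(\<Sum>a\<in>\<iota> ` {..<n}. g a) = (\<Sum>i<n. g (\<iota> i))"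
  using sum.reindex[OF inj_\<iota>, of g] by simp

lemma sum_cc:
  fixes x :: "'i \<Rightarrow> 'v::real_vector"
  shows "i < n \<Longrightarrow> (\<Sum>b\<in>UNIV. cc (\<iota> i) b *\<^sub>R x b) = (\<Sum>j<n. C i j *\<^sub>R x (\<iota> j))"
proof -
  assume i: "i < n"
  have "(\<Sum>b\<in>UNIV. cc (\<iota> i) b *\<^sub>R x b) = (\<Sum>b\<in>\<iota> ` {..<n}. cc (\<iota> i) b *\<^sub>R x b)"
    by (rule sum.mono_neutral_right) (auto simp: cc_def)
  also have "\<dots> = (\<Sum>j<n. C i j *\<^sub>R x (\<iota> j))" unfolding sum_\<iota> using i by (intro sum.cong refl) (simp add: cc_\<iota>)
  finally show ?thesis .
qed

sublocale mixing "\<iota> ` {..<n}" cc \<theta> "map \<iota> [0..<n]"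
proof
  show "cc a b = cc b a" for a b using C_sym by (simp add: cc_def)
  show "cc a a = 0" for a using C_diag by (simp add: cc_def)
  show "cc a b = 0" if "a \<notin> \<iota> ` {..<n}" for a b using that by (simp add: cc_def)
  show "set (map \<iota> [0..<n]) = \<iota> ` {..<n}" by (simp add: atLeast0LessThan)
  show "distinct (map \<iota> [0..<n])" using inj_\<iota> by (simp add: distinct_map atLeast0LessThan)
  show "\<theta> > 0" by (rule \<theta>_gt_0)
  show "\<theta> * (\<Sum>b\<in>UNIV. \<bar>cc a b\<bar>) < 1" for a
  proof (cases "a \<in> \<iota> ` {..<n}")
    case True
    then obtain i where i: "i < n" "a = \<iota> i" by auto
    have "(\<Sum>b\<in>UNIV. \<bar>cc a b\<bar>) = (\<Sum>b\<in>\<iota> ` {..<n}. \<bar>cc a b\<bar>)"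
      by (rule sum.mono_neutral_right) (auto simp: cc_def)
    also have "\<dots> = col_norm1 n C i"
      unfolding sum_\<iota> col_norm1_def i(2) using i by (intro sum.cong refl) (simp add: cc_\<iota> C_sym[of i])
    finally show ?thesis using \<theta>_col_norm1[OF i(1)] by simp
  next
    case False
    then show ?thesis by (simp add: cc_def)
  qed
qed

definition emb :: "(nat \<Rightarrow> real^'k) \<Rightarrow> real^'k^'i" where
  "emb V = (\<chi> a. if a \<in> \<iota> ` {..<n} then V (the_inv_into {..<n} \<iota> a) else 0)"

lemma emb_\<iota>: "i < n \<Longrightarrow> emb V $ \<iota> i = V i" and emb_out: "a \<notin> \<iota> ` {..<n} \<Longrightarrow> emb V $ a = 0"
  by (simp_all add: emb_def inv_\<iota>)

lemma vec_eq_\<iota>I: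
  fixes x y :: "real^'k^'i"
  assumes "\<And>i. i < n \<Longrightarrow> x $ \<iota> i = y $ \<iota> i" "\<And>a. a \<notin> \<iota> ` {..<n} \<Longrightarrow> x $ a = y $ a"
  shows "x = y"
proof -
  have "x $ a = y $ a" for a using assms by (cases "a \<in> \<iota> ` {..<n}") auto
  then show ?thesis by (simp add: vec_eq_iff)
qed

lemma emb_step:
  assumes i: "i < n"
  shows "emb (mix_step n C \<theta> V i) = step_map (\<iota> i) (emb V)"
proof (rule vec_eq_\<iota>I)
  have w: "emb V $ \<iota> i - \<theta> *\<^sub>R G (emb V) $ \<iota> i = V i - \<theta> *\<^sub>R (\<Sum>j<n. C i j *\<^sub>R V j)"
    unfolding G_nth sum_cc[OF i] emb_\<iota>[OF i] by (simp add: emb_\<iota>)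
  fix j assume j: "j < n"
  have "\<iota> j = \<iota> i \<longleftrightarrow> j = i" using inj_\<iota> i j by (auto simp: inj_on_def)
  then show "emb (mix_step n C \<theta> V i) $ \<iota> j = step_map (\<iota> i) (emb V) $ \<iota> j"
    using i j unfolding emb_\<iota>[OF j] step_map_nth w by (auto simp: mix_step_def Let_def sgn_div_norm divide_inverse emb_\<iota>)
next
  fix a assume "a \<notin> \<iota> ` {..<n}"
  then show "emb (mix_step n C \<theta> V i) $ a = step_map (\<iota> i) (emb V) $ a" using i by (auto simp: emb_out step_map_nth)
qed

lemma emb_sweep: "emb (mix_sweep n C \<theta> V) = sweep (emb V)"
proof -
  have "emb (fold (\<lambda>i W. mix_step n C \<theta> W i) ys V) = fold step_map (map \<iota> ys) (emb V)" if "set ys \<subseteq> {..<n}" for ys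
    using that by (induction ys arbitrary: V) (auto simp: emb_step)
  from this[of "[0..<n]"] show ?thesis by (simp add: mix_sweep_def sweep_def atLeast0LessThan)
qed

lemma emb_iter: "emb (mix_iter n C \<theta> V t) = (sweep ^^ t) (emb V)"
  unfolding mix_iter_def by (induction t) (auto simp: emb_sweep)

lemma crit_C_sum:
  assumes v: "crit v" and i: "i < n"
  shows "(\<Sum>j<n. C i j *\<^sub>R v $ \<iota> j) = lam v (\<iota> i) *\<^sub>R v $ \<iota> i"
  using crit_G[OF v, of "\<iota> i"] unfolding G_nth sum_cc[OF i] .

text \<open>Weak duality, with the multipliers as dual certificate: on the feasible set <C, X> is
  <S, X> plus the constant sum of the \<open>l i\<close>, the first term is nonnegative by
  \<open>psd_frob_nonneg\<close>, and it is zero at the Gram matrix of \<open>v\<close>.\<close>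

lemma global_opt_if_psd:
  assumes v: "crit v"
    and psd: "\<And>z. 0 \<le> (\<Sum>a\<in>\<iota> ` {..<n}. \<Sum>b\<in>\<iota> ` {..<n}. z a * (cc a b - (if a = b then lam v a else 0)) * z b)"
  shows "global_opt n C (\<lambda>i. v $ \<iota> i)"
proof -
  have vc: "v \<in> configs" using v by (simp add: crit_def)
  define l where "l i = lam v (\<iota> i)" for i
  define S where "S i j = C i j - (if i = j then l i else 0)" for i j
  have "psd n S"
    unfolding psd_def
  proof (intro conjI allI impI)
    show "S i j = S j i" for i j using C_sym[of i j] by (simp add: S_def)
    fix x :: "nat \<Rightarrow> real"
    have "0 \<le> (\<Sum>i<n. \<Sum>j<n. x (the_inv_into {..<n} \<iota> (\<iota> i)) * (cc (\<iota> i) (\<iota> j) - (if \<iota> i = \<iota> j then lam v (\<iota> i) else 0)) * x (the_inv_into {..<n} \<iota> (\<iota> j)))"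
      using psd[of "\<lambda>a. x (the_inv_into {..<n} \<iota> a)"] unfolding sum_\<iota> .
    also have "\<dots> = (\<Sum>i<n. \<Sum>j<n. x i * S i j * x j)"
    proof (intro sum.cong refl)
      fix i j assume ij: "i \<in> {..<n}" "j \<in> {..<n}"
      then have "\<iota> i = \<iota> j \<longleftrightarrow> i = j" using inj_\<iota> by (auto simp: inj_on_def)
      then show "x (the_inv_into {..<n} \<iota> (\<iota> i)) * (cc (\<iota> i) (\<iota> j) - (if \<iota> i = \<iota> j then lam v (\<iota> i) else 0)) * x (the_inv_into {..<n} \<iota> (\<iota> j)) = x i * S i j * x j"
        using ij by (simp add: inv_\<iota> cc_\<iota> S_def l_def)
    qed
    finally show "0 \<le> (\<Sum>i<n. \<Sum>j<n. x i * S i j * x j)" .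
  qed
  have fS: "frob n S X = frob n C X - (\<Sum>i<n. l i * X i i)" for X
  proof -
    have "(\<Sum>j<n. S i j * X i j) = (\<Sum>j<n. C i j * X i j) - l i * X i i" if "i < n" for i
      using that by (simp add: S_def left_diff_distrib sum_subtractf if_distrib[of "\<lambda>r. r * _"] cong: if_cong)
    then show ?thesis by (simp add: frob_def sum_subtractf)
  qed
  show ?thesis
    unfolding global_opt_def
  proof (intro conjI allI impI)
    show nv: "norm (v $ \<iota> i) = 1" if "i < n" for i using configs_norm[OF vc] that by simp
    fix X assume X: "psd n X \<and> (\<forall>i<n. X i i = 1)"
    have "frob n C (gram (\<lambda>i. v $ \<iota> i)) = (\<Sum>i<n. l i)"
    proof -
      have "(\<Sum>j<n. C i j * (v $ \<iota> i \<bullet> v $ \<iota> j)) = l i" if i: "i < n" for i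
      proof -
        have "(\<Sum>j<n. C i j * (v $ \<iota> i \<bullet> v $ \<iota> j)) = v $ \<iota> i \<bullet> (\<Sum>j<n. C i j *\<^sub>R v $ \<iota> j)" by (simp add: inner_sum_right)
        also have "\<dots> = l i" unfolding crit_C_sum[OF v i] using nv[OF i] by (simp add: l_def norm_eq_1)
        finally show ?thesis .
      qed
      then show ?thesis by (simp add: frob_def gram_def)
    qed
    also have "\<dots> \<le> frob n C X"
      using psd_frob_nonneg[OF \<open>psd n S\<close>, of X] X by (simp add: fS)
    finally show "frob n C (gram (\<lambda>i. v $ \<iota> i)) \<le> frob n C X" .
  qed
qed

text \<open>A vanishing projection of \<open>L v d\<close> means that each of its columns is a
  multiple of the column of \<open>v\<close>; these multiples are the \<gamma> of
  \<open>degenerate_in_degenerate\<close>. Only off-diagonal coordinates of \<open>z\<close> are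
  prescribed.\<close>

lemma morse_bott_if_not_degenerate:
  fixes e :: "nat \<times> nat \<Rightarrow> 'm::{finite,wellorder}" and v :: "real^'k^'i"
  assumes e: "sym_coords n e" and z: "z \<notin> sym_coords.degenerate n e" "\<And>i j. i < j \<Longrightarrow> j < n \<Longrightarrow> z $ e (i, j) = C i j"
    and v: "crit v"
  shows "morse_bott v"
proof (rule ccontr)
  assume "\<not> morse_bott v"
  then obtain d where d: "d \<in> tangent v" "proj v (L v d) = 0" and nosk: "\<And>\<Omega>. transpose \<Omega> = - \<Omega> \<Longrightarrow> d \<noteq> rot \<Omega> v"
    unfolding morse_bott_def by blast
  have vc: "v \<in> configs" using v by (simp add: crit_def)
  have "z \<in> sym_coords.degenerate n e"
  proof (rule sym_coords.degenerate_in_degenerate[OF e, where C=C and V="\<lambda>i. v $ \<iota> i" and d="\<lambda>i. d $ \<iota> i" and lam="\<lambda>i. lam v (\<iota> i)"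
        and \<gamma>="\<lambda>i. L v d $ \<iota> i \<bullet> v $ \<iota> i"])
    show "C i j = C j i" for i j by (rule C_sym)
    show "C i i = 0" for i by (rule C_diag)
    show "(\<Sum>j<n. C i j *\<^sub>R v $ \<iota> j) = lam v (\<iota> i) *\<^sub>R v $ \<iota> i" if "i < n" for i by (rule crit_C_sum[OF v that])
    show "d $ \<iota> i \<bullet> v $ \<iota> i = 0" for i using d(1) by (simp add: tangent_def)
    show "(\<Sum>j<n. C i j *\<^sub>R d $ \<iota> j) - lam v (\<iota> i) *\<^sub>R d $ \<iota> i = (L v d $ \<iota> i \<bullet> v $ \<iota> i) *\<^sub>R v $ \<iota> i" if i: "i < n" for i
    proof -
      have "proj v (L v d) $ \<iota> i = 0" using d(2) by simp
      then have "L v d $ \<iota> i = (L v d $ \<iota> i \<bullet> v $ \<iota> i) *\<^sub>R v $ \<iota> i" by (simp add: proj_def)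
      moreover have "L v d $ \<iota> i = (\<Sum>j<n. C i j *\<^sub>R d $ \<iota> j) - lam v (\<iota> i) *\<^sub>R d $ \<iota> i"
        unfolding sum_cc[OF i, of "\<lambda>b. d $ b", symmetric] by (simp add: L_def G_nth)
      ultimately show ?thesis by simp
    qed
    show "\<exists>i<n. d $ \<iota> i \<noteq> \<Omega> *v v $ \<iota> i" if "transpose \<Omega> = - \<Omega>" for \<Omega>
    proof (rule ccontr)
      assume no: "\<not> ?thesis"
      have "d = rot \<Omega> v"
      proof (rule vec_eq_\<iota>I)
        show "d $ \<iota> i = rot \<Omega> v $ \<iota> i" if "i < n" for i using no that by (simp add: rot_def)
        show "d $ a = rot \<Omega> v $ a" if "a \<notin> \<iota> ` {..<n}" for a
          using that d(1) configs_out[OF vc that] by (simp add: tangent_def rot_def)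
      qed
      then show False using nosk[OF that] by blast
    qed
    show "v $ \<iota> i \<bullet> v $ \<iota> i = 1" if "i < n" for i using configs_norm[OF vc, of "\<iota> i"] that by (simp add: norm_eq_1)
  qed (rule z(2))
  then show False using z(1) by blast
qed

text \<open>Columns of \<open>X\<close> outside the image of \<iota> are arbitrary;
  \<open>normalized\<close> erases them, so the orbit of \<open>X\<close> is that of
  \<open>W\<close>.\<close>

lemma converges_if_no_saddle_limit:
  fixes X :: "real^'k^'i"
  assumes X: "X \<in> nonzero_cols" and XW: "\<And>i. i < n \<Longrightarrow> X $ \<iota> i = W i"
    and ns: "\<not> (\<exists>v. saddle v \<and> (\<lambda>t. (sweep ^^ t) (normalized X)) \<longlonglongrightarrow> v)"
    and morse_bott: "\<And>v::real^'k^'i. crit v \<Longrightarrow> morse_bott v" and card: "2 * n < CARD('k) * CARD('k)"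
  shows "converges_to_global_opt n C \<theta> (\<lambda>i. sgn (W i))"
proof -
  have emb: "emb (\<lambda>i. sgn (W i)) = normalized X"
  proof (rule vec_eq_\<iota>I)
    show "emb (\<lambda>i. sgn (W i)) $ \<iota> i = normalized X $ \<iota> i" if "i < n" for i using that by (simp add: emb_\<iota> normalized_nth XW)
    show "emb (\<lambda>i. sgn (W i)) $ a = normalized X $ a" if "a \<notin> \<iota> ` {..<n}" for a using that by (simp add: emb_out normalized_nth)
  qed
  obtain v where v: "crit v" "(\<lambda>t. (sweep ^^ t) (normalized X)) \<longlonglongrightarrow> v"
    using mixing_convergence[OF normalized_configs[OF X] morse_bott] by blast
  have "card (\<iota> ` {..<n}) = n" using inj_\<iota> by (simp add: card_image)
  then have "global_opt n C (\<lambda>i. v $ \<iota> i)"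
    using crit_saddle_or_psd[OF v(1) morse_bott[OF v(1)]] ns v card by (intro global_opt_if_psd[OF v(1)]) auto
  moreover have "(\<lambda>t. mix_iter n C \<theta> (\<lambda>i. sgn (W i)) t i) \<longlonglongrightarrow> v $ \<iota> i" if i: "i < n" for i
  proof -
    have "mix_iter n C \<theta> (\<lambda>i. sgn (W i)) t i = (sweep ^^ t) (normalized X) $ \<iota> i" for t
      using emb_iter[of "\<lambda>i. sgn (W i)" t] emb_\<iota>[OF i, of "mix_iter n C \<theta> (\<lambda>i. sgn (W i)) t"] emb by simp
    then show ?thesis using tendsto_vec_nth[OF v(2), of "\<iota> i"] by simp
  qed
  ultimately show ?thesis unfolding converges_to_global_opt_def by (intro exI[of _ "\<lambda>i. v $ \<iota> i"]) simp
qed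

lemma negligible_not_nonzero_cols: "negligible (- nonzero_cols :: (real^'k^'i) set)"
proof -
  have "- nonzero_cols = (\<Union>a\<in>\<iota> ` {..<n}. {W :: real^'k^'i. W $ a = 0})" by (auto simp: nonzero_cols_def)
  moreover have "negligible {W :: real^'k^'i. W $ a = 0}" for a
  proof (rule negligible_subset[OF negligible_hyperplane])
    show "(axis a (axis undefined 1) :: real^'k^'i) \<noteq> 0 \<or> (0::real) \<noteq> 0" by (simp add: axis_eq_0_iff)
    show "{W :: real^'k^'i. W $ a = 0} \<subseteq> {W. axis a (axis undefined 1) \<bullet> W = 0}" by (auto simp: inner_axis')
  qed
  ultimately show ?thesis by (auto intro!: negligible_Union)
qed

end

theorem theorem3:
  fixes n :: nat
  assumes "real CARD('k) > sqrt (2 * real n)"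
  shows "AE u in cost_space n.
           \<forall>\<theta>. 0 < \<theta> \<and> \<theta> < 1 / max_col_norm1 n (sym_zero_diag u) \<longrightarrow>
             (AE W in (init_space n :: (nat \<Rightarrow> real ^ 'k) measure).
                converges_to_global_opt n (sym_zero_diag u) \<theta> (\<lambda>i. sgn (W i)))"
proof -
  have "(sqrt (2 * real n))\<^sup>2 < (real CARD('k))\<^sup>2" using assms by (intro power_strict_mono) auto
  then have "real (2 * n) < real (CARD('k) * CARD('k))" by (simp add: power2_eq_square)
  then have card: "2 * n < CARD('k) * CARD('k)" by (simp only: of_nat_less_iff)
  \<comment> \<open>Room in \<open>'k idx\<close>, which has k^4 elements: the triangle
    \<open>P\<close> has at most n^2 pairs. The same type also indexes the columns.\<close>
  have le4: "n * n \<le> CARD('k) ^ 4"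
  proof -
    have "n * n \<le> (CARD('k) * CARD('k)) * (CARD('k) * CARD('k))" using card by (intro mult_mono) auto
    then show ?thesis by (simp add: power4_eq_xxxx mult.assoc)
  qed
  define P where "P = {(i, j). i \<le> j \<and> j < n}"
  have P: "P \<subseteq> {..<n} \<times> {..<n}" by (auto simp: P_def)
  have finP: "finite P" using P finite_subset by blast
  have "card P \<le> n * n" using card_mono[OF _ P] by (simp add: card_cartesian_product)
  then have "card P \<le> CARD('k idx)" using le4 by (simp add: card_UNIV_idx)
  then obtain e :: "nat \<times> nat \<Rightarrow> 'k idx" where e: "inj_on e P"
    using card_le_inj[OF finP finite_class.finite_UNIV] by blast
  have "n \<le> CARD('k idx)" using le_trans[OF le_square le4] by (simp add: card_UNIV_idx)
  then obtain \<iota> :: "nat \<Rightarrow> 'k idx" where \<iota>: "inj_on \<iota> {..<n}"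
    using card_le_inj[of "{..<n}" "UNIV :: 'k idx set"] by auto
  interpret E: sym_coords n e by standard (use e in \<open>simp add: P_def\<close>)
  define I where "I = {(i::nat, j). i < j \<and> j < n}"
  have I: "I \<subseteq> P" by (auto simp: I_def P_def)
  have "AE u in PiM I (\<lambda>_. lborel). \<exists>x. (\<forall>p\<in>I. x $ e p = u p) \<and> x \<notin> E.degenerate"
    using finite_subset[OF I finP] inj_on_subset[OF e I] E.negligible_degenerate by (rule AE_PiM_of_negligible)
  then have "AE u in cost_space n. \<exists>x. (\<forall>p\<in>I. x $ e p = u p) \<and> x \<notin> E.degenerate" unfolding cost_space_def I_def[symmetric] .
  then show ?thesis
  proof eventually_elim
    case (elim u)
    \<comment> \<open>\<open>x\<close> completes the off-diagonal entries by some diagonal and spare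
      coordinates outside the null set. It is fixed before \<theta>, since degeneracy involves
      \<open>C\<close> alone.\<close>
    then obtain x where x: "\<And>i j. i < j \<Longrightarrow> j < n \<Longrightarrow> x $ e (i, j) = u (i, j)" "x \<notin> E.degenerate" by (auto simp: I_def)
    define C where "C = sym_zero_diag u"
    show ?case
      unfolding C_def[symmetric]
    proof (intro allI impI)
      fix \<theta> :: real assume \<theta>: "0 < \<theta> \<and> \<theta> < 1 / max_col_norm1 n C"
      have \<theta>1: "\<theta> * col_norm1 n C i < 1" if "i < n" for i
      proof -
        have "col_norm1 n C i \<le> max_col_norm1 n C" unfolding max_col_norm1_def using that by (intro Max_ge) auto
        then have "\<theta> * col_norm1 n C i \<le> \<theta> * max_col_norm1 n C" using \<theta> by (intro mult_left_mono) auto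
        also have "\<dots> < 1"
        proof -
          \<comment> \<open>As 1/0 = 0 in HOL, an admissible \<theta> forces
            \<open>max_col_norm1 n C\<close> to be positive.\<close>
          have "0 < 1 / max_col_norm1 n C" using \<theta> by linarith
          then have "0 < max_col_norm1 n C" by simp
          then show ?thesis using \<theta> by (simp add: pos_less_divide_eq)
        qed
        finally show ?thesis .
      qed
      interpret embedded_mixing n C \<theta> \<iota>
        by standard (use \<iota> \<theta> \<theta>1 in \<open>auto simp: C_def sym_zero_diag_def\<close>)
      have morse_bott: "morse_bott v" if "crit v" for v :: "real^'k^'k idx"
        using morse_bott_if_not_degenerate[OF E.sym_coords_axioms x(2) _ that] x(1) by (simp add: C_def sym_zero_diag_def)
      \<comment> \<open>Points with a zero column cannot be normalised to a configuration; they are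
        null and join the exceptional set.\<close>
      have "negligible ({X :: real^'k^'k idx. X \<in> nonzero_cols \<and> (\<exists>v. saddle v \<and> (\<lambda>t. (sweep ^^ t) (normalized X)) \<longlonglongrightarrow> v)} \<union> - nonzero_cols)"
        using saddle_avoidance negligible_not_nonzero_cols by (rule negligible_Un)
      from AE_PiM_of_negligible[OF finite_lessThan \<iota> this]
      show "AE W in (init_space n :: (nat \<Rightarrow> real ^ 'k) measure). converges_to_global_opt n C \<theta> (\<lambda>i. sgn (W i))"
        unfolding init_space_def
      proof eventually_elim
        case (elim W)
        then obtain X where X: "\<And>i. i < n \<Longrightarrow> X $ \<iota> i = W i" "X \<in> nonzero_cols" "\<not> (\<exists>v. saddle v \<and> (\<lambda>t. (sweep ^^ t) (normalized X)) \<longlonglongrightarrow> v)"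
          by auto
        show ?case by (rule converges_if_no_saddle_limit[OF X(2,1,3) morse_bott card])
      qed
    qed
  qed
qed

end
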